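(* The following statements are equivalent for every cardinal $\kappa$: (i) $\kappa$ is supercompact. (ii) For all cardinals $\lambda\geq\kappa$, all sufficiently large cardinals $\theta$ and every $\mathcal{P}_\kappa(\lambda)$-list $\vec d=\langle d_a\mid a\in\mathcal{P}_\kappa(\lambda)\rangle$, there is a small embedding $j:M\longrightarrow \mathrm{H}(\theta)$ for $\kappa$ such that $|M|<\kappa$, $\lambda,\vec d\in\mathrm{ran}(j)$, and $j^{-1}[d_{\mathrm{ran}(j)\cap\lambda}]\in M$. (iii) For all sufficiently large cardinals $\theta$, there is a small embedding $j:M\longrightarrow \mathrm{H}(\theta)$ for $\kappa$ such that $|M|<\kappa$ and $j^{-1}[d_{\mathrm{ran}(j)\cap\lambda}]\in M$ for every cardinal $\lambda\geq\kappa$ and every $\mathcal{P}_\kappa(\lambda)$-list $\vec d=\langle d_a\mid a\in\mathcal{P}_\kappa(\lambda)\rangle$ with $\lambda,\vec d\in\mathrm{ran}(j)$.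
   Context: $\mathrm{H}(\theta)$ is the set of all sets whose transitive closure has cardinality less than $\theta$. An elementary embedding $j:M\to N$ between transitive classes is non-trivial if there is an ordinal $\alpha\in M$ with $j(\alpha)>\alpha$; then $\mathrm{crit}(j)$ denotes the least such ordinal. Given cardinals $\kappa<\theta$, a non-trivial elementary embedding $j:M\to \mathrm{H}(\theta)$ is a small embedding for $\kappa$ if $M\in \mathrm{H}(\theta)$ is transitive and $j(\mathrm{crit}(j))=\kappa$. "For all sufficiently large cardinals $\theta$" means: there is an ordinal $\alpha\geq\kappa$ such that the statement holds for all cardinals $\theta>\alpha$ (in (ii), $\alpha$ may depend on $\lambda$). $\mathcal{P}_\kappa(\lambda)$ is the set of all subsets of $\lambda$ of cardinality less than $\kappa$. Given a set $A$, an $A$-list is a sequence $\langle d_a\mid a\in A\rangle$ with $d_a\subseteq a$ for all $a\in A$. $j^{-1}[\,\cdot\,]$ denotes the pointwise preimage. *)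

theory Defs
  imports "HOL-Library.Equipollence" "HOL-Library.Countable_Set"
begin

(* The set-theoretic universe is a type satisfying ZFC; elts x is the class of members of x.
   Separation and Replacement range over arbitrary predicates and functions of HOL, so every
   class ('a set) contained in a set is a set, and two sets are equinumerous in the universe iff
   their extensions are equinumerous in HOL. Choice is not listed because it follows from
   Separation and the choice operator of HOL. *)
class zfc_universe =
  fixes elts :: "'a \<Rightarrow> 'a set"
  assumes extensionality: "elts x = elts y \<Longrightarrow> x = y"
    and foundation: "wf {(x, y). x \<in> elts y}"
    and pairing: "\<exists>z. elts z = {x, y}"
    and union: "\<exists>u. elts u = (\<Union>y\<in>elts x. elts y)"
    and power_set: "\<exists>p. elts p = {y. elts y \<subseteq> elts x}"
    and infinity: "\<exists>w. (\<exists>e\<in>elts w. elts e = {}) \<and>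
                        (\<forall>n\<in>elts w. \<exists>m\<in>elts w. elts m = insert n (elts n))"
    and separation: "\<exists>z. elts z = {y \<in> elts x. P y}"
    and replacement: "\<exists>z. elts z = f ` elts x"

(* Meaningful only for classes X that are sets. *)
definition mkset :: "'v set \<Rightarrow> 'v::zfc_universe" where
  "mkset X = (THE x. elts x = X)"

definition kpair :: "'v \<Rightarrow> 'v \<Rightarrow> 'v::zfc_universe" where
  "kpair a b = mkset {mkset {a}, mkset {a, b}}"

definition function_on :: "'v::zfc_universe \<Rightarrow> 'v set \<Rightarrow> bool" where
  "function_on d A \<longleftrightarrow> (\<exists>f. elts d = (\<lambda>a. kpair a (f a)) ` A)"

definition app :: "'v \<Rightarrow> 'v \<Rightarrow> 'v::zfc_universe" where
  "app d a = (THE b. kpair a b \<in> elts d)"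

definition Transset :: "'v::zfc_universe \<Rightarrow> bool" where
  "Transset x \<longleftrightarrow> (\<forall>y\<in>elts x. elts y \<subseteq> elts x)"

(* For ordinals, the order < is membership and \<le> is inclusion of extensions. *)
definition Ord :: "'v::zfc_universe \<Rightarrow> bool" where
  "Ord \<alpha> \<longleftrightarrow> Transset \<alpha> \<and> (\<forall>\<beta>\<in>elts \<alpha>. Transset \<beta>)"

(* Initial ordinals, finite ones included. For a cardinal \<kappa>, |x| < \<kappa> is elts x \<prec> elts \<kappa>. *)
definition Card :: "'v::zfc_universe \<Rightarrow> bool" where
  "Card \<kappa> \<longleftrightarrow> Ord \<kappa> \<and> (\<forall>\<alpha>\<in>elts \<kappa>. \<not> elts \<alpha> \<approx> elts \<kappa>)"

definition TC :: "'v::zfc_universe \<Rightarrow> 'v set" where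
  "TC x = {y. (y, x) \<in> {(a, b). a \<in> elts b}\<^sup>+}"

definition Hset :: "'v::zfc_universe \<Rightarrow> 'v set" where
  "Hset \<theta> = {x. TC x \<prec> elts \<theta>}"

definition Pkappa :: "'v::zfc_universe \<Rightarrow> 'v \<Rightarrow> 'v set" where
  "Pkappa \<kappa> A = {a. elts a \<subseteq> elts A \<and> elts a \<prec> elts \<kappa>}"

definition is_list :: "'v set \<Rightarrow> 'v::zfc_universe \<Rightarrow> bool" where
  "is_list A d \<longleftrightarrow> function_on d A \<and> (\<forall>a\<in>A. elts (app d a) \<subseteq> elts a)"

datatype fm = Mem nat nat | Equal nat nat | Neg fm | And fm fm | Forall nat fm

primrec sat :: "'v::zfc_universe set \<Rightarrow> fm \<Rightarrow> (nat \<Rightarrow> 'v) \<Rightarrow> bool" where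
  "sat M (Mem m n) e \<longleftrightarrow> e m \<in> elts (e n)"
| "sat M (Equal m n) e \<longleftrightarrow> e m = e n"
| "sat M (Neg p) e \<longleftrightarrow> \<not> sat M p e"
| "sat M (And p q) e \<longleftrightarrow> sat M p e \<and> sat M q e"
| "sat M (Forall n p) e \<longleftrightarrow> (\<forall>x\<in>M. sat M p (e(n := x)))"

(* Only the values of j on M matter, here and below. *)
definition elementary_embedding ::
    "'v::zfc_universe set \<Rightarrow> 'v set \<Rightarrow> ('v \<Rightarrow> 'v) \<Rightarrow> bool" where
  "elementary_embedding M N j \<longleftrightarrow> j ` M \<subseteq> N \<and>
     (\<forall>p e. range e \<subseteq> M \<longrightarrow> (sat M p e \<longleftrightarrow> sat N p (j \<circ> e)))"

definition moved :: "'v::zfc_universe set \<Rightarrow> ('v \<Rightarrow> 'v) \<Rightarrow> 'v \<Rightarrow> bool" where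
  "moved M j \<alpha> \<longleftrightarrow> \<alpha> \<in> M \<and> Ord \<alpha> \<and> \<alpha> \<in> elts (j \<alpha>)"

definition nontrivial :: "'v::zfc_universe set \<Rightarrow> ('v \<Rightarrow> 'v) \<Rightarrow> bool" where
  "nontrivial M j \<longleftrightarrow> (\<exists>\<alpha>. moved M j \<alpha>)"

definition crit :: "'v::zfc_universe set \<Rightarrow> ('v \<Rightarrow> 'v) \<Rightarrow> 'v" where
  "crit M j = (THE \<alpha>. moved M j \<alpha> \<and> (\<forall>\<beta>. moved M j \<beta> \<longrightarrow> elts \<alpha> \<subseteq> elts \<beta>))"

definition small_embedding ::
    "'v::zfc_universe \<Rightarrow> 'v \<Rightarrow> 'v \<Rightarrow> ('v \<Rightarrow> 'v) \<Rightarrow> bool" where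
  "small_embedding \<kappa> \<theta> M j \<longleftrightarrow>
     Card \<kappa> \<and> Card \<theta> \<and> \<kappa> \<in> elts \<theta> \<and>
     M \<in> Hset \<theta> \<and> Transset M \<and>
     elementary_embedding (elts M) (Hset \<theta>) j \<and>
     nontrivial (elts M) j \<and> j (crit (elts M) j) = \<kappa>"

definition sufficiently_large_cardinals ::
    "'v::zfc_universe \<Rightarrow> ('v \<Rightarrow> bool) \<Rightarrow> bool" where
  "sufficiently_large_cardinals \<kappa> P \<longleftrightarrow>
     (\<exists>\<alpha>. Ord \<alpha> \<and> elts \<kappa> \<subseteq> elts \<alpha> \<and> (\<forall>\<theta>. Card \<theta> \<and> \<alpha> \<in> elts \<theta> \<longrightarrow> P \<theta>))"

definition emb_range :: "'v::zfc_universe \<Rightarrow> ('v \<Rightarrow> 'v) \<Rightarrow> 'v set" where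
  "emb_range M j = j ` elts M"

(* The pointwise preimage of d_(ran(j) \<inter> A) under j : M \<rightarrow> H(\<theta>). *)
definition list_preimage :: "'v::zfc_universe \<Rightarrow> ('v \<Rightarrow> 'v) \<Rightarrow> 'v \<Rightarrow> 'v \<Rightarrow> 'v" where
  "list_preimage M j A d =
     mkset {x \<in> elts M. j x \<in> elts (app d (mkset (emb_range M j \<inter> elts A)))}"

(* Jech's notion: a fine, \<kappa>-complete ultrafilter on P_\<kappa>(A) such that every function choosing
   an element almost everywhere is constant almost everywhere. For uncountable \<kappa>, closure under
   binary intersections is an instance of \<kappa>-completeness. *)
definition normal_measure :: "'v::zfc_universe \<Rightarrow> 'v \<Rightarrow> 'v set set \<Rightarrow> bool" where
  "normal_measure \<kappa> A U \<longleftrightarrow>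
     U \<subseteq> Pow (Pkappa \<kappa> A) \<and> Pkappa \<kappa> A \<in> U \<and> {} \<notin> U \<and>
     (\<forall>X Y. X \<in> U \<and> X \<subseteq> Y \<and> Y \<subseteq> Pkappa \<kappa> A \<longrightarrow> Y \<in> U) \<and>
     (\<forall>X. X \<subseteq> Pkappa \<kappa> A \<longrightarrow> X \<in> U \<or> Pkappa \<kappa> A - X \<in> U) \<and>
     (\<forall>F. F \<subseteq> U \<and> F \<noteq> {} \<and> F \<prec> elts \<kappa> \<longrightarrow> \<Inter>F \<in> U) \<and>
     (\<forall>a\<in>elts A. {x \<in> Pkappa \<kappa> A. a \<in> elts x} \<in> U) \<and>
     (\<forall>f. {x \<in> Pkappa \<kappa> A. f x \<in> elts x} \<in> U \<longrightarrow>
          (\<exists>a\<in>elts A. {x \<in> Pkappa \<kappa> A. f x = a} \<in> U))"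

definition supercompact :: "'v::zfc_universe \<Rightarrow> bool" where
  "supercompact \<kappa> \<longleftrightarrow> Card \<kappa> \<and> uncountable (elts \<kappa>) \<and>
     (\<forall>A. elts \<kappa> \<lesssim> elts A \<longrightarrow> (\<exists>U. normal_measure \<kappa> A U))"

end

theory Submission
  imports Defs
begin

text \<open>
  From supercompactness to embeddings: let \<open>U\<close> be a normal measure on \<open>P\<^sub>\<kappa>(H(\<theta>))\<close>. For \<open>U\<close>-almost
  all \<open>x\<close>, the set \<open>x\<close> is an elementary substructure of \<open>H(\<theta>)\<close> (Tarski--Vaught, by normality and
  because there are only countably many formulas), \<open>x \<inter> \<kappa>\<close> is an ordinal, and for all \<open>lam\<close> and \<open>d\<close> in
  \<open>x\<close> there is some \<open>y\<close> in \<open>x\<close> whose trace on \<open>x\<close> is the value of the list \<open>d\<close> at \<open>x \<inter> lam\<close>. The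
  inverse of the Mostowski collapse of such an \<open>x\<close> is the required small embedding.

  Conversely, suppose that \<open>P\<^sub>\<kappa>(A)\<close> carries no normal measure for some cardinal \<open>A \<ge> \<kappa>\<close>. Enumerate all
  families \<open>f(\<xi>)\<close>, \<open>\<xi> < lam\<close>, of elements of \<open>P\<^sub>\<kappa>(A)\<close> and let the list \<open>d\<close> send \<open>a\<close> to
  \<open>{\<xi> \<in> a. a \<inter> A \<in> f(\<xi>)}\<close>. Let \<open>j\<close> be a small embedding with range \<open>X\<close> into \<open>H(\<theta>)\<close> for a strong
  limit \<open>\<theta>\<close>. By elementarity \<open>A\<close>, \<open>lam\<close>, \<open>d\<close> can be chosen in \<open>X\<close>, and the hypothesis on \<open>j\<close> yields
  a family in \<open>X\<close> that has the same members in \<open>X\<close> as \<open>{Y. X \<inter> A \<in> Y}\<close>. It satisfies the axioms of a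
  normal measure for parameters in \<open>X\<close>, hence for all parameters by elementarity.
\<close>

subsection \<open>Sets and classes\<close>

text \<open>Elementarity concerns formulas evaluated in H(\<theta>), while measures, lists and
  cardinalities are notions of the whole universe. A strong limit \<theta> bridges the two:
  H(\<theta>) is then closed under power sets, so the relevant families, relations and injections
  are elements of it, and these notions become definable over it with their true meaning.
  Restricting to such \<theta> is harmless, as they are unbounded and (ii) and (iii) concern all
  large \<theta>. One list decides a whole measure because its value at
  \<open>X \<inter> lam\<close> records, for all codes in X at once, whether
  \<open>X \<inter> A\<close> lies in the coded family. The bound |M| < \<kappa> makes
  \<open>X \<inter> lam\<close> an index of the list. The obstacle is that the parameters of a
  counterexample need not lie in the range: (ii) supplies only \<open>lam\<close> and
  \<open>d\<close>, (iii) none of them. Hence being a counterexample is written as a property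
  definable from \<kappa>, and elementarity replaces the missing parameters by others in X. In (ii)
  the bound on \<theta> depends on \<open>lam\<close>, so the list has to be built before \<theta>
  is chosen.\<close>

definition small :: "'v::zfc_universe set \<Rightarrow> bool" where
  "small X \<longleftrightarrow> (\<exists>x. elts x = X)"

lemma elts_mkset [simp]: "small X \<Longrightarrow> elts (mkset X) = X"
  unfolding small_def mkset_def by (metis (mono_tags, lifting) extensionality the_equality)

lemma mkset_elts [simp]: "mkset (elts x) = x"
  by (metis elts_mkset extensionality small_def)

lemma small_elts [simp]: "small (elts x)"
  by (auto simp: small_def)

lemma small_subset: "\<lbrakk>small Y; X \<subseteq> Y\<rbrakk> \<Longrightarrow> small X"
proof -
  assume "small Y" "X \<subseteq> Y"
  then obtain y where "elts y = Y" by (auto simp: small_def)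
  moreover obtain z where "elts z = {u \<in> elts y. u \<in> X}" using separation by metis
  ultimately have "elts z = X" using \<open>X \<subseteq> Y\<close> by auto
  then show ?thesis by (auto simp: small_def)
qed

lemma small_image: "small X \<Longrightarrow> small ((f :: 'v \<Rightarrow> 'v::zfc_universe) ` X)"
  unfolding small_def using replacement[of f] by blast

text \<open>An injection into a set inverts to a surjection from it, to which Replacement
  applies.\<close>

lemma small_lepoll: "\<lbrakk>X \<lesssim> Y; small (Y :: 'v::zfc_universe set)\<rbrakk> \<Longrightarrow> small (X :: 'v set)"
  unfolding lepoll_iff using small_image small_subset by blast

lemma small_Union:
  "\<lbrakk>small I; \<And>i. i \<in> I \<Longrightarrow> small (F i)\<rbrakk> \<Longrightarrow> small (\<Union>i\<in>(I :: 'v::zfc_universe set). F i :: 'v set)"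
proof -
  assume I: "small I" and F: "\<And>i. i \<in> I \<Longrightarrow> small (F i)"
  obtain x where x: "elts x = (\<lambda>i. mkset (F i)) ` I"
    using small_image[OF I, of "\<lambda>i. mkset (F i)"] unfolding small_def by blast
  obtain u where "elts u = (\<Union>y\<in>elts x. elts y)" using union by metis
  also have "\<dots> = (\<Union>i\<in>I. elts (mkset (F i)))" by (simp add: x)
  also have "\<dots> = (\<Union>i\<in>I. F i)" using F by simp
  finally show ?thesis unfolding small_def by blast
qed

lemma small_pair [simp]: "small {x, y}"
  using pairing by (auto simp: small_def)

lemma small_Un: "\<lbrakk>small X; small Y\<rbrakk> \<Longrightarrow> small (X \<union> Y)"
proof -
  assume X: "small X" and Y: "small Y"
  have "small (\<Union>i\<in>{mkset X, mkset Y}. elts i)" by (rule small_Union) auto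
  then show ?thesis using X Y by simp
qed

lemma small_singleton [simp]: "small {x}"
  using small_pair[of x x] by simp

lemma small_empty [simp]: "small {}"
  by (rule small_subset[OF small_singleton]) auto

lemma small_insert: "small X \<Longrightarrow> small (insert x X)"
  using small_Un[of "{x}" X] by simp

lemma small_times:
  assumes "small X" "small Y"
  shows "small {kpair a b |a b. a \<in> X \<and> b \<in> Y}"
proof -
  have "{kpair a b |a b. a \<in> X \<and> b \<in> Y} = (\<Union>a\<in>X. kpair a ` Y)" by auto
  then show ?thesis using assms by (simp add: small_Union small_image)
qed

lemma mkset_inject:
  assumes "small X" "small Y"
  shows "mkset X = mkset Y \<longleftrightarrow> X = Y"
proof
  assume "mkset X = mkset Y"
  then have "elts (mkset X) = elts (mkset Y)" by (rule arg_cong)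
  then show "X = Y" by (simp only: elts_mkset assms)
qed (rule arg_cong)

definition pow :: "'v \<Rightarrow> 'v::zfc_universe" where
  "pow x = mkset {y. elts y \<subseteq> elts x}"

lemma elts_pow [simp]: "elts (pow x) = {y. elts y \<subseteq> elts x}"
  unfolding pow_def using power_set[of x] by (intro elts_mkset) (auto simp: small_def)

lemma elts_pow_eqpoll: "elts (pow x) \<approx> Pow (elts x)"
proof -
  have "bij_betw elts (elts (pow x)) (Pow (elts x))"
  proof (rule bij_betw_byWitness[where f' = mkset])
    show "mkset ` Pow (elts x) \<subseteq> elts (pow x)" "\<forall>a\<in>Pow (elts x). elts (mkset a) = a"
      using small_subset[OF small_elts[of x]] by auto
  qed auto
  then show ?thesis by (auto simp: eqpoll_def)
qed

lemma elts_induct [case_names step]: "(\<And>x. (\<And>y. y \<in> elts x \<Longrightarrow> P y) \<Longrightarrow> P x) \<Longrightarrow> P x"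
  using wf_induct_rule[OF foundation, of P x] by auto

lemma mem_not_refl [simp]: "x \<notin> elts x"
  using wf_not_refl[OF foundation] by auto

lemma mem_not_sym: "x \<in> elts y \<Longrightarrow> y \<notin> elts x"
  using wf_not_sym[OF foundation, of x y] by auto

lemma mem_minimal: "P x \<Longrightarrow> \<exists>x. P x \<and> (\<forall>y\<in>elts x. \<not> P y)"
  using wfE_min[OF foundation, of x "Collect P"] by (metis case_prodI mem_Collect_eq)

lemma kpair_eq_iff [simp]: "kpair a b = kpair c d \<longleftrightarrow> a = c \<and> b = d"
  by (auto simp: kpair_def mkset_inject doubleton_eq_iff)

subsection \<open>Transitive closures\<close>

lemma TC_unfold: "TC x = elts x \<union> (\<Union>y\<in>elts x. TC y)"
proof (intro equalityI subsetI)
  fix z assume "z \<in> TC x"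
  then have "(z, x) \<in> {(a, b). a \<in> elts b}\<^sup>+" by (simp add: TC_def)
  then show "z \<in> elts x \<union> (\<Union>y\<in>elts x. TC y)"
    by (cases rule: tranclE) (auto simp: TC_def)
next
  fix z assume "z \<in> elts x \<union> (\<Union>y\<in>elts x. TC y)"
  then show "z \<in> TC x"
    unfolding TC_def by (auto intro: trancl_into_trancl)
qed

lemma elts_subset_TC: "elts x \<subseteq> TC x"
  using TC_unfold[of x] by blast

lemma TC_mono: "y \<in> TC x \<Longrightarrow> TC y \<subseteq> TC x"
  by (auto simp: TC_def)

lemma TC_elts_subset: "y \<in> TC x \<Longrightarrow> elts y \<subseteq> TC x"
  using TC_mono elts_subset_TC by blast

lemma TC_least: "\<lbrakk>elts x \<subseteq> X; \<And>y. y \<in> X \<Longrightarrow> elts y \<subseteq> X\<rbrakk> \<Longrightarrow> TC x \<subseteq> X"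
proof (induction x rule: elts_induct)
  case (step x)
  then show ?case unfolding TC_unfold[of x] by blast
qed

lemma small_TC: "small (TC x)"
proof (induction x rule: elts_induct)
  case (step x)
  then show ?case unfolding TC_unfold[of x] by (intro small_Un small_Union) auto
qed

lemma TC_Transset: "Transset x \<Longrightarrow> TC x = elts x"
  by (rule equalityI[OF TC_least elts_subset_TC]) (auto simp: Transset_def)

subsection \<open>Ordinals\<close>

lemma Ord_elt: "\<lbrakk>Ord \<alpha>; \<beta> \<in> elts \<alpha>\<rbrakk> \<Longrightarrow> Ord \<beta>"
  unfolding Ord_def Transset_def by blast

lemma Ord_Transset: "Ord \<alpha> \<Longrightarrow> Transset \<alpha>"
  by (simp add: Ord_def)

lemma Ord_trans: "\<lbrakk>Ord \<alpha>; \<beta> \<in> elts \<alpha>; \<gamma> \<in> elts \<beta>\<rbrakk> \<Longrightarrow> \<gamma> \<in> elts \<alpha>"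
  unfolding Ord_def Transset_def by blast

lemma Ord_subset: "\<lbrakk>Ord \<alpha>; \<beta> \<in> elts \<alpha>\<rbrakk> \<Longrightarrow> elts \<beta> \<subseteq> elts \<alpha>"
  unfolding Ord_def Transset_def by blast

lemma OrdI: "\<lbrakk>Transset \<alpha>; \<And>\<beta>. \<beta> \<in> elts \<alpha> \<Longrightarrow> Ord \<beta>\<rbrakk> \<Longrightarrow> Ord \<alpha>"
  unfolding Ord_def by blast

lemma Ord_linear: "\<lbrakk>Ord \<alpha>; Ord \<beta>\<rbrakk> \<Longrightarrow> \<alpha> \<in> elts \<beta> \<or> \<alpha> = \<beta> \<or> \<beta> \<in> elts \<alpha>"
proof (induction \<alpha> arbitrary: \<beta> rule: elts_induct)
  case (step \<alpha>)
  note outer = step.IH and \<alpha> = \<open>Ord \<alpha>\<close>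
  show ?case using \<open>Ord \<beta>\<close>
  proof (induction \<beta> rule: elts_induct)
    case (step \<beta>)
    show ?case
    proof (rule ccontr)
      assume neg: "\<not> ?thesis"
      have "elts \<alpha> \<subseteq> elts \<beta>"
      proof
        fix \<gamma> assume \<gamma>: "\<gamma> \<in> elts \<alpha>"
        then have "\<gamma> \<in> elts \<beta> \<or> \<gamma> = \<beta> \<or> \<beta> \<in> elts \<gamma>"
          by (intro outer Ord_elt[OF \<alpha>] step.prems)
        then show "\<gamma> \<in> elts \<beta>" using neg \<gamma> Ord_trans[OF \<alpha> \<gamma>] by blast
      qed
      moreover have "elts \<beta> \<subseteq> elts \<alpha>"
      proof
        fix \<gamma> assume \<gamma>: "\<gamma> \<in> elts \<beta>"
        then have "\<alpha> \<in> elts \<gamma> \<or> \<alpha> = \<gamma> \<or> \<gamma> \<in> elts \<alpha>"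
          by (intro step.IH Ord_elt[OF step.prems])
        then show "\<gamma> \<in> elts \<alpha>" using neg \<gamma> Ord_trans[OF step.prems \<gamma>] by blast
      qed
      ultimately show False using neg extensionality by blast
    qed
  qed
qed

lemma Ord_not_mem_iff: "\<lbrakk>Ord \<alpha>; Ord \<beta>\<rbrakk> \<Longrightarrow> \<alpha> \<notin> elts \<beta> \<longleftrightarrow> elts \<beta> \<subseteq> elts \<alpha>"
  using Ord_linear[of \<alpha> \<beta>] Ord_subset[of \<alpha> \<beta>] mem_not_refl[of \<alpha>] by blast

lemma Transset_subset_Ord:
  "\<lbrakk>Ord \<beta>; Transset \<alpha>; elts \<alpha> \<subseteq> elts \<beta>; \<alpha> \<noteq> \<beta>\<rbrakk> \<Longrightarrow> \<alpha> \<in> elts \<beta>"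
  using Ord_linear[of \<alpha> \<beta>] OrdI[of \<alpha>] Ord_elt[of \<beta>] mem_not_refl[of \<beta>] by blast

lemma Ord_Union:
  assumes "\<And>x. x \<in> X \<Longrightarrow> Ord x" "small X"
  shows "Ord (mkset (\<Union>x\<in>X. elts x))"
proof -
  have "elts (mkset (\<Union>x\<in>X. elts x)) = (\<Union>x\<in>X. elts x)"
    using assms(2) by (intro elts_mkset small_Union) auto
  then show ?thesis
    using assms(1) Ord_trans unfolding Ord_def Transset_def by (simp, blast)
qed

subsection \<open>Mostowski collapse\<close>

text \<open>The relation is arbitrary because the same recursion serves three purposes: order types
  of well-orders, decoding sets from relations on a cardinal, and collapsing elementary
  substructures.\<close>

definition collapse :: "('v \<times> 'v) set \<Rightarrow> 'v \<Rightarrow> 'v::zfc_universe" where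
  "collapse R = wfrec R (\<lambda>f a. mkset (f ` {b. (b, a) \<in> R}))"

lemma collapse_unfold: "wf R \<Longrightarrow> collapse R a = mkset (collapse R ` {b. (b, a) \<in> R})"
  unfolding collapse_def
  by (subst wfrec, assumption, rule arg_cong[of _ _ mkset], rule image_cong) (simp_all add: cut_apply)

lemma elts_collapse:
  "\<lbrakk>wf R; small {b. (b, a) \<in> R}\<rbrakk> \<Longrightarrow> elts (collapse R a) = collapse R ` {b. (b, a) \<in> R}"
  by (simp add: collapse_unfold[of R a] small_image)

text \<open>A copy of a transitive class collapses back to the original, since the collapse and the
  membership relation obey the same recursion.\<close>

lemma collapse_transport:
  assumes "wf R" "\<And>a. small {b. (b, a) \<in> R}"
    and "\<And>v. v \<in> T \<Longrightarrow> elts v \<subseteq> T"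
    and "\<And>v. v \<in> T \<Longrightarrow> {b. (b, g v) \<in> R} = g ` elts v"
  shows "v \<in> T \<Longrightarrow> collapse R (g v) = v"
proof (induction v rule: elts_induct)
  case (step v)
  have "elts (collapse R (g v)) = collapse R ` g ` elts v"
    using elts_collapse[OF assms(1,2)] assms(4) step.prems by auto
  also have "\<dots> = elts v"
    using step assms(3)[OF step.prems] by (force simp: image_image)
  finally show ?case by (rule extensionality)
qed

text \<open>The ordinal is the order type of a well-order of \<open>elts x\<close>: the set of
  collapses of its points.\<close>

lemma ex_Ord_eqpoll: "\<exists>\<alpha>::'v::zfc_universe. Ord \<alpha> \<and> elts \<alpha> \<approx> elts (x::'v)"
proof -
  obtain r where "well_order_on (elts x) r" using well_order_on by blast
  then have r: "trans r" "antisym r" "total_on (elts x) r" "wf (r - Id)" and rx: "r \<subseteq> elts x \<times> elts x"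
    unfolding order_on_defs refl_on_def by auto
  define R where "R = r - Id"
  have wf: "wf R" and sm: "\<And>a. small {b. (b, a) \<in> R}"
    using r rx by (auto simp: R_def intro!: small_subset[OF small_elts[of x]])
  have trR: "(a, c) \<in> R" if "(a, b) \<in> R" "(b, c) \<in> R" for a b c
    using that r(1,2) unfolding R_def trans_def antisym_def by blast
  have Oc: "Ord (collapse R a)" for a
    using wf
  proof (induction a rule: wf_induct_rule)
    case (less a)
    have e: "elts (collapse R a) = collapse R ` {b. (b, a) \<in> R}" by (rule elts_collapse[OF wf sm])
    show ?case
    proof (rule OrdI)
      show "Transset (collapse R a)"
        unfolding Transset_def e using elts_collapse[OF wf sm] trR by auto
    qed (use e less in auto)
  qed
  have inj: "inj_on (collapse R) (elts x)"
  proof (rule inj_onI, rule ccontr)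
    fix a b assume ab: "a \<in> elts x" "b \<in> elts x" "collapse R a = collapse R b" "a \<noteq> b"
    then have "(a, b) \<in> R \<or> (b, a) \<in> R"
      using r(3) unfolding total_on_def R_def by blast
    then have "collapse R a \<in> elts (collapse R b) \<or> collapse R b \<in> elts (collapse R a)"
      using elts_collapse[OF wf sm] by auto
    then show False using ab by auto
  qed
  let ?\<alpha> = "mkset (collapse R ` elts x)"
  have e: "elts ?\<alpha> = collapse R ` elts x" by (simp add: small_image)
  have "Ord ?\<alpha>"
  proof (rule OrdI)
    show "Transset ?\<alpha>"
      unfolding Transset_def e using elts_collapse[OF wf sm] rx by (auto simp: R_def)
  qed (use e Oc in auto)
  moreover have "elts ?\<alpha> \<approx> elts x"
    unfolding e using inj by (simp add: inj_on_image_eqpoll_self)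
  ultimately show ?thesis by blast
qed

subsection \<open>Cardinals\<close>

lemma Card_Ord: "Card \<kappa> \<Longrightarrow> Ord \<kappa>"
  by (simp add: Card_def)

lemma ex_Card_eqpoll: "\<exists>\<kappa>::'v::zfc_universe. Card \<kappa> \<and> elts \<kappa> \<approx> elts (x::'v)"
proof -
  obtain \<alpha> :: 'v where \<alpha>: "Ord \<alpha>" "elts \<alpha> \<approx> elts x"
    and min: "\<And>\<beta>. \<beta> \<in> elts \<alpha> \<Longrightarrow> \<not> (Ord \<beta> \<and> elts \<beta> \<approx> elts x)"
    using mem_minimal[of "\<lambda>\<alpha>. Ord \<alpha> \<and> elts \<alpha> \<approx> elts x"] ex_Ord_eqpoll[of x] by blast
  have "Card \<alpha>"
    unfolding Card_def using \<alpha> min Ord_elt eqpoll_trans by blast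
  then show ?thesis using \<alpha> by blast
qed

lemma Card_elt_lesspoll: "\<lbrakk>Card \<kappa>; \<alpha> \<in> elts \<kappa>\<rbrakk> \<Longrightarrow> elts \<alpha> \<prec> elts \<kappa>"
  unfolding Card_def lesspoll_def by (simp add: Ord_subset subset_imp_lepoll)

lemma Card_not_lepoll_elt: "\<lbrakk>Card \<kappa>; \<alpha> \<in> elts \<kappa>\<rbrakk> \<Longrightarrow> \<not> elts \<kappa> \<lesssim> elts \<alpha>"
  using Card_elt_lesspoll lesspoll_trans2 lesspoll_not_refl by blast

lemma lepoll_Card_subset: "\<lbrakk>Card \<kappa>; Ord \<alpha>; elts \<kappa> \<lesssim> elts \<alpha>\<rbrakk> \<Longrightarrow> elts \<kappa> \<subseteq> elts \<alpha>"
  using Card_not_lepoll_elt[of \<kappa> \<alpha>] Card_Ord[of \<kappa>] Ord_not_mem_iff[of \<alpha> \<kappa>] by blast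

lemma lesspoll_Card_ex_elt:
  fixes \<kappa> :: "'v::zfc_universe"
  assumes "X \<prec> elts \<kappa>" "Card \<kappa>"
  shows "\<exists>\<alpha>\<in>elts \<kappa>. elts \<alpha> \<approx> X"
proof -
  obtain f where f: "inj_on f X" "f ` X \<subseteq> elts \<kappa>"
    using assms(1) by (auto simp: lesspoll_def lepoll_def)
  have "small (f ` X)" using f(2) small_subset small_elts by blast
  then obtain \<mu> :: 'v where \<mu>: "Card \<mu>" "elts \<mu> \<approx> X"
    using ex_Card_eqpoll[of "mkset (f ` X)"] f(1) by auto
  have "\<not> elts \<kappa> \<subseteq> elts \<mu>"
    using \<mu>(2) assms(1) eq_lesspoll_trans lesspoll_trans1 subset_imp_lepoll lesspoll_not_refl by metis
  then show ?thesis using \<mu> assms(2) Card_Ord Ord_not_mem_iff by blast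
qed

text \<open>Comparability comes from the HOL theory of cardinal orders. The equivalence lets
  formulas express |x| < \<kappa> as the absence of an injection from \<kappa>.\<close>

lemma not_lepoll_iff_lesspoll: "\<not> Y \<lesssim> X \<longleftrightarrow> X \<prec> Y"
proof -
  have "X \<lesssim> Y \<or> Y \<lesssim> X"
    using ordLeq_total[OF card_of_Well_order[of X] card_of_Well_order[of Y]]
    by (simp add: card_of_ordLeq[symmetric] lepoll_def)
  then show ?thesis
    using lesspoll_def lesspoll_trans2 lesspoll_not_refl eqpoll_sym eqpoll_imp_lepoll
    by (metis lepoll_antisym)
qed

subsection \<open>The classes of hereditarily small sets\<close>

lemma Hset_trans: "\<lbrakk>x \<in> Hset \<theta>; y \<in> elts x\<rbrakk> \<Longrightarrow> y \<in> Hset \<theta>"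
  unfolding Hset_def using TC_mono elts_subset_TC lesspoll_trans1 subset_imp_lepoll by blast

lemma Hset_subset:
  assumes "x \<in> Hset \<theta>" "elts y \<subseteq> elts x"
  shows "y \<in> Hset \<theta>"
proof -
  have "TC y \<subseteq> TC x"
    using assms(2) TC_unfold by blast
  then show ?thesis
    using assms(1) lesspoll_trans1 subset_imp_lepoll unfolding Hset_def by blast
qed

lemma Hset_Transset: "\<lbrakk>Transset x; elts x \<prec> elts \<theta>\<rbrakk> \<Longrightarrow> x \<in> Hset \<theta>"
  by (simp add: Hset_def TC_Transset)

lemma Hset_Card_elt: "\<lbrakk>Card \<theta>; \<alpha> \<in> elts \<theta>\<rbrakk> \<Longrightarrow> \<alpha> \<in> Hset \<theta>"
  by (meson Card_Ord Card_elt_lesspoll Hset_Transset Ord_Transset Ord_elt)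

text \<open>Each member of H(\<theta>) is decoded from a relation on \<theta> together with a point
  of \<theta>: copy membership on the transitive closure into \<theta> and collapse the copy. The
  possible relations form the power set of \<theta> \<times> \<theta>.\<close>

lemma small_Hset: "small (Hset (\<theta> :: 'v::zfc_universe))"
proof -
  define dec where "dec r = {(b, a). kpair b a \<in> elts r}" for r :: 'v
  define P where "P = mkset {kpair b a |b a. b \<in> elts \<theta> \<and> a \<in> elts \<theta>}"
  have P: "elts P = {kpair b a |b a. b \<in> elts \<theta> \<and> a \<in> elts \<theta>}"
    unfolding P_def by (intro elts_mkset small_times) auto
  let ?C = "\<Union>r\<in>elts (pow P). collapse (dec r) ` elts \<theta>"
  have "small ?C" by (intro small_Union small_image small_elts)
  moreover have "Hset \<theta> \<subseteq> ?C"
  proof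
    fix x assume "x \<in> Hset \<theta>"
    \<comment> \<open>The point that collapses to \<open>x\<close> needs a name in \<theta> as well;
      the strict inequality leaves room for one more element.\<close>
    then have T: "insert x (TC x) \<lesssim> elts \<theta>"
      by (simp add: Hset_def less_imp_insert_lepoll)
    define T where "T = insert x (TC x)"
    obtain g where g: "inj_on g T" "g ` T \<subseteq> elts \<theta>"
      using T by (auto simp: lepoll_def T_def)
    have elT: "elts v \<subseteq> T" if "v \<in> T" for v
      using that elts_subset_TC[of x] TC_elts_subset[of v x] by (auto simp: T_def)
    define r where "r = mkset {kpair (g u) (g v) |u v. u \<in> elts v \<and> v \<in> T}"
    have sub: "{kpair (g u) (g v) |u v. u \<in> elts v \<and> v \<in> T} \<subseteq> elts P"
      using g(2) elT by (fastforce simp: P)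
    then have r: "elts r = {kpair (g u) (g v) |u v. u \<in> elts v \<and> v \<in> T}"
      unfolding r_def by (intro elts_mkset small_subset[OF small_elts])
    have dec: "dec r = {(g u, g v) |u v. u \<in> elts v \<and> v \<in> T}"
      by (auto simp: dec_def r)
    have preds: "{b. (b, g v) \<in> dec r} = g ` elts v" if "v \<in> T" for v
      using that g(1) by (auto simp: dec inj_on_def)
    have "dec r \<subseteq> inv_image {(x, y). x \<in> elts y} (inv_into T g)"
    proof
      fix p assume "p \<in> dec r"
      then obtain u v where "p = (g u, g v)" "u \<in> elts v" "v \<in> T" by (auto simp: dec)
      then show "p \<in> inv_image {(x, y). x \<in> elts y} (inv_into T g)"
        using elT g(1) by (auto simp: inv_into_f_f subset_iff)
    qed
    then have wf: "wf (dec r)"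
      using wf_inv_image[OF foundation] wf_subset by blast
    have sm: "small {b. (b, a) \<in> dec r}" for a
    proof (rule small_subset[OF small_elts[of \<theta>]])
      show "{b. (b, a) \<in> dec r} \<subseteq> elts \<theta>" using g(2) elT by (auto simp: dec)
    qed
    have "collapse (dec r) (g x) = x"
      by (rule collapse_transport[OF wf sm elT preds]) (auto simp: T_def)
    moreover have "r \<in> elts (pow P)" using r sub by simp
    moreover have "g x \<in> elts \<theta>" using g by (auto simp: T_def)
    ultimately show "x \<in> ?C" by (metis UN_I image_eqI)
  qed
  ultimately show ?thesis by (rule small_subset)
qed

subsection \<open>Definable predicates and elementary substructures\<close>

text \<open>Bound variables are counted along with free ones, so \<open>var_bound p\<close> itself
  is fresh for \<open>p\<close>.\<close>

primrec var_bound :: "fm \<Rightarrow> nat" where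
  "var_bound (Mem m n) = Suc (max m n)"
| "var_bound (Equal m n) = Suc (max m n)"
| "var_bound (Neg p) = var_bound p"
| "var_bound (And p q) = max (var_bound p) (var_bound q)"
| "var_bound (Forall n p) = max (Suc n) (var_bound p)"

lemma sat_cong: "(\<And>n. n < var_bound p \<Longrightarrow> e n = e' n) \<Longrightarrow> sat M p e \<longleftrightarrow> sat M p e'"
proof (induction p arbitrary: e e')
  case (Mem m n)
  have "e m = e' m" "e n = e' n" by (rule Mem; simp)+
  then show ?case by simp
next
  case (Equal m n)
  have "e m = e' m" "e n = e' n" by (rule Equal; simp)+
  then show ?case by simp
next
  case (Neg p)
  show ?case using Neg.IH[OF Neg.prems] by simp
next
  case (And p q)
  have "sat M p e \<longleftrightarrow> sat M p e'" by (rule And.IH) (simp add: And.prems)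
  moreover have "sat M q e \<longleftrightarrow> sat M q e'" by (rule And.IH) (simp add: And.prems)
  ultimately show ?case by simp
next
  case (Forall n p)
  have "sat M p (e(n := x)) \<longleftrightarrow> sat M p (e'(n := x))" for x
    by (rule Forall.IH) (use Forall.prems in auto)
  then show ?case by simp
qed

primrec rename_vars :: "(nat \<Rightarrow> nat) \<Rightarrow> fm \<Rightarrow> fm" where
  "rename_vars \<sigma> (Mem m n) = Mem (\<sigma> m) (\<sigma> n)"
| "rename_vars \<sigma> (Equal m n) = Equal (\<sigma> m) (\<sigma> n)"
| "rename_vars \<sigma> (Neg p) = Neg (rename_vars \<sigma> p)"
| "rename_vars \<sigma> (And p q) = And (rename_vars \<sigma> p) (rename_vars \<sigma> q)"
| "rename_vars \<sigma> (Forall n p) = Forall (\<sigma> n) (rename_vars \<sigma> p)"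

text \<open>Injectivity on all variables, bound ones included, rules out capture, so quantifiers can
  be renamed without alpha-conversion.\<close>

lemma sat_rename_vars: "inj_on \<sigma> {..<var_bound p} \<Longrightarrow> sat M (rename_vars \<sigma> p) e \<longleftrightarrow> sat M p (e \<circ> \<sigma>)"
proof (induction p arbitrary: e)
  case (And p q)
  then show ?case by (auto simp: inj_on_def)
next
  case (Forall n p)
  have "sat M (rename_vars \<sigma> p) (e(\<sigma> n := x)) \<longleftrightarrow> sat M p ((e \<circ> \<sigma>)(n := x))" for x
  proof -
    have "inj_on \<sigma> {..<var_bound p}" using Forall.prems by (auto simp: inj_on_def)
    then have "sat M (rename_vars \<sigma> p) (e(\<sigma> n := x)) \<longleftrightarrow> sat M p (e(\<sigma> n := x) \<circ> \<sigma>)"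
      by (rule Forall.IH)
    also have "\<dots> \<longleftrightarrow> sat M p ((e \<circ> \<sigma>)(n := x))"
      by (rule sat_cong) (use Forall.prems in \<open>auto simp: inj_on_def\<close>)
    finally show ?thesis .
  qed
  then show ?case by (simp only: rename_vars.simps sat.simps)
qed auto

text \<open>\<open>Q\<close> may be any HOL predicate, so definability also asserts that
  \<open>N\<close> evaluates \<open>Q\<close> correctly. The closure rules below replace the
  explicit writing of formulas.\<close>

definition definable :: "'v::zfc_universe set \<Rightarrow> ((nat \<Rightarrow> 'v) \<Rightarrow> bool) \<Rightarrow> bool" where
  "definable N Q \<longleftrightarrow> (\<exists>p. \<forall>e. range e \<subseteq> N \<longrightarrow> (sat N p e \<longleftrightarrow> Q e))"

lemma definable_cong: "\<lbrakk>definable N Q; \<And>e. range e \<subseteq> N \<Longrightarrow> Q' e \<longleftrightarrow> Q e\<rbrakk> \<Longrightarrow> definable N Q'"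
  unfolding definable_def by auto

lemma definable_mem: "definable N (\<lambda>e. e m \<in> elts (e n))"
  unfolding definable_def by (rule exI[of _ "Mem m n"]) simp

lemma definable_eq: "definable N (\<lambda>e. e m = e n)"
  unfolding definable_def by (rule exI[of _ "Equal m n"]) simp

lemma definable_not: "definable N Q \<Longrightarrow> definable N (\<lambda>e. \<not> Q e)"
  unfolding definable_def by (metis sat.simps(3))

lemma definable_conj: "\<lbrakk>definable N Q; definable N Q'\<rbrakk> \<Longrightarrow> definable N (\<lambda>e. Q e \<and> Q' e)"
  unfolding definable_def by (metis sat.simps(4))

lemma definable_disj: "\<lbrakk>definable N Q; definable N Q'\<rbrakk> \<Longrightarrow> definable N (\<lambda>e. Q e \<or> Q' e)"
  using definable_not[OF definable_conj[OF definable_not[of N Q] definable_not[of N Q']]] by simp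

lemma definable_imp: "\<lbrakk>definable N Q; definable N Q'\<rbrakk> \<Longrightarrow> definable N (\<lambda>e. Q e \<longrightarrow> Q' e)"
  using definable_not[OF definable_conj[OF _ definable_not[of N Q']], of Q] by simp

lemma definable_iff: "\<lbrakk>definable N Q; definable N Q'\<rbrakk> \<Longrightarrow> definable N (\<lambda>e. Q e \<longleftrightarrow> Q' e)"
  using definable_conj[OF definable_imp[of N Q Q'] definable_imp[of N Q' Q]] by (simp add: iff_conv_conj_imp)

text \<open>The bound variable becomes variable 0 and the other variables are shifted by one.\<close>

lemma definable_ball:
  assumes "definable N (\<lambda>e. Q (e 0) (\<lambda>n. e (Suc n)))"
  shows "definable N (\<lambda>e. \<forall>x\<in>N. Q x e)"
proof -
  obtain p where p: "\<And>e. range e \<subseteq> N \<Longrightarrow> sat N p e \<longleftrightarrow> Q (e 0) (\<lambda>n. e (Suc n))"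
    using assms by (auto simp: definable_def)
  define K where "K = var_bound p"
  \<comment> \<open>Variable 0 moves to the fresh variable \<open>K\<close> and \<open>Suc n\<close>
    returns to \<open>n\<close>, so the quantifier can bind \<open>K\<close> without touching the
    parameters.\<close>
  define \<sigma> where "\<sigma> = case_nat K id"
  have inj: "inj_on \<sigma> {..<var_bound p}"
    by (auto simp: inj_on_def \<sigma>_def K_def split: nat.splits)
  have "sat N (rename_vars \<sigma> p) (e(K := x)) \<longleftrightarrow> Q x e" if "range e \<subseteq> N" "x \<in> N" for e x
  proof -
    have "sat N (rename_vars \<sigma> p) (e(K := x)) \<longleftrightarrow> sat N p (case_nat x e)"
      unfolding sat_rename_vars[OF inj] by (rule sat_cong) (auto simp: \<sigma>_def K_def split: nat.splits)
    also have "\<dots> \<longleftrightarrow> Q x e"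
      by (subst p) (use that in \<open>auto simp: image_subset_iff split: nat.splits\<close>)
    finally show ?thesis .
  qed
  then show ?thesis
    unfolding definable_def by (intro exI[of _ "Forall K (rename_vars \<sigma> p)"]) simp
qed

lemma definable_bex:
  assumes "definable N (\<lambda>e. Q (e 0) (\<lambda>n. e (Suc n)))"
  shows "definable N (\<lambda>e. \<exists>x\<in>N. Q x e)"
  using definable_not[OF definable_ball[of N "\<lambda>x e. \<not> Q x e", OF definable_not[OF assms]]] by simp

text \<open>This is the Tarski-Vaught criterion, from which agreement of truth follows by induction
  on formulas. It is the form used to pull witnesses into \<open>X\<close>, and the form that a
  normal measure verifies directly.\<close>

definition elem_substruct :: "'v::zfc_universe set \<Rightarrow> 'v set \<Rightarrow> bool" where
  "elem_substruct X N \<longleftrightarrow> X \<subseteq> N \<and> (\<forall>p e n. range e \<subseteq> X \<longrightarrow>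
     (\<exists>x\<in>N. sat N p (e(n := x))) \<longrightarrow> (\<exists>x\<in>X. sat N p (e(n := x))))"

lemma elem_substruct_sat: "\<lbrakk>elem_substruct X N; range e \<subseteq> X\<rbrakk> \<Longrightarrow> sat X p e \<longleftrightarrow> sat N p e"
proof (induction p arbitrary: e)
  case (Forall n p)
  have "sat X p (e(n := x)) \<longleftrightarrow> sat N p (e(n := x))" if "x \<in> X" for x
    by (rule Forall.IH) (use Forall.prems that in auto)
  moreover have "(\<exists>x\<in>N. sat N (Neg p) (e(n := x))) \<longrightarrow> (\<exists>x\<in>X. sat N (Neg p) (e(n := x)))"
    using Forall.prems unfolding elem_substruct_def by blast
  moreover have "X \<subseteq> N" using Forall.prems by (simp add: elem_substruct_def)
  ultimately show ?case by auto
qed auto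

text \<open>An existential statement true in \<open>N\<close> about images under \<open>j\<close>
  holds in \<open>M\<close> of the preimages; the image of a witness in \<open>M\<close> is the
  witness required.\<close>

lemma elem_substruct_range:
  assumes "elementary_embedding M N j"
  shows "elem_substruct (j ` M) N"
  unfolding elem_substruct_def
proof (intro conjI allI impI)
  show "j ` M \<subseteq> N" using assms by (simp add: elementary_embedding_def)
next
  fix p n and e :: "nat \<Rightarrow> 'a"
  assume e: "range e \<subseteq> j ` M" and ex: "\<exists>x\<in>N. sat N p (e(n := x))"
  define e' where "e' = (\<lambda>n. SOME y. y \<in> M \<and> j y = e n)"
  have e': "e' n \<in> M \<and> j (e' n) = e n" for n
    unfolding e'_def by (rule someI_ex) (use subsetD[OF e, of "e n"] in auto)
  have sat: "sat M q f \<longleftrightarrow> sat N q (j \<circ> f)" if "range f \<subseteq> M" for q f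
    using assms that by (auto simp: elementary_embedding_def)
  have je': "j \<circ> e' = e" using e' by auto
  have "\<not> sat N (Forall n (Neg p)) (j \<circ> e')"
    using ex je' by auto
  then have "\<not> sat M (Forall n (Neg p)) e'"
    using sat[of e' "Forall n (Neg p)"] e' by (simp add: image_subset_iff)
  then obtain x where x: "x \<in> M" "sat M p (e'(n := x))" by auto
  then have "sat N p (j \<circ> e'(n := x))"
    using sat[of "e'(n := x)" p] e' by (simp add: image_subset_iff)
  then have "sat N p (e(n := j x))"
    by (simp add: je' fun_upd_comp)
  then show "\<exists>x\<in>j ` M. sat N p (e(n := x))" using x by blast
qed

lemma elem_substruct_bex_env:
  assumes "elem_substruct X N" "definable N (\<lambda>e. Q (e 0) (\<lambda>n. e (Suc n)))" "range e \<subseteq> X" "\<exists>x\<in>N. Q x e"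
  shows "\<exists>x\<in>X. Q x e"
proof -
  obtain p where p: "\<And>e. range e \<subseteq> N \<Longrightarrow> sat N p e \<longleftrightarrow> Q (e 0) (\<lambda>n. e (Suc n))"
    using assms(2) by (auto simp: definable_def)
  have XN: "X \<subseteq> N" using assms(1) by (simp add: elem_substruct_def)
  \<comment> \<open>Slot 0 must hold some element of \<open>X\<close> until it is overwritten by
    \<open>x\<close>; \<open>e 0\<close> is a placeholder.\<close>
  have *: "sat N p ((case_nat (e 0) e)(0 := x)) \<longleftrightarrow> Q x e" if "x \<in> N" for x
    by (subst p) (use that XN assms(3) in \<open>auto simp: image_subset_iff split: nat.splits if_splits\<close>)
  have "range (case_nat (e 0) e) \<subseteq> X"
    using assms(3) by (auto split: nat.splits)
  then have "(\<exists>x\<in>N. sat N p ((case_nat (e 0) e)(0 := x))) \<longrightarrow>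
      (\<exists>x\<in>X. sat N p ((case_nat (e 0) e)(0 := x)))"
    using assms(1) unfolding elem_substruct_def by blast
  then show ?thesis using * XN assms(4) by blast
qed

text \<open>Slot 0 is the witness and slots 1 to 4 are parameters. Applications with fewer
  parameters repeat one of them.\<close>

lemma elem_substruct_bex:
  assumes "elem_substruct X N" "definable N (\<lambda>e. Q (e 0) (e 1) (e 2) (e 3) (e 4))"
    and "{a, b, c, d} \<subseteq> X" "\<exists>x\<in>N. Q x a b c d"
  shows "\<exists>x\<in>X. Q x a b c d"
proof -
  define e where "e = case_nat a (case_nat b (case_nat c (\<lambda>_. d)))"
  have "\<exists>x\<in>X. Q x (e 0) (e 1) (e 2) (e 3)"
  proof (rule elem_substruct_bex_env[OF assms(1), of "\<lambda>x e. Q x (e 0) (e 1) (e 2) (e 3)"])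
    show "definable N (\<lambda>e. Q (e 0) (e (Suc 0)) (e (Suc 1)) (e (Suc 2)) (e (Suc 3)))"
      using assms(2) by (simp add: numeral_eq_Suc)
  qed (use assms(3,4) in \<open>auto simp: e_def numeral_eq_Suc split: nat.splits\<close>)
  then show ?thesis by (simp add: e_def numeral_eq_Suc)
qed

lemma elem_substruct_ball:
  assumes "elem_substruct X N" "definable N (\<lambda>e. Q (e 0) (e 1) (e 2) (e 3) (e 4))"
    and "{a, b, c, d} \<subseteq> X" "\<And>x. x \<in> X \<Longrightarrow> Q x a b c d"
  shows "\<forall>x\<in>N. Q x a b c d"
  using elem_substruct_bex[OF assms(1) definable_not[OF assms(2)] assms(3)] assms(4) by blast

text \<open>The quantifiers are extended from \<open>X\<close> to \<open>N\<close> one at a time: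
  first over \<open>y\<close> with \<open>x\<close> kept as a parameter in \<open>X\<close>, then
  over \<open>x\<close>. The inner variable \<open>y\<close> occupies slot 0, whence the order
  \<open>e 1\<close>, \<open>e 0\<close>.\<close>

lemma elem_substruct_ball2:
  assumes "elem_substruct X N" "definable N (\<lambda>e. Q (e 1) (e 0) (e 2) (e 3) (e 4))"
    and "{a, b, c} \<subseteq> X" "\<And>x y. x \<in> X \<Longrightarrow> y \<in> X \<Longrightarrow> Q x y a b c"
  shows "\<forall>x\<in>N. \<forall>y\<in>N. Q x y a b c"
proof -
  have 1: "\<forall>y\<in>N. Q x y a b c" if x: "x \<in> X" for x
  proof (rule elem_substruct_ball[OF assms(1), of "\<lambda>y x. Q x y" x a b c])
    show "definable N (\<lambda>e. Q (e 1) (e 0) (e 2) (e 3) (e 4))" by (rule assms(2))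
  qed (use assms(3,4) x in auto)
  show ?thesis
  proof (rule elem_substruct_ball[OF assms(1), of "\<lambda>x a b c _. \<forall>y\<in>N. Q x y a b c" a b c c])
    show "definable N (\<lambda>e. \<forall>y\<in>N. Q (e 0) y (e 1) (e 2) (e 3))"
      by (rule definable_ball) (use assms(2) in \<open>simp add: numeral_eq_Suc\<close>)
  qed (use assms(3) 1 in auto)
qed

locale trans_class =
  fixes N :: "'v::zfc_universe set"
  assumes trans: "\<lbrakk>x \<in> N; y \<in> elts x\<rbrakk> \<Longrightarrow> y \<in> N"
begin

lemma definable_ball_elts:
  assumes "definable N (\<lambda>e. Q (e 0) (\<lambda>n. e (Suc n)))"
  shows "definable N (\<lambda>e. \<forall>x\<in>elts (e i). Q x e)"
proof (rule definable_cong)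
  show "definable N (\<lambda>e. \<forall>x\<in>N. x \<in> elts (e i) \<longrightarrow> Q x e)"
    by (intro definable_ball definable_imp definable_mem assms)
qed (use trans in blast)

lemma definable_bex_elts:
  assumes "definable N (\<lambda>e. Q (e 0) (\<lambda>n. e (Suc n)))"
  shows "definable N (\<lambda>e. \<exists>x\<in>elts (e i). Q x e)"
  using definable_not[OF definable_ball_elts[of "\<lambda>x e. \<not> Q x e", OF definable_not[OF assms]]] by simp

lemmas definable_basic = definable_mem definable_eq definable_not definable_conj definable_disj definable_imp definable_iff definable_ball definable_bex
  definable_ball_elts definable_bex_elts

lemma definable_subset: "definable N (\<lambda>e. elts (e i) \<subseteq> elts (e j))"
  unfolding subset_iff by (rule definable_cong[of _ "\<lambda>e. \<forall>x\<in>elts (e i). x \<in> elts (e j)"])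
    (intro definable_basic, blast)

lemma definable_eq_doubleton: "definable N (\<lambda>e. e k = mkset {e i, e j})"
proof (rule definable_cong)
  show "definable N (\<lambda>e. e i \<in> elts (e k) \<and> e j \<in> elts (e k) \<and> (\<forall>x\<in>elts (e k). x = e i \<or> x = e j))"
    by (intro definable_basic)
  show "e k = mkset {e i, e j} \<longleftrightarrow>
    e i \<in> elts (e k) \<and> e j \<in> elts (e k) \<and> (\<forall>x\<in>elts (e k). x = e i \<or> x = e j)" for e :: "nat \<Rightarrow> 'v"
  proof
    assume R: "e i \<in> elts (e k) \<and> e j \<in> elts (e k) \<and> (\<forall>x\<in>elts (e k). x = e i \<or> x = e j)"
    show "e k = mkset {e i, e j}"
      by (rule extensionality) (use R in auto)
  qed simp
qed

text \<open>Two elements of \<open>X\<close> that differ do so at an element of \<open>X\<close>, by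
  elementarity. This makes the Mostowski collapse of \<open>X\<close> injective.\<close>

lemma elem_substruct_extensional:
  assumes X: "elem_substruct X N" and uv: "u \<in> X" "v \<in> X" "elts u \<inter> X = elts v \<inter> X"
  shows "u = v"
proof -
  have "\<forall>x\<in>N. x \<in> elts u \<longleftrightarrow> x \<in> elts v"
  proof (rule elem_substruct_ball[OF X, of "\<lambda>x u v _ _. x \<in> elts u \<longleftrightarrow> x \<in> elts v" u v v v])
    show "definable N (\<lambda>e. e 0 \<in> elts (e 1) \<longleftrightarrow> e 0 \<in> elts (e 2))" by (intro definable_basic)
  qed (use uv in auto)
  moreover have "u \<in> N" "v \<in> N" using X uv by (auto simp: elem_substruct_def)
  ultimately have "elts u = elts v" using trans by blast
  then show ?thesis by (rule extensionality)
qed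

end

text \<open>These closure properties put all subsets of an element of \<open>N\<close>, and all
  relations between two elements, into \<open>N\<close>. Quantifiers over such objects are therefore
  correct when restricted to \<open>N\<close>.\<close>

locale pow_class = trans_class +
  assumes pow_closed: "x \<in> N \<Longrightarrow> pow x \<in> N"
    and pair_closed: "\<lbrakk>x \<in> N; y \<in> N\<rbrakk> \<Longrightarrow> mkset {x, y} \<in> N"
    and Un_closed: "\<lbrakk>x \<in> N; y \<in> N\<rbrakk> \<Longrightarrow> mkset (elts x \<union> elts y) \<in> N"
begin

lemma subset_closed: "\<lbrakk>x \<in> N; elts y \<subseteq> elts x\<rbrakk> \<Longrightarrow> y \<in> N"
  using pow_closed[of x] trans[of "pow x" y] by simp

lemma kpair_subset_closed:
  assumes "a \<in> N" "b \<in> N" "elts r \<subseteq> {kpair x y |x y. x \<in> elts a \<and> y \<in> elts b}"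
  shows "r \<in> N"
proof (rule subset_closed)
  let ?c = "mkset (elts a \<union> elts b)"
  show "pow (pow ?c) \<in> N" by (intro pow_closed Un_closed assms)
  have c: "elts ?c = elts a \<union> elts b" by (simp add: small_Un)
  have "kpair x y \<in> elts (pow (pow ?c))" if "x \<in> elts a" "y \<in> elts b" for x y
    using that by (auto simp: kpair_def c)
  then show "elts r \<subseteq> elts (pow (pow ?c))" using assms(3) by blast
qed

lemma definable_eq_kpair: "definable N (\<lambda>e. e k = kpair (e i) (e j))"
proof (rule definable_cong)
  show "definable N (\<lambda>e. \<exists>s\<in>N. \<exists>t\<in>N. s = mkset {e i, e i} \<and> t = mkset {e i, e j} \<and> e k = mkset {s, t})"
    by (intro definable_basic definable_eq_doubleton)
  show "e k = kpair (e i) (e j) \<longleftrightarrow>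
      (\<exists>s\<in>N. \<exists>t\<in>N. s = mkset {e i, e i} \<and> t = mkset {e i, e j} \<and> e k = mkset {s, t})"
    if "range e \<subseteq> N" for e
    using that pair_closed[of "e i" "e i"] pair_closed[of "e i" "e j"] by (auto simp: kpair_def)
qed

lemma definable_kpair_mem: "definable N (\<lambda>e. kpair (e i) (e j) \<in> elts (e k))"
  by (rule definable_cong[of _ "\<lambda>e. \<exists>z\<in>elts (e k). z = kpair (e i) (e j)"])
    (intro definable_basic definable_eq_kpair, blast)

lemma definable_lepoll: "definable N (\<lambda>e. elts (e i) \<lesssim> elts (e j))"
proof (rule definable_cong)
  \<comment> \<open>A total relation that relates distinct points to no common value already yields
    an injection by choice, so the formula does not ask \<open>g\<close> to be
    single-valued.\<close>
  let ?Q = "\<lambda>e g. (\<forall>x\<in>elts (e i). \<exists>y\<in>elts (e j). kpair x y \<in> elts g) \<and>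
    (\<forall>x\<in>N. \<forall>x'\<in>N. \<forall>y\<in>N. kpair x y \<in> elts g \<and> kpair x' y \<in> elts g \<longrightarrow> x = x')"
  show "definable N (\<lambda>e. \<exists>g\<in>N. ?Q e g)"
    by (intro definable_basic definable_kpair_mem)
  show "elts (e i) \<lesssim> elts (e j) \<longleftrightarrow> (\<exists>g\<in>N. ?Q e g)" if e: "range e \<subseteq> N" for e
  proof
    assume "elts (e i) \<lesssim> elts (e j)"
    then obtain f where f: "inj_on f (elts (e i))" "f ` elts (e i) \<subseteq> elts (e j)"
      by (auto simp: lepoll_def)
    let ?g = "mkset ((\<lambda>x. kpair x (f x)) ` elts (e i))"
    have g: "elts ?g = (\<lambda>x. kpair x (f x)) ` elts (e i)" by (simp add: small_image)
    have "e i \<in> N" "e j \<in> N" using e by auto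
    then have gN: "?g \<in> N" by (rule kpair_subset_closed) (use f g in auto)
    have kg: "kpair x y \<in> elts ?g \<longleftrightarrow> x \<in> elts (e i) \<and> y = f x" for x y
      unfolding g by auto
    have "?Q e ?g"
      unfolding kg using f(2) inj_onD[OF f(1)] by (intro conjI ballI) blast+
    then show "\<exists>g\<in>N. ?Q e g" using gN by blast
  next
    assume "\<exists>g\<in>N. ?Q e g"
    then obtain g where g: "\<And>x. x \<in> elts (e i) \<Longrightarrow> \<exists>y\<in>elts (e j). kpair x y \<in> elts g"
      "\<And>x x' y. \<lbrakk>x \<in> N; x' \<in> N; y \<in> N; kpair x y \<in> elts g; kpair x' y \<in> elts g\<rbrakk> \<Longrightarrow> x = x'"
      by blast
    have N: "elts (e k) \<subseteq> N" for k using e trans by blast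
    show "elts (e i) \<lesssim> elts (e j)"
      by (rule lepoll_relational_full[where R = "\<lambda>y x. kpair x y \<in> elts g"])
        (use g N in blast)+
  qed
qed

lemma definable_Pkappa: "definable N (\<lambda>e. e i \<in> Pkappa (e j) (e k))"
  by (rule definable_cong[of _ "\<lambda>e. elts (e i) \<subseteq> elts (e k) \<and> \<not> elts (e j) \<lesssim> elts (e i)"])
    (intro definable_basic definable_subset definable_lepoll, simp add: Pkappa_def not_lepoll_iff_lesspoll)

lemma definable_Transset: "definable N (\<lambda>e. Transset (e i))"
  unfolding Transset_def by (intro definable_basic definable_subset)

lemma definable_Ord: "definable N (\<lambda>e. Ord (e i))"
  unfolding Ord_def by (intro definable_basic definable_Transset)

lemma definable_Card: "definable N (\<lambda>e. Card (e i))"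
proof (rule definable_cong)
  show "definable N (\<lambda>e. Ord (e i) \<and> (\<forall>\<alpha>\<in>elts (e i). \<not> elts (e i) \<lesssim> elts \<alpha>))"
    by (intro definable_basic definable_Ord definable_lepoll)
  show "Card (e i) \<longleftrightarrow> Ord (e i) \<and> (\<forall>\<alpha>\<in>elts (e i). \<not> elts (e i) \<lesssim> elts \<alpha>)" if "range e \<subseteq> N" for e
    using Card_not_lepoll_elt Card_Ord eqpoll_sym eqpoll_imp_lepoll unfolding Card_def by blast
qed

end

text \<open>\<open>app\<close> is a description operator without a counterpart among formulas, so
  the list property is restated through the ordered pairs in \<open>d\<close>.\<close>

lemma is_list_iff:
  "is_list P d \<longleftrightarrow> (\<forall>z\<in>elts d. \<exists>a b. z = kpair a b \<and> a \<in> P \<and> elts b \<subseteq> elts a) \<and>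
     (\<forall>a\<in>P. \<exists>b. kpair a b \<in> elts d) \<and>
     (\<forall>a b b'. kpair a b \<in> elts d \<and> kpair a b' \<in> elts d \<longrightarrow> b = b')"
  (is "_ \<longleftrightarrow> ?A \<and> ?B \<and> ?C")
proof
  assume L: "is_list P d"
  then obtain f where f: "elts d = (\<lambda>a. kpair a (f a)) ` P" by (auto simp: is_list_def function_on_def)
  have "app d a = f a" if "a \<in> P" for a
    unfolding app_def by (rule the_equality) (use that f in auto)
  then show "?A \<and> ?B \<and> ?C"
    using L unfolding is_list_def f by auto
next
  assume R: "?A \<and> ?B \<and> ?C"
  have app: "app d a = b" if "kpair a b \<in> elts d" for a b
    unfolding app_def by (rule the_equality) (use that R in auto)
  have "elts d = (\<lambda>a. kpair a (app d a)) ` P"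
  proof (intro equalityI subsetI)
    fix z assume z: "z \<in> elts d"
    then obtain a b where ab: "z = kpair a b" "a \<in> P" using R by blast
    then have "app d a = b" using app z by simp
    then show "z \<in> (\<lambda>a. kpair a (app d a)) ` P" using ab by blast
  next
    fix z assume "z \<in> (\<lambda>a. kpair a (app d a)) ` P"
    then obtain a where a: "a \<in> P" "z = kpair a (app d a)" by blast
    obtain b where "kpair a b \<in> elts d" using R a by blast
    then show "z \<in> elts d" using app a by simp
  qed
  moreover have "elts (app d a) \<subseteq> elts a" if a: "a \<in> P" for a
  proof -
    obtain b where b: "kpair a b \<in> elts d" using R a by blast
    then obtain a' b' where "kpair a b = kpair a' b'" "elts b' \<subseteq> elts a'" using R by blast
    then show ?thesis using app[OF b] by simp
  qed
  ultimately show "is_list P d" unfolding is_list_def function_on_def by blast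
qed

lemma is_list_app_iff:
  assumes "is_list P d" "a \<in> P"
  shows "kpair a b \<in> elts d \<longleftrightarrow> app d a = b"
proof -
  obtain f where f: "elts d = (\<lambda>a. kpair a (f a)) ` P"
    using assms(1) by (auto simp: is_list_def function_on_def)
  have "app d a = f a"
    unfolding app_def by (rule the_equality) (use assms(2) f in auto)
  then show ?thesis using assms(2) f by auto
qed

lemma is_list_app_subset: "\<lbrakk>is_list P d; a \<in> P\<rbrakk> \<Longrightarrow> elts (app d a) \<subseteq> elts a"
  by (simp add: is_list_def)

context pow_class begin

text \<open>The quantifiers of \<open>is_list_iff\<close> can be restricted to \<open>N\<close>:
  components of pairs in the list are in \<open>N\<close> by transitivity, and members of
  \<open>Pkappa\<close> as subsets of an element of \<open>N\<close>.\<close>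

lemma definable_is_list: "definable N (\<lambda>e. is_list (Pkappa (e j) (e k)) (e i))"
proof (rule definable_cong)
  let ?Q = "\<lambda>e. (\<forall>z\<in>elts (e i). \<exists>a\<in>N. \<exists>b\<in>N. z = kpair a b \<and> a \<in> Pkappa (e j) (e k) \<and> elts b \<subseteq> elts a) \<and>
     (\<forall>a\<in>N. a \<in> Pkappa (e j) (e k) \<longrightarrow> (\<exists>b\<in>N. kpair a b \<in> elts (e i))) \<and>
     (\<forall>a\<in>N. \<forall>b\<in>N. \<forall>b'\<in>N. kpair a b \<in> elts (e i) \<and> kpair a b' \<in> elts (e i) \<longrightarrow> b = b')"
  show "definable N ?Q"
    by (intro definable_basic definable_kpair_mem definable_eq_kpair definable_Pkappa definable_subset)
  show "is_list (Pkappa (e j) (e k)) (e i) \<longleftrightarrow> ?Q e" if e: "range e \<subseteq> N" for e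
  proof -
    have N: "e n \<in> N" for n using e by auto
    have P: "a \<in> N" if "a \<in> Pkappa (e j) (e k)" for a
      using that subset_closed[OF N[of k]] by (simp add: Pkappa_def)
    have K: "a \<in> N \<and> b \<in> N" if "kpair a b \<in> elts (e i)" for a b
    proof -
      have "kpair a b \<in> N" using trans[OF N that] .
      then have "mkset {a, b} \<in> N" using trans[of "kpair a b" "mkset {a, b}"] by (simp add: kpair_def)
      then show ?thesis using trans[of "mkset {a, b}"] by simp
    qed
    have "(\<forall>z\<in>elts (e i). \<exists>a b. z = kpair a b \<and> a \<in> Pkappa (e j) (e k) \<and> elts b \<subseteq> elts a) \<longleftrightarrow>
        (\<forall>z\<in>elts (e i). \<exists>a\<in>N. \<exists>b\<in>N. z = kpair a b \<and> a \<in> Pkappa (e j) (e k) \<and> elts b \<subseteq> elts a)"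
      by (rule ball_cong[OF refl]) (use K in blast)
    moreover have "(\<forall>a\<in>Pkappa (e j) (e k). \<exists>b. kpair a b \<in> elts (e i)) \<longleftrightarrow>
        (\<forall>a\<in>N. a \<in> Pkappa (e j) (e k) \<longrightarrow> (\<exists>b\<in>N. kpair a b \<in> elts (e i)))"
      using P K by blast
    moreover have "(\<forall>a b b'. kpair a b \<in> elts (e i) \<and> kpair a b' \<in> elts (e i) \<longrightarrow> b = b') \<longleftrightarrow>
        (\<forall>a\<in>N. \<forall>b\<in>N. \<forall>b'\<in>N. kpair a b \<in> elts (e i) \<and> kpair a b' \<in> elts (e i) \<longrightarrow> b = b')"
      using K by blast
    ultimately show ?thesis unfolding is_list_iff by simp
  qed
qed

end

subsection \<open>Strong limit cardinals\<close>

primrec numeral_set :: "nat \<Rightarrow> 'v::zfc_universe" where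
  "numeral_set 0 = mkset {}"
| "numeral_set (Suc n) = mkset (insert (numeral_set n) (elts (numeral_set n)))"

lemma numeral_set_mem: "m < n \<Longrightarrow> numeral_set m \<in> elts (numeral_set n)"
  by (induction n) (auto simp: small_insert less_Suc_eq)

lemma inj_numeral_set: "inj numeral_set"
  by (rule linorder_injI) (metis numeral_set_mem mem_not_refl)

text \<open>Infinity provides a set containing all von Neumann numerals; Replacement then maps this
  set onto a superset of the range of any HOL sequence.\<close>

lemma small_range_nat: "small (range (f :: nat \<Rightarrow> 'v::zfc_universe))"
proof -
  obtain w :: 'v where w: "\<exists>e\<in>elts w. elts e = {}" "\<forall>n\<in>elts w. \<exists>m\<in>elts w. elts m = insert n (elts n)"
    using infinity by blast
  have "numeral_set n \<in> elts w" for n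
  proof (induction n)
    case 0
    obtain e where "e \<in> elts w" "elts e = {}" using w by blast
    then show ?case using mkset_elts[of e] by simp
  next
    case (Suc n)
    then obtain m where "m \<in> elts w" "elts m = insert (numeral_set n) (elts (numeral_set n))"
      using w by blast
    then show ?case using mkset_elts[of m] by simp
  qed
  moreover have "f n = f (inv numeral_set (numeral_set n :: 'v))" for n
    by (simp add: inv_f_f[OF inj_numeral_set])
  ultimately have "range f \<subseteq> (\<lambda>x. f (inv numeral_set x)) ` elts w"
    by blast
  then show ?thesis using small_subset small_image small_elts by blast
qed

definition cardof :: "'v \<Rightarrow> 'v::zfc_universe" where
  "cardof x = (SOME \<kappa>. Card \<kappa> \<and> elts \<kappa> \<approx> elts x)"

lemma cardof: "Card (cardof x)" "elts (cardof x) \<approx> elts x"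
  using someI_ex[OF ex_Card_eqpoll[of x]] by (auto simp: cardof_def)

lemma Pow_lepoll_mono: "X \<lesssim> Y \<Longrightarrow> Pow X \<lesssim> Pow Y"
  unfolding lepoll_def by (meson Pow_mono image_Pow_mono inj_on_image_Pow)

text \<open>\<theta> is the supremum of |z|, 2^|z|, 2^(2^|z|) and so on. A set smaller than \<theta>
  injects into some stage, hence its power set into the next one.\<close>

lemma ex_strong_limit:
  fixes z :: "'v::zfc_universe"
  shows "\<exists>\<theta>::'v. Card \<theta> \<and> infinite (elts \<theta>) \<and> elts z \<prec> elts \<theta> \<and>
    (\<forall>X::'v set. X \<prec> elts \<theta> \<longrightarrow> Pow X \<prec> elts \<theta>)"
proof -
  define c where "c = rec_nat (cardof z) (\<lambda>_ x. cardof (pow x))"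
  have c0: "c 0 = cardof z" and cS: "c (Suc n) = cardof (pow (c n))" for n
    by (simp_all add: c_def)
  have cC: "Card (c n)" for n by (cases n) (simp_all add: c0 cS cardof)
  have PcS: "Pow (elts (c n)) \<approx> elts (c (Suc n))" for n
    unfolding cS using cardof(2) elts_pow_eqpoll eqpoll_sym eqpoll_trans by blast
  have step: "elts (c n) \<prec> elts (c (Suc n))" for n
    using lesspoll_Pow_self PcS lesspoll_eq_trans by blast
  have mono: "elts (c m) \<prec> elts (c n)" if "m < n" for m n
    using that by (induction rule: less_Suc_induct) (use step lesspoll_trans in blast)+
  define \<theta> where "\<theta> = mkset (\<Union>x\<in>range c. elts x)"
  have e\<theta>: "elts \<theta> = (\<Union>x\<in>range c. elts x)"
    unfolding \<theta>_def by (intro elts_mkset small_Union small_range_nat small_elts)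
  have O: "Ord \<theta>"
    unfolding \<theta>_def using cC Card_Ord by (intro Ord_Union small_range_nat) auto
  have c\<theta>: "elts (c n) \<prec> elts \<theta>" for n
  proof -
    have "elts (c (Suc n)) \<lesssim> elts \<theta>" by (rule subset_imp_lepoll) (auto simp: e\<theta>)
    then show ?thesis using step lesspoll_trans2 by blast
  qed
  have lim: "\<exists>n. \<alpha> \<in> elts (c n)" if "\<alpha> \<in> elts \<theta>" for \<alpha>
    using that by (auto simp: e\<theta>)
  have C: "Card \<theta>"
    unfolding Card_def
  proof (intro conjI ballI O notI)
    fix \<alpha> assume "\<alpha> \<in> elts \<theta>" "elts \<alpha> \<approx> elts \<theta>"
    then obtain n where "\<alpha> \<in> elts (c n)" using lim by blast
    then have "elts \<alpha> \<prec> elts (c n)" using Card_elt_lesspoll cC by blast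
    then have "elts \<alpha> \<prec> elts \<theta>" using c\<theta> lesspoll_trans by blast
    then show False using \<open>elts \<alpha> \<approx> elts \<theta>\<close> by (simp add: lesspoll_def)
  qed
  moreover have "elts z \<prec> elts \<theta>"
    using c\<theta>[of 0] cardof(2)[of z] eqpoll_sym eq_lesspoll_trans unfolding c0 by blast
  moreover have P: "Pow X \<prec> elts \<theta>" if X: "X \<prec> elts \<theta>" for X :: "'v set"
  proof -
    obtain \<alpha> where "\<alpha> \<in> elts \<theta>" "elts \<alpha> \<approx> X" using lesspoll_Card_ex_elt[OF X C] by blast
    moreover then obtain n where "\<alpha> \<in> elts (c n)" using lim by blast
    ultimately have "X \<lesssim> elts (c n)"
      using Card_elt_lesspoll[OF cC] eqpoll_sym lepoll_trans1 lesspoll_imp_lepoll by blast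
    then have "Pow X \<lesssim> Pow (elts (c n))" by (rule Pow_lepoll_mono)
    then have "Pow X \<lesssim> elts (c (Suc n))" using PcS lepoll_trans2 by blast
    then show ?thesis using c\<theta> lesspoll_trans1 by blast
  qed
  moreover have "infinite (elts \<theta>)"
  proof -
    have "inj c"
      by (rule linorder_injI) (metis mono lesspoll_not_refl)
    moreover have "c n \<in> elts \<theta>" for n
    proof -
      have "elts (c (Suc n)) \<subseteq> elts (c n) \<Longrightarrow> False"
        using step lesspoll_trans2 lesspoll_not_refl subset_imp_lepoll by blast
      then have "c n \<in> elts (c (Suc n))"
        using Ord_not_mem_iff[of "c n" "c (Suc n)"] cC Card_Ord by blast
      then show ?thesis by (auto simp: e\<theta>)
    qed
    ultimately show ?thesis by (meson image_subsetI infinite_iff_countable_subset)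
  qed
  ultimately show ?thesis by blast
qed

text \<open>Translated to the HOL theory of cardinal orders, which has the arithmetic of infinite
  cardinals.\<close>

lemma Un_lesspoll:
  fixes A B :: "'a set" and C :: "'b set"
  shows "\<lbrakk>infinite C; A \<prec> C; B \<prec> C\<rbrakk> \<Longrightarrow> A \<union> B \<prec> C"
proof -
  have *: "X \<prec> C \<longleftrightarrow> (card_of X, card_of C) \<in> ordLess" for X :: "'a set"
    unfolding not_lepoll_iff_lesspoll[symmetric] lepoll_def
    using card_of_ordLeq not_ordLess_iff_ordLeq card_of_Well_order by metis
  show "\<lbrakk>infinite C; A \<prec> C; B \<prec> C\<rbrakk> \<Longrightarrow> A \<union> B \<prec> C"
    unfolding * by (rule card_of_Un_ordLess_infinite)
qed

lemma pow_class_Hset: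
  fixes \<theta> :: "'v::zfc_universe"
  assumes inf: "infinite (elts \<theta>)" and P: "\<And>X::'v set. X \<prec> elts \<theta> \<Longrightarrow> Pow X \<prec> elts \<theta>"
  shows "pow_class (Hset \<theta>)"
proof
  fix x y :: 'v
  show "y \<in> Hset \<theta>" if "x \<in> Hset \<theta>" "y \<in> elts x"
    using that by (rule Hset_trans)
  have fin: "finite F \<Longrightarrow> F \<prec> elts \<theta>" for F :: "'v set"
    using inf by (rule finite_lesspoll_infinite)
  show "pow x \<in> Hset \<theta>" if "x \<in> Hset \<theta>"
  proof -
    have "TC (pow x) \<subseteq> elts (pow x) \<union> TC x"
      by (rule TC_least) (use elts_subset_TC TC_elts_subset in force)+
    moreover have "elts (pow x) \<prec> elts \<theta>"
    proof -
      have "elts x \<lesssim> TC x" by (intro subset_imp_lepoll elts_subset_TC)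
      then have "elts x \<prec> elts \<theta>" using that lesspoll_trans1 by (auto simp: Hset_def)
      then show ?thesis using P elts_pow_eqpoll eq_lesspoll_trans by blast
    qed
    ultimately show ?thesis
      using that Un_lesspoll[OF inf] lesspoll_trans1 subset_imp_lepoll unfolding Hset_def by blast
  qed
  \<comment> \<open>One bound on the transitive closure covers both the unordered pair and the
    binary union.\<close>
  have un: "z \<in> Hset \<theta>" if "x \<in> Hset \<theta>" "y \<in> Hset \<theta>" "elts z \<subseteq> {x, y} \<union> (TC x \<union> TC y)" for z
  proof -
    have "TC z \<subseteq> {x, y} \<union> (TC x \<union> TC y)"
      by (rule TC_least) (use that elts_subset_TC TC_elts_subset in blast)+
    moreover have "{x, y} \<union> (TC x \<union> TC y) \<prec> elts \<theta>"
      using that by (intro Un_lesspoll[OF inf] fin[of "{x, y}"]) (auto simp: Hset_def)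
    ultimately show ?thesis
      using lesspoll_trans1 subset_imp_lepoll unfolding Hset_def by blast
  qed
  show "mkset {x, y} \<in> Hset \<theta>" if "x \<in> Hset \<theta>" "y \<in> Hset \<theta>"
    using that by (rule un) simp
  show "mkset (elts x \<union> elts y) \<in> Hset \<theta>" if "x \<in> Hset \<theta>" "y \<in> Hset \<theta>"
    using that by (rule un) (use elts_subset_TC[of x] elts_subset_TC[of y] in \<open>auto simp: small_Un\<close>)
qed

lemma ex_strong_limit_Hset:
  fixes z \<alpha> :: "'v::zfc_universe"
  assumes "Ord \<alpha>"
  shows "\<exists>\<theta>. Card \<theta> \<and> \<alpha> \<in> elts \<theta> \<and> z \<in> Hset \<theta> \<and> pow_class (Hset \<theta>)"
proof -
  obtain \<theta> :: 'v where \<theta>: "Card \<theta>" "infinite (elts \<theta>)" "elts (mkset (elts \<alpha> \<union> TC z)) \<prec> elts \<theta>"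
    and P: "\<And>X::'v set. X \<prec> elts \<theta> \<Longrightarrow> Pow X \<prec> elts \<theta>"
    using ex_strong_limit by blast
  have *: "elts \<alpha> \<union> TC z \<prec> elts \<theta>" using \<theta>(3) by (simp add: small_Un small_TC)
  then have "\<not> elts \<theta> \<subseteq> elts \<alpha>"
    by (metis lesspoll_not_refl lesspoll_trans2 subset_imp_lepoll le_supI1)
  then have "\<alpha> \<in> elts \<theta>" using Ord_not_mem_iff[OF assms Card_Ord[OF \<theta>(1)]] by blast
  moreover have "z \<in> Hset \<theta>"
    using * lesspoll_trans1 subset_imp_lepoll[of "TC z" "elts \<alpha> \<union> TC z"] by (auto simp: Hset_def)
  ultimately show ?thesis using \<theta> pow_class_Hset P by blast
qed

subsection \<open>Normal measures inside a class closed under power sets\<close>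

text \<open>Given normality and fineness, \<open>\<kappa>\<close>-completeness is equivalent to \<open>x \<inter> \<kappa>\<close> being transitive for
  almost all \<open>x\<close>, which avoids quantifying over subfamilies of size less than \<open>\<kappa>\<close>.\<close>

lemma normal_measureI:
  fixes \<kappa> A :: "'v::zfc_universe"
  defines "P \<equiv> Pkappa \<kappa> A"
  assumes \<kappa>: "Card \<kappa>" "elts \<kappa> \<subseteq> elts A"
    and sub: "\<And>S. S \<in> V \<Longrightarrow> S \<subseteq> P \<and> S \<noteq> {}"
    and int: "\<And>S T. \<lbrakk>S \<in> V; T \<in> V\<rbrakk> \<Longrightarrow> S \<inter> T \<in> V"
    and up: "\<And>S T. \<lbrakk>S \<in> V; S \<subseteq> T; T \<subseteq> P\<rbrakk> \<Longrightarrow> T \<in> V"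
    and ultra: "\<And>S. S \<subseteq> P \<Longrightarrow> S \<in> V \<or> P - S \<in> V"
    and fine: "\<And>a. a \<in> elts A \<Longrightarrow> {x \<in> P. a \<in> elts x} \<in> V"
    and tr: "{x \<in> P. \<forall>\<beta>\<in>elts x. \<beta> \<in> elts \<kappa> \<longrightarrow> elts \<beta> \<subseteq> elts x} \<in> V"
    and normal: "\<And>S R. \<lbrakk>S \<in> V; \<And>x. x \<in> S \<Longrightarrow> \<exists>a\<in>elts x. R x a\<rbrakk> \<Longrightarrow> \<exists>a\<in>elts A. {x \<in> P. R x a} \<in> V"
  shows "normal_measure \<kappa> A V"
  unfolding normal_measure_def P_def[symmetric]
proof (intro conjI allI impI ballI)
  show "V \<subseteq> Pow P" using sub by blast
  show "{} \<notin> V" using sub by blast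
  then show "P \<in> V" using ultra[of "{}"] by auto
  show "Y \<in> V" if "X \<in> V \<and> X \<subseteq> Y \<and> Y \<subseteq> P" for X Y using that up by blast
  show "X \<in> V \<or> P - X \<in> V" if "X \<subseteq> P" for X using that by (rule ultra)
  show "{x \<in> P. a \<in> elts x} \<in> V" if "a \<in> elts A" for a using that by (rule fine)
next
  fix f assume f: "{x \<in> P. f x \<in> elts x} \<in> V"
  show "\<exists>a\<in>elts A. {x \<in> P. f x = a} \<in> V" by (rule normal[OF f]) auto
next
  fix F assume F: "F \<subseteq> V \<and> F \<noteq> {} \<and> F \<prec> elts \<kappa>"
  then obtain \<beta> where \<beta>: "\<beta> \<in> elts \<kappa>" "elts \<beta> \<approx> F" using lesspoll_Card_ex_elt \<kappa>(1) by blast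
  then obtain h where h: "h ` elts \<beta> = F" by (auto simp: eqpoll_def bij_betw_def)
  show "\<Inter>F \<in> V"
  proof (rule ccontr)
    assume "\<Inter>F \<notin> V"
    moreover have "\<Inter>F \<subseteq> P" using F sub by blast
    ultimately have D: "P - \<Inter>F \<in> V" using ultra by blast
    \<comment> \<open>If \<open>x\<close> is in \<open>?D\<close>, then \<beta> is a subset of
      \<open>x\<close>, so the index of a member of \<open>F\<close> that omits \<open>x\<close> can
      be chosen inside \<open>x\<close>. Normality fixes one index \<open>a\<close> almost
      everywhere, and \<open>h a\<close> is then both in \<open>V\<close> and disjoint from a set in
      \<open>V\<close>.\<close>
    let ?D = "(P - \<Inter>F) \<inter> {x \<in> P. \<beta> \<in> elts x} \<inter>
        {x \<in> P. \<forall>\<beta>\<in>elts x. \<beta> \<in> elts \<kappa> \<longrightarrow> elts \<beta> \<subseteq> elts x}"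
    have "?D \<in> V" using \<beta> \<kappa> by (intro int D fine tr) auto
    moreover have "\<exists>a\<in>elts x. a \<in> elts \<beta> \<and> x \<notin> h a" if x: "x \<in> ?D" for x
    proof -
      obtain S where "S \<in> F" "x \<notin> S" using x by blast
      then obtain a where "a \<in> elts \<beta>" "x \<notin> h a" using h by blast
      moreover have "elts \<beta> \<subseteq> elts x" using x \<beta> by blast
      ultimately show ?thesis by blast
    qed
    ultimately obtain a where a: "{x \<in> P. a \<in> elts \<beta> \<and> x \<notin> h a} \<in> V"
      using normal[of ?D "\<lambda>x a. a \<in> elts \<beta> \<and> x \<notin> h a"] by blast
    then have "a \<in> elts \<beta>" using sub by blast
    then have "h a \<in> V" using h F by blast
    then have "{x \<in> P. a \<in> elts \<beta> \<and> x \<notin> h a} \<inter> h a \<in> V" using a int by blast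
    moreover have "{x \<in> P. a \<in> elts \<beta> \<and> x \<notin> h a} \<inter> h a = {}" by blast
    ultimately show False using sub by metis
  qed
qed

text \<open>The last conjunct is normality for a relation given as a set \<open>Y\<close> of pairs, instead of a function.\<close>

definition nm_clause :: "'v set \<Rightarrow> 'v \<Rightarrow> 'v \<Rightarrow> 'v \<Rightarrow> 'v \<Rightarrow> 'v::zfc_universe \<Rightarrow> bool" where
  "nm_clause N Y Z \<kappa> A U \<longleftrightarrow>
    (Y \<in> elts U \<longrightarrow> (\<forall>x\<in>elts Y. x \<in> Pkappa \<kappa> A) \<and> (\<exists>x\<in>elts Y. x = x)) \<and>
    (Y \<in> elts U \<and> Z \<in> elts U \<longrightarrow> (\<exists>W\<in>elts U. elts W \<subseteq> elts Y \<and> elts W \<subseteq> elts Z)) \<and>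
    (Y \<in> elts U \<and> elts Y \<subseteq> elts Z \<and> (\<forall>x\<in>elts Z. x \<in> Pkappa \<kappa> A) \<longrightarrow> Z \<in> elts U) \<and>
    ((\<forall>x\<in>elts Y. x \<in> Pkappa \<kappa> A) \<and> (\<forall>x\<in>elts Z. x \<in> Pkappa \<kappa> A) \<and>
      (\<forall>x\<in>N. x \<in> Pkappa \<kappa> A \<longrightarrow> x \<in> elts Y \<or> x \<in> elts Z) \<longrightarrow> Y \<in> elts U \<or> Z \<in> elts U) \<and>
    (Y \<in> elts A \<and> (\<forall>x\<in>N. x \<in> elts Z \<longleftrightarrow> x \<in> Pkappa \<kappa> A \<and> Y \<in> elts x) \<longrightarrow> Z \<in> elts U) \<and>
    ((\<forall>x\<in>N. x \<in> elts Z \<longleftrightarrow> x \<in> Pkappa \<kappa> A \<and>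
      (\<forall>\<beta>\<in>elts x. \<beta> \<in> elts \<kappa> \<longrightarrow> elts \<beta> \<subseteq> elts x)) \<longrightarrow> Z \<in> elts U) \<and>
    (Z \<in> elts U \<and> (\<forall>x\<in>elts Z. \<exists>a\<in>elts x. kpair x a \<in> elts Y) \<longrightarrow>
      (\<exists>a\<in>elts A. \<exists>W\<in>elts U. \<forall>x\<in>elts W. kpair x a \<in> elts Y))"

text \<open>All axioms share two universally quantified parameters in one clause, so a single
  application of \<open>elem_substruct_ball2\<close> transfers all of them from \<open>X\<close> to
  \<open>N\<close>.\<close>

definition nm_code :: "'v set \<Rightarrow> 'v \<Rightarrow> 'v \<Rightarrow> 'v::zfc_universe \<Rightarrow> bool" where
  "nm_code N \<kappa> A U \<longleftrightarrow> (\<forall>Y\<in>N. \<forall>Z\<in>N. nm_clause N Y Z \<kappa> A U)"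

context pow_class begin

lemma Pkappa_closed: "\<lbrakk>A \<in> N; x \<in> Pkappa \<kappa> A\<rbrakk> \<Longrightarrow> x \<in> N"
  using subset_closed by (auto simp: Pkappa_def)

text \<open>Every subset of P_kappa(A) and every relation between P_kappa(A) and A is an element of
  \<open>N\<close>, so quantification over \<open>N\<close> in the code reaches all HOL sets and
  functions in the definition of a normal measure.\<close>

lemma normal_measure_nm_code:
  assumes \<kappa>: "Card \<kappa>" "elts \<kappa> \<subseteq> elts A" and A: "A \<in> N" and U: "U \<in> N"
    and code: "nm_code N \<kappa> A U"
  shows "normal_measure \<kappa> A {S. S \<subseteq> Pkappa \<kappa> A \<and> mkset S \<in> elts U}"
proof -
  define P where "P = Pkappa \<kappa> A"
  define V where "V = {S. S \<subseteq> P \<and> mkset S \<in> elts U}"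
  have P: "P \<subseteq> elts (pow A)" by (auto simp: P_def Pkappa_def)
  have sm: "elts (mkset S) = S" and smN: "mkset S \<in> N" if "S \<subseteq> P" for S
  proof -
    have S: "S \<subseteq> elts (pow A)" using that P by blast
    then have "small S" using small_subset small_elts by blast
    then show e: "elts (mkset S) = S" by simp
    show "mkset S \<in> N"
      by (rule subset_closed[OF pow_closed[OF A]]) (use S e in simp)
  qed
  have cl: "nm_clause N Y Z \<kappa> A U" if "Y \<in> N" "Z \<in> N" for Y Z
    using code that by (simp add: nm_code_def)
  have UN: "Y \<in> N" if "Y \<in> elts U" for Y using trans[OF U that] .
  have c1: "elts Y \<subseteq> P \<and> elts Y \<noteq> {}" if "Y \<in> elts U" for Y
    using cl[OF UN UN, OF that that] that unfolding nm_clause_def P_def by blast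
  have up: "S \<in> V" if "Y \<in> elts U" "elts Y \<subseteq> S" "S \<subseteq> P" for Y S
  proof -
    have "elts Y \<subseteq> elts (mkset S)" "\<forall>x\<in>elts (mkset S). x \<in> Pkappa \<kappa> A"
      using that sm[of S] by (auto simp: P_def)
    then have "mkset S \<in> elts U"
      using cl[OF UN smN, OF that(1,3)] that(1) unfolding nm_clause_def by blast
    then show ?thesis using that by (simp add: V_def)
  qed
  have VD: "mkset S \<in> elts U" "mkset S \<in> N" "elts (mkset S) = S" "S \<subseteq> P" if "S \<in> V" for S
    using that sm smN by (auto simp: V_def)
  show ?thesis
    unfolding P_def[symmetric] V_def[symmetric]
  proof (rule normal_measureI[OF \<kappa>, folded P_def])
    fix S assume S: "S \<in> V"
    then show "S \<subseteq> P \<and> S \<noteq> {}" using c1[OF VD(1)[OF S]] VD(3)[OF S] by simp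
  next
    fix S T assume S: "S \<in> V" and T: "T \<in> V"
    obtain W where W: "W \<in> elts U" "elts W \<subseteq> S" "elts W \<subseteq> T"
      using cl[of "mkset S" "mkset T"] VD[OF S] VD[OF T] unfolding nm_clause_def by auto
    show "S \<inter> T \<in> V" by (rule up[OF W(1)]) (use W VD(4)[OF S] in auto)
  next
    fix S T assume "S \<in> V" "S \<subseteq> T" "T \<subseteq> P"
    then show "T \<in> V" using up VD by metis
  next
    fix S R assume S: "S \<in> V" and R: "\<And>x. x \<in> S \<Longrightarrow> \<exists>a\<in>elts x. R x a"
    \<comment> \<open>The HOL relation \<open>R\<close> is cut down to P \<times> A to become a set
      of pairs in \<open>N\<close>, as the normality clause requires.\<close>
    let ?Q = "{kpair x a |x a. x \<in> P \<and> a \<in> elts A \<and> R x a}"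
    have "?Q \<subseteq> {kpair x a |x a. x \<in> elts (pow A) \<and> a \<in> elts A}" using P by blast
    moreover have "small \<dots>" by (intro small_times small_elts)
    ultimately have "small ?Q" using small_subset by blast
    then have eQ: "elts (mkset ?Q) = ?Q" by simp
    have QN: "mkset ?Q \<in> N"
      by (rule kpair_subset_closed[OF pow_closed[OF A] A]) (use eQ P in auto)
    have kQ: "kpair x a \<in> elts (mkset ?Q) \<longleftrightarrow> x \<in> P \<and> a \<in> elts A \<and> R x a" for x a
      unfolding eQ by auto
    have "\<exists>a\<in>elts x. kpair x a \<in> elts (mkset ?Q)" if "x \<in> S" for x
      unfolding kQ using R[OF that] that VD(4)[OF S] by (auto simp: P_def Pkappa_def)
    then have "\<forall>x\<in>elts (mkset S). \<exists>a\<in>elts x. kpair x a \<in> elts (mkset ?Q)"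
      using VD(3)[OF S] by simp
    then have "\<exists>a\<in>elts A. \<exists>W\<in>elts U. \<forall>x\<in>elts W. kpair x a \<in> elts (mkset ?Q)"
      using cl[OF QN VD(2)[OF S]] VD(1)[OF S] unfolding nm_clause_def by blast
    then obtain a W where W: "a \<in> elts A" "W \<in> elts U" "\<forall>x\<in>elts W. kpair x a \<in> elts (mkset ?Q)"
      by blast
    have "{x \<in> P. R x a} \<in> V" by (rule up[OF W(2)]) (use W(3) kQ in auto)
    then show "\<exists>a\<in>elts A. {x \<in> P. R x a} \<in> V" using W(1) by blast
  next
    fix S assume S: "S \<subseteq> P"
    have "P - S \<subseteq> P" by blast
    have "(\<forall>x\<in>elts (mkset S). x \<in> Pkappa \<kappa> A) \<and> (\<forall>x\<in>elts (mkset (P - S)). x \<in> Pkappa \<kappa> A) \<and>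
      (\<forall>x\<in>N. x \<in> Pkappa \<kappa> A \<longrightarrow> x \<in> elts (mkset S) \<or> x \<in> elts (mkset (P - S)))"
      unfolding sm[OF S] sm[OF \<open>P - S \<subseteq> P\<close>] using S by (auto simp: P_def)
    then have "mkset S \<in> elts U \<or> mkset (P - S) \<in> elts U"
      using cl[OF smN smN, OF S \<open>P - S \<subseteq> P\<close>] unfolding nm_clause_def by satx
    then show "S \<in> V \<or> P - S \<in> V" using S by (auto simp: V_def)
  next
    fix a assume a: "a \<in> elts A"
    let ?S = "{x \<in> P. a \<in> elts x}"
    have "mkset ?S \<in> elts U"
      using cl[of a "mkset ?S"] sm[of ?S] smN[of ?S] a trans[OF A a]
      unfolding nm_clause_def P_def by simp
    then show "?S \<in> V" by (auto simp: V_def)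
  next
    let ?S = "{x \<in> P. \<forall>\<beta>\<in>elts x. \<beta> \<in> elts \<kappa> \<longrightarrow> elts \<beta> \<subseteq> elts x}"
    have "mkset ?S \<in> elts U"
      using cl[of A "mkset ?S"] sm[of ?S] smN[of ?S] A unfolding nm_clause_def P_def by simp
    then show "?S \<in> V" by (auto simp: V_def)
  qed
qed

lemma definable_nm_clause: "definable N (\<lambda>e. nm_clause N (e i) (e j) (e k) (e l) (e m))"
  unfolding nm_clause_def by (intro definable_basic definable_Pkappa definable_subset definable_kpair_mem)

lemma definable_nm_code: "definable N (\<lambda>e. nm_code N (e i) (e j) (e k))"
  unfolding nm_code_def by (intro definable_basic definable_nm_clause)

end

subsection \<open>Lists coding families of subsets\<close>

text \<open>The code \<xi> answers through the list whether the trace of an index \<open>a\<close>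
  on \<open>A\<close> lies in \<open>Y\<close>. Pairs and quantifiers over \<open>N\<close> replace
  the value of \<open>d\<close> and the intersection, for which formulas have no terms;
  \<open>coded_iff\<close> gives the intended reading.\<close>

definition coded :: "'v set \<Rightarrow> 'v \<Rightarrow> 'v \<Rightarrow> 'v \<Rightarrow> 'v::zfc_universe \<Rightarrow> bool" where
  "coded N \<xi> Y A d \<longleftrightarrow> (\<forall>a\<in>N. \<forall>b\<in>N. kpair a b \<in> elts d \<longrightarrow>
    (\<xi> \<in> elts b \<longleftrightarrow> \<xi> \<in> elts a \<and> (\<exists>x\<in>elts Y. \<forall>u\<in>N. u \<in> elts x \<longleftrightarrow> u \<in> elts a \<and> u \<in> elts A)))"

definition codes_all :: "'v set \<Rightarrow> 'v \<Rightarrow> 'v \<Rightarrow> 'v \<Rightarrow> 'v::zfc_universe \<Rightarrow> bool" where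
  "codes_all N \<kappa> lam A d \<longleftrightarrow>
    (\<forall>Y\<in>N. (\<forall>x\<in>elts Y. x \<in> Pkappa \<kappa> A) \<longrightarrow> (\<exists>\<xi>\<in>elts lam. coded N \<xi> Y A d))"

lemma (in trans_class) coded_iff:
  assumes "Y \<in> N" "A \<in> N"
  shows "coded N \<xi> Y A d \<longleftrightarrow> (\<forall>a\<in>N. \<forall>b\<in>N. kpair a b \<in> elts d \<longrightarrow>
    (\<xi> \<in> elts b \<longleftrightarrow> \<xi> \<in> elts a \<and> mkset (elts a \<inter> elts A) \<in> elts Y))"
proof -
  have sm: "small (elts a \<inter> elts A)" for a by (rule small_subset[OF small_elts]) auto
  have eq: "(\<forall>u\<in>N. u \<in> elts x \<longleftrightarrow> u \<in> elts a \<and> u \<in> elts A) \<longleftrightarrow> x = mkset (elts a \<inter> elts A)"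
    if "x \<in> elts Y" for x a
  proof
    assume R: "\<forall>u\<in>N. u \<in> elts x \<longleftrightarrow> u \<in> elts a \<and> u \<in> elts A"
    have "x \<in> N" using that assms(1) trans by blast
    then have "elts x \<subseteq> N" "elts A \<subseteq> N" using trans assms(2) by blast+
    then have "elts x = elts a \<inter> elts A" using R by blast
    then show "x = mkset (elts a \<inter> elts A)" by (metis mkset_elts)
  qed (simp add: sm)
  have "(\<exists>x\<in>elts Y. \<forall>u\<in>N. u \<in> elts x \<longleftrightarrow> u \<in> elts a \<and> u \<in> elts A) \<longleftrightarrow>
      mkset (elts a \<inter> elts A) \<in> elts Y" for a
  proof -
    have "(\<exists>x\<in>elts Y. \<forall>u\<in>N. u \<in> elts x \<longleftrightarrow> u \<in> elts a \<and> u \<in> elts A) \<longleftrightarrow>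
        (\<exists>x\<in>elts Y. x = mkset (elts a \<inter> elts A))"
      by (rule bex_cong[OF refl]) (rule eq)
    then show ?thesis by simp
  qed
  then show ?thesis unfolding coded_def by (simp only:)
qed

text \<open>\<open>lam\<close> is the size of the double power set of \<open>A\<close>, so that
  \<open>f\<close> enumerates all families of subsets of \<open>A\<close>. The inclusion of
  \<open>A\<close> in \<open>lam\<close> is what lets an index \<open>X \<inter> lam\<close>
  determine \<open>X \<inter> A\<close>. The list is independent of \<open>N\<close>, which leaves
  \<theta> free to be chosen afterwards.\<close>

lemma ex_coding_list:
  fixes \<kappa> A :: "'v::zfc_universe"
  assumes A: "Card A"
  shows "\<exists>lam d. Card lam \<and> elts A \<subseteq> elts lam \<and> is_list (Pkappa \<kappa> lam) d \<and>
    (\<forall>N. trans_class N \<longrightarrow> A \<in> N \<longrightarrow> codes_all N \<kappa> lam A d)"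
proof -
  define lam where "lam = cardof (pow (pow A))"
  have lam: "Card lam" "elts lam \<approx> elts (pow (pow A))" unfolding lam_def by (rule cardof)+
  have "elts A \<lesssim> elts (pow A)" "elts (pow A) \<lesssim> elts (pow (pow A))"
    using lepoll_Pow_self elts_pow_eqpoll eqpoll_sym lepoll_trans2 by blast+
  then have "elts A \<lesssim> elts lam"
    using lam(2) eqpoll_sym lepoll_trans lepoll_trans2 by blast
  then have Alam: "elts A \<subseteq> elts lam" by (rule lepoll_Card_subset[OF A Card_Ord[OF lam(1)]])
  obtain f where f: "f ` elts lam = elts (pow (pow A))"
    using lam(2) by (auto simp: eqpoll_def bij_betw_def)
  define g where "g a = mkset {\<xi> \<in> elts a. mkset (elts a \<inter> elts A) \<in> elts (f \<xi>)}" for a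
  have g: "elts (g a) = {\<xi> \<in> elts a. mkset (elts a \<inter> elts A) \<in> elts (f \<xi>)}" for a
    unfolding g_def by (rule elts_mkset, rule small_subset[OF small_elts]) auto
  define d where "d = mkset ((\<lambda>a. kpair a (g a)) ` Pkappa \<kappa> lam)"
  have "Pkappa \<kappa> lam \<subseteq> elts (pow lam)" by (auto simp: Pkappa_def)
  then have d: "elts d = (\<lambda>a. kpair a (g a)) ` Pkappa \<kappa> lam"
    unfolding d_def by (intro elts_mkset small_image) (rule small_subset[OF small_elts])
  have L: "is_list (Pkappa \<kappa> lam) d"
    unfolding is_list_iff d using g by auto
  have "codes_all N \<kappa> lam A d" if N: "trans_class N" "A \<in> N" for N
    unfolding codes_all_def
  proof (intro ballI impI)
    interpret trans_class N by (rule N(1))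
    fix Y assume Y: "Y \<in> N" "\<forall>x\<in>elts Y. x \<in> Pkappa \<kappa> A"
    then have "Y \<in> elts (pow (pow A))" by (auto simp: Pkappa_def)
    then obtain \<xi> where \<xi>: "\<xi> \<in> elts lam" "f \<xi> = Y" using f by (metis imageE)
    have "coded N \<xi> Y A d"
      unfolding coded_iff[OF Y(1) N(2)] d using \<xi>(2) g by auto
    then show "\<exists>\<xi>\<in>elts lam. coded N \<xi> Y A d" using \<xi> by blast
  qed
  then show ?thesis using lam(1) Alam L by blast
qed

context pow_class begin

lemma definable_coded: "definable N (\<lambda>e. coded N (e i) (e j) (e k) (e l))"
  unfolding coded_def by (intro definable_basic definable_kpair_mem)

lemma definable_codes_all: "definable N (\<lambda>e. codes_all N (e i) (e j) (e k) (e l))"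
  unfolding codes_all_def by (intro definable_basic definable_Pkappa definable_coded)

text \<open>The family \<open>U\<close> of sets coded by elements of \<open>y\<close> belongs to \<open>X\<close>, and a member \<open>Y\<close> of \<open>X\<close> is
  in \<open>U\<close> iff it contains \<open>X \<inter> A\<close>. Hence every clause of the normal measure property holds for
  all parameters in \<open>X\<close>, and by elementarity for all parameters.\<close>

lemma nm_code_of_list:
  assumes X: "elem_substruct X N" and X\<kappa>: "X \<prec> elts \<kappa>"
    and X_tr: "\<And>\<beta>. \<lbrakk>\<beta> \<in> X; \<beta> \<in> elts \<kappa>\<rbrakk> \<Longrightarrow> elts \<beta> \<subseteq> X"
    and \<kappa>: "Card \<kappa>" "elts \<kappa> \<subseteq> elts A" and Alam: "elts A \<subseteq> elts lam"
    and inX: "\<kappa> \<in> X" "lam \<in> X" "A \<in> X" "d \<in> X" "y \<in> X"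
    and L: "is_list (Pkappa \<kappa> lam) d" and codes: "codes_all N \<kappa> lam A d"
    and y: "elts y \<inter> X = elts (app d (mkset (X \<inter> elts lam))) \<inter> X"
  shows "\<exists>U\<in>N. nm_code N \<kappa> A U"
proof -
  have XN: "x \<in> X \<Longrightarrow> x \<in> N" for x using X by (auto simp: elem_substruct_def)
  have smallX: "small (X \<inter> elts z)" for z by (rule small_subset[OF small_elts[of z]]) auto
  have lessX: "X \<inter> elts z \<prec> elts \<kappa>" for z
    using X\<kappa> lesspoll_trans1 subset_imp_lepoll[of "X \<inter> elts z" X] by blast
  \<comment> \<open>Two traces of \<open>X\<close>: \<open>a0\<close> is the index at which the list
    is evaluated, \<open>x0\<close> is the point that will generate the measure.\<close>
  define a0 where "a0 = mkset (X \<inter> elts lam)"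
  define x0 where "x0 = mkset (X \<inter> elts A)"
  have a0: "elts a0 = X \<inter> elts lam" and x0: "elts x0 = X \<inter> elts A"
    by (simp_all add: a0_def x0_def smallX)
  have a0P: "a0 \<in> Pkappa \<kappa> lam" and x0P: "x0 \<in> Pkappa \<kappa> A"
    using lessX by (auto simp: Pkappa_def a0 x0)
  have a0N: "a0 \<in> N" and x0N: "x0 \<in> N"
    using Pkappa_closed XN inX a0P x0P by blast+
  define b0 where "b0 = app d a0"
  have b0: "kpair a0 b0 \<in> elts d" "elts b0 \<subseteq> elts a0"
    using is_list_app_iff[OF L a0P] is_list_app_subset[OF L a0P] by (simp_all add: b0_def)
  have b0N: "b0 \<in> N" using subset_closed[OF a0N b0(2)] .
  have yb: "\<xi> \<in> elts y \<longleftrightarrow> \<xi> \<in> elts b0" if "\<xi> \<in> X" for \<xi>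
    using y that by (auto simp: b0_def a0_def)
  have a0A: "mkset (elts a0 \<inter> elts A) = x0"
    unfolding a0 x0_def using Alam by (intro arg_cong[of _ _ mkset]) auto
  have coded_b0: "\<xi> \<in> elts b0 \<longleftrightarrow> \<xi> \<in> elts a0 \<and> x0 \<in> elts Y" if "coded N \<xi> Y A d" "Y \<in> N" for \<xi> Y
    using that coded_iff[of Y A \<xi> d] XN inX a0N b0N b0(1) a0A by auto
  \<comment> \<open>Membership is expressed through \<open>y\<close> and not through
    \<open>x0\<close>, because \<open>x0\<close> is not assumed to lie in \<open>X\<close> while all
    parameters used here do. Hence \<open>U\<close> is definable from elements of
    \<open>X\<close>.\<close>
  define inU where "inU Y y d A \<kappa> \<longleftrightarrow> (\<forall>x\<in>elts Y. x \<in> Pkappa \<kappa> A) \<and> (\<exists>\<xi>\<in>elts y. coded N \<xi> Y A d)"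
    for Y y d A \<kappa>
  define U where "U = mkset {Y. inU Y y d A \<kappa>}"
  have sub: "{Y. inU Y y d A \<kappa>} \<subseteq> elts (pow (pow A))"
    by (auto simp: inU_def Pkappa_def)
  then have U: "elts U = {Y. inU Y y d A \<kappa>}"
    unfolding U_def by (intro elts_mkset small_subset[OF small_elts])
  have UN: "U \<in> N"
    by (rule subset_closed[OF pow_closed[OF pow_closed[OF XN[OF inX(3)]]]]) (use U sub in simp)
  have UX: "U \<in> X"
  proof -
    have "\<exists>u\<in>X. \<forall>Y\<in>N. Y \<in> elts u \<longleftrightarrow> inU Y y d A \<kappa>"
    proof (rule elem_substruct_bex[OF X, of "\<lambda>u y d A \<kappa>. \<forall>Y\<in>N. Y \<in> elts u \<longleftrightarrow> inU Y y d A \<kappa>"])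
      show "definable N (\<lambda>e. \<forall>Y\<in>N. Y \<in> elts (e 0) \<longleftrightarrow> inU Y (e 1) (e 2) (e 3) (e 4))"
        unfolding inU_def by (intro definable_basic definable_Pkappa definable_coded)
    qed (use inX U UN in auto)
    then obtain u where u: "u \<in> X" "\<forall>Y\<in>N. Y \<in> elts u \<longleftrightarrow> inU Y y d A \<kappa>" by blast
    then have "elts u = elts U"
      using trans[OF XN[OF u(1)]] trans[OF UN] unfolding U by blast
    then show ?thesis using u(1) extensionality by metis
  qed
  \<comment> \<open>Since \<open>y\<close> agrees with the list value \<open>b0\<close> only on
    \<open>X\<close>, a code of \<open>Y\<close> must first be moved into \<open>X\<close> by
    elementarity, in both directions.\<close>
  have mem_U: "Y \<in> elts U \<longleftrightarrow> x0 \<in> elts Y" if Y: "Y \<in> X" "\<forall>x\<in>elts Y. x \<in> Pkappa \<kappa> A" for Y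
  proof
    assume "Y \<in> elts U"
    then have ex: "\<exists>\<xi>\<in>N. \<xi> \<in> elts y \<and> coded N \<xi> Y A d"
      using trans[OF XN[OF inX(5)]] unfolding U inU_def by blast
    have "\<exists>\<xi>\<in>X. \<xi> \<in> elts y \<and> coded N \<xi> Y A d"
    proof (rule elem_substruct_bex[OF X, of "\<lambda>\<xi> y Y A d. \<xi> \<in> elts y \<and> coded N \<xi> Y A d"])
      show "definable N (\<lambda>e. e 0 \<in> elts (e 1) \<and> coded N (e 0) (e 2) (e 3) (e 4))"
        by (intro definable_basic definable_coded)
    qed (use inX Y ex in auto)
    then show "x0 \<in> elts Y" using yb coded_b0 XN Y(1) by blast
  next
    assume x0Y: "x0 \<in> elts Y"
    have ex: "\<exists>\<xi>\<in>N. \<xi> \<in> elts lam \<and> coded N \<xi> Y A d"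
      using codes Y XN[OF Y(1)] trans[OF XN[OF inX(2)]] unfolding codes_all_def by blast
    have "\<exists>\<xi>\<in>X. \<xi> \<in> elts lam \<and> coded N \<xi> Y A d"
    proof (rule elem_substruct_bex[OF X, of "\<lambda>\<xi> lam Y A d. \<xi> \<in> elts lam \<and> coded N \<xi> Y A d"])
      show "definable N (\<lambda>e. e 0 \<in> elts (e 1) \<and> coded N (e 0) (e 2) (e 3) (e 4))"
        by (intro definable_basic definable_coded)
    qed (use inX Y ex in auto)
    then obtain \<xi> where \<xi>: "\<xi> \<in> X" "\<xi> \<in> elts lam" "coded N \<xi> Y A d" by blast
    then have "\<xi> \<in> elts b0" using coded_b0 x0Y XN[OF Y(1)] a0 by blast
    then show "Y \<in> elts U" using \<xi> yb Y(2) by (auto simp: U inU_def)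
  qed
  have PN: "(\<forall>x\<in>N. x \<in> elts Z \<longleftrightarrow> x \<in> Pkappa \<kappa> A \<and> Q x) \<Longrightarrow> Z \<in> X \<Longrightarrow>
      Z \<in> elts U \<longleftrightarrow> Q x0" for Z Q
    using mem_U[of Z] trans[of Z] XN[of Z] x0P x0N by blast
  have UP: "\<forall>x\<in>elts Y. x \<in> Pkappa \<kappa> A" if "Y \<in> elts U" for Y
    using that by (simp add: U inU_def)
  have "nm_clause N Y Z \<kappa> A U" if YZ: "Y \<in> X" "Z \<in> X" for Y Z
    unfolding nm_clause_def
  proof (intro conjI impI)
    assume "Y \<in> elts U"
    then show "\<forall>x\<in>elts Y. x \<in> Pkappa \<kappa> A" "\<exists>x\<in>elts Y. x = x"
      using UP mem_U YZ by blast+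
  next
    assume U2: "Y \<in> elts U \<and> Z \<in> elts U"
    \<comment> \<open>The criterion \<open>mem_U\<close> applies only to elements of
      \<open>X\<close>, so the intersection has to be found in \<open>X\<close>.\<close>
    have "\<exists>W\<in>X. \<forall>x\<in>N. x \<in> elts W \<longleftrightarrow> x \<in> elts Y \<and> x \<in> elts Z"
    proof (rule elem_substruct_bex[OF X, of "\<lambda>W Y Z _ _. \<forall>x\<in>N. x \<in> elts W \<longleftrightarrow> x \<in> elts Y \<and> x \<in> elts Z" Y Z Y Y])
      have sm: "small (elts Y \<inter> elts Z)" by (rule small_subset[OF small_elts]) auto
      then have "mkset (elts Y \<inter> elts Z) \<in> N"
        by (intro subset_closed[OF XN[OF YZ(1)]]) simp
      then show "\<exists>W\<in>N. \<forall>x\<in>N. x \<in> elts W \<longleftrightarrow> x \<in> elts Y \<and> x \<in> elts Z"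
        by (rule rev_bexI) (simp add: sm)
    qed (use YZ in \<open>auto intro!: definable_basic\<close>)
    then obtain W where W: "W \<in> X" "\<forall>x\<in>N. x \<in> elts W \<longleftrightarrow> x \<in> elts Y \<and> x \<in> elts Z" by blast
    then have sub: "elts W \<subseteq> elts Y \<inter> elts Z" using trans[OF XN[OF W(1)]] by blast
    moreover have "x0 \<in> elts W" using W U2 mem_U[of Y] mem_U[of Z] UP YZ x0N by blast
    ultimately have "W \<in> elts U" using mem_U[OF W(1)] UP U2 by blast
    then show "\<exists>W\<in>elts U. elts W \<subseteq> elts Y \<and> elts W \<subseteq> elts Z" using sub by blast
  next
    assume "Y \<in> elts U \<and> elts Y \<subseteq> elts Z \<and> (\<forall>x\<in>elts Z. x \<in> Pkappa \<kappa> A)"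
    then show "Z \<in> elts U" using mem_U UP YZ by blast
  next
    assume "(\<forall>x\<in>elts Y. x \<in> Pkappa \<kappa> A) \<and> (\<forall>x\<in>elts Z. x \<in> Pkappa \<kappa> A) \<and>
      (\<forall>x\<in>N. x \<in> Pkappa \<kappa> A \<longrightarrow> x \<in> elts Y \<or> x \<in> elts Z)"
    then show "Y \<in> elts U \<or> Z \<in> elts U" using mem_U YZ x0N x0P by blast
  next
    assume "Y \<in> elts A \<and> (\<forall>x\<in>N. x \<in> elts Z \<longleftrightarrow> x \<in> Pkappa \<kappa> A \<and> Y \<in> elts x)"
    then show "Z \<in> elts U" using PN[of Z "\<lambda>x. Y \<in> elts x"] YZ by (simp add: x0)
  next
    assume *: "\<forall>x\<in>N. x \<in> elts Z \<longleftrightarrow> x \<in> Pkappa \<kappa> A \<and>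
      (\<forall>\<beta>\<in>elts x. \<beta> \<in> elts \<kappa> \<longrightarrow> elts \<beta> \<subseteq> elts x)"
    have "elts \<beta> \<subseteq> elts x0" if "\<beta> \<in> elts x0" "\<beta> \<in> elts \<kappa>" for \<beta>
      using that X_tr[of \<beta>] Ord_subset[OF Card_Ord[OF \<kappa>(1)], of \<beta>] \<kappa>(2) by (auto simp: x0)
    then show "Z \<in> elts U"
      using PN[OF *] YZ by simp
  next
    assume *: "Z \<in> elts U \<and> (\<forall>x\<in>elts Z. \<exists>a\<in>elts x. kpair x a \<in> elts Y)"
    then have "x0 \<in> elts Z" using mem_U UP YZ by blast
    then obtain a where a: "a \<in> X" "a \<in> elts A" "kpair x0 a \<in> elts Y" using * x0 by blast
    \<comment> \<open>The value \<open>a\<close> lies in \<open>x0\<close>, hence in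
      \<open>X\<close>, and may serve as a parameter. The set on which \<open>a\<close> is a value
      contains \<open>x0\<close>, so it belongs to \<open>U\<close>.\<close>
    have "\<exists>W\<in>X. \<forall>x\<in>N. x \<in> elts W \<longleftrightarrow> x \<in> elts Z \<and> kpair x a \<in> elts Y"
    proof (rule elem_substruct_bex[OF X, of "\<lambda>W Y Z a _. \<forall>x\<in>N. x \<in> elts W \<longleftrightarrow> x \<in> elts Z \<and> kpair x a \<in> elts Y" Y Z a a])
      let ?W = "{x \<in> elts Z. kpair x a \<in> elts Y}"
      have sm: "small ?W" by (rule small_subset[OF small_elts[of Z]]) auto
      then have "mkset ?W \<in> N"
        by (intro subset_closed[OF XN[OF YZ(2)]]) auto
      then show "\<exists>W\<in>N. \<forall>x\<in>N. x \<in> elts W \<longleftrightarrow> x \<in> elts Z \<and> kpair x a \<in> elts Y"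
        by (rule rev_bexI) (simp add: sm)
    qed (use YZ a in \<open>auto intro!: definable_basic definable_kpair_mem\<close>)
    then obtain W where W: "W \<in> X" "\<forall>x\<in>N. x \<in> elts W \<longleftrightarrow> x \<in> elts Z \<and> kpair x a \<in> elts Y" by blast
    then have sub: "\<forall>x\<in>elts W. x \<in> elts Z \<and> kpair x a \<in> elts Y" using trans[OF XN[OF W(1)]] by blast
    moreover have "x0 \<in> elts W" using W a x0N \<open>x0 \<in> elts Z\<close> by blast
    ultimately have "W \<in> elts U" using mem_U[OF W(1)] UP * by blast
    then show "\<exists>a\<in>elts A. \<exists>W\<in>elts U. \<forall>x\<in>elts W. kpair x a \<in> elts Y" using sub a by blast
  qed
  then have "\<forall>Y\<in>N. \<forall>Z\<in>N. nm_clause N Y Z \<kappa> A U"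
    by (intro elem_substruct_ball2[OF X, of "nm_clause N"] definable_nm_clause) (use inX UX in auto)
  then show ?thesis using UN unfolding nm_code_def by blast
qed

end

subsection \<open>Small embeddings\<close>

text \<open>Foundation gives a minimal moved ordinal and linearity makes it the least one, so the
  description in \<open>crit\<close> is proper.\<close>

lemma crit_moved:
  assumes "nontrivial M j"
  shows "moved M j (crit M j)" "moved M j \<beta> \<Longrightarrow> elts (crit M j) \<subseteq> elts \<beta>"
proof -
  obtain \<alpha> where \<alpha>: "moved M j \<alpha>" and min: "\<forall>\<beta>\<in>elts \<alpha>. \<not> moved M j \<beta>"
    using mem_minimal[of "moved M j"] assms by (auto simp: nontrivial_def)
  have le: "elts \<alpha> \<subseteq> elts \<beta>" if "moved M j \<beta>" for \<beta>
    using that \<alpha> min Ord_not_mem_iff[of \<beta> \<alpha>] by (auto simp: moved_def)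
  have "crit M j = \<alpha>"
    unfolding crit_def
  proof (rule the_equality)
    fix \<gamma> assume "moved M j \<gamma> \<and> (\<forall>\<beta>. moved M j \<beta> \<longrightarrow> elts \<gamma> \<subseteq> elts \<beta>)"
    then show "\<gamma> = \<alpha>" using \<alpha> le[of \<gamma>] by (intro extensionality equalityI) auto
  qed (use \<alpha> le in auto)
  then show "moved M j (crit M j)" "moved M j \<beta> \<Longrightarrow> elts (crit M j) \<subseteq> elts \<beta>"
    using \<alpha> le by auto
qed

lemma elementary_embedding_mem:
  assumes "elementary_embedding M N j" "u \<in> M" "v \<in> M"
  shows "u \<in> elts v \<longleftrightarrow> j u \<in> elts (j v)"
proof -
  let ?e = "\<lambda>n::nat. if n = 0 then u else v"
  have "range ?e \<subseteq> M" using assms by auto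
  then have "sat M (Mem 0 1) ?e \<longleftrightarrow> sat N (Mem 0 1) (j \<circ> ?e)"
    using assms(1) unfolding elementary_embedding_def by blast
  then show ?thesis by simp
qed

lemma elementary_embedding_eq:
  assumes "elementary_embedding M N j" "u \<in> M" "v \<in> M"
  shows "j u = j v \<longleftrightarrow> u = v"
proof -
  let ?e = "\<lambda>n::nat. if n = 0 then u else v"
  have "range ?e \<subseteq> M" using assms by auto
  then have "sat M (Equal 0 1) ?e \<longleftrightarrow> sat N (Equal 0 1) (j \<circ> ?e)"
    using assms(1) unfolding elementary_embedding_def by blast
  then show ?thesis by simp
qed

text \<open>In the third claim \<delta> is the critical point: \<open>j\<close> fixes every smaller
  ordinal, and a range element below \<kappa> = j(\<delta>) is the image of an element of
  \<delta>.\<close>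

lemma small_embedding_range:
  assumes E: "small_embedding \<kappa> \<theta> M j"
  shows "elem_substruct (emb_range M j) (Hset \<theta>)" "\<kappa> \<in> emb_range M j"
    and "\<exists>\<delta>\<in>elts \<kappa>. emb_range M j \<inter> elts \<kappa> = elts \<delta>"
proof -
  define \<delta> where "\<delta> = crit (elts M) j"
  have ee: "elementary_embedding (elts M) (Hset \<theta>) j" and nt: "nontrivial (elts M) j"
    and j\<delta>: "j \<delta> = \<kappa>" and \<kappa>: "Ord \<kappa>" and M: "Transset M"
    using E by (auto simp: small_embedding_def \<delta>_def Card_def)
  show "elem_substruct (emb_range M j) (Hset \<theta>)"
    unfolding emb_range_def using ee by (rule elem_substruct_range)
  have \<delta>: "\<delta> \<in> elts M" "Ord \<delta>" "\<delta> \<in> elts \<kappa>"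
    using crit_moved(1)[OF nt] j\<delta> by (auto simp: moved_def \<delta>_def)
  show "\<kappa> \<in> emb_range M j" using \<delta> j\<delta> by (auto simp: emb_range_def)
  have \<delta>M: "elts \<delta> \<subseteq> elts M" using M \<delta> by (auto simp: Transset_def)
  note mem = elementary_embedding_mem[OF ee] and inj = elementary_embedding_eq[OF ee]
  have fix_j: "j \<beta> = \<beta>" if "\<beta> \<in> elts \<delta>" for \<beta>
    using that
  proof (induction \<beta> rule: elts_induct)
    case (step \<beta>)
    have \<beta>: "\<beta> \<in> elts M" "Ord \<beta>" using step.prems \<delta>M \<delta> Ord_elt by blast+
    have "j \<beta> \<in> elts \<kappa>" using mem[OF \<beta>(1) \<delta>(1)] step.prems j\<delta> by simp
    then have "Ord (j \<beta>)" using \<kappa> Ord_elt by blast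
    moreover have "\<beta> \<notin> elts (j \<beta>)"
    proof
      assume "\<beta> \<in> elts (j \<beta>)"
      then have "elts \<delta> \<subseteq> elts \<beta>"
        unfolding \<delta>_def using \<beta> by (intro crit_moved(2)[OF nt]) (simp add: moved_def)
      then show False using step.prems mem_not_refl[of \<beta>] by blast
    qed
    \<comment> \<open>\<open>moved\<close> speaks only of ordinals sent upwards, so a downward move
      is excluded separately: \<open>j \<beta>\<close> would be fixed by induction, contradicting
      injectivity.\<close>
    moreover have "j \<beta> \<notin> elts \<beta>"
    proof
      assume *: "j \<beta> \<in> elts \<beta>"
      then have "j \<beta> \<in> elts \<delta>" using Ord_trans[OF \<delta>(2) step.prems] by blast
      then have "j (j \<beta>) = j \<beta>" using step.IH * by blast
      then have "j \<beta> = \<beta>" using inj[of "j \<beta>" \<beta>] \<open>j \<beta> \<in> elts \<delta>\<close> \<delta>M \<beta> by blast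
      then show False using * by simp
    qed
    ultimately show ?case using Ord_linear[OF \<beta>(2), of "j \<beta>"] by metis
  qed
  have "emb_range M j \<inter> elts \<kappa> = elts \<delta>"
  proof (intro equalityI subsetI)
    fix \<zeta> assume \<zeta>: "\<zeta> \<in> emb_range M j \<inter> elts \<kappa>"
    then obtain \<eta> where "\<eta> \<in> elts M" "\<zeta> = j \<eta>" by (auto simp: emb_range_def)
    then have "\<eta> \<in> elts \<delta>" using mem[of \<eta> \<delta>] \<delta> j\<delta> \<zeta> by auto
    then show "\<zeta> \<in> elts \<delta>" using fix_j \<open>\<zeta> = j \<eta>\<close> by simp
  next
    fix \<zeta> assume "\<zeta> \<in> elts \<delta>"
    then show "\<zeta> \<in> emb_range M j \<inter> elts \<kappa>"
      using fix_j \<delta>M Ord_trans[OF \<kappa> \<delta>(3)] by (auto simp: emb_range_def intro!: image_eqI[of _ _ \<zeta>])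
  qed
  then show "\<exists>\<delta>\<in>elts \<kappa>. emb_range M j \<inter> elts \<kappa> = elts \<delta>" using \<delta> by blast
qed

text \<open>The critical point is a limit ordinal below \<open>\<kappa>\<close>, because \<open>0\<close> and successors are definable.\<close>

lemma small_embedding_uncountable:
  assumes E: "small_embedding \<kappa> \<theta> M j"
  shows "uncountable (elts \<kappa>)"
proof
  assume count: "countable (elts \<kappa>)"
  define X where "X = emb_range M j"
  interpret trans_class "Hset \<theta>" by unfold_locales (rule Hset_trans)
  obtain \<delta> where \<delta>: "\<delta> \<in> elts \<kappa>" "X \<inter> elts \<kappa> = elts \<delta>" and X: "elem_substruct X (Hset \<theta>)"
    using small_embedding_range[OF E] by (auto simp: X_def)
  have \<kappa>: "Card \<kappa>" "Ord \<kappa>" "Card \<theta>" "\<kappa> \<in> elts \<theta>"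
    using E by (auto simp: small_embedding_def Card_Ord)
  then have \<kappa>N: "x \<in> Hset \<theta>" if "x \<in> elts \<kappa>" for x
    using Hset_Card_elt[of \<theta> \<kappa>] Hset_trans that by blast
  have XN: "x \<in> X \<Longrightarrow> x \<in> Hset \<theta>" for x using X by (auto simp: elem_substruct_def)
  have \<delta>O: "Ord \<delta>" using Ord_elt[OF \<kappa>(2) \<delta>(1)] .
  have "numeral_set n \<in> elts \<delta>" for n
  proof (induction n)
    case 0
    let ?z = "mkset {} :: 'a"
    have "Ord ?z" by (auto simp: Ord_def Transset_def)
    then have z\<kappa>: "?z \<in> elts \<kappa>" using Ord_linear[OF _ \<kappa>(2), of ?z] \<delta>(1) by auto
    obtain x where "x \<in> X" using small_embedding_range(2)[OF E] X_def by blast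
    moreover have "\<exists>z\<in>Hset \<theta>. \<forall>u\<in>Hset \<theta>. u \<notin> elts z"
      by (rule bexI[OF _ \<kappa>N[OF z\<kappa>]]) simp
    ultimately have "\<exists>z\<in>X. \<forall>u\<in>Hset \<theta>. u \<notin> elts z"
      by (intro elem_substruct_bex[OF X, of "\<lambda>z _ _ _ _. \<forall>u\<in>Hset \<theta>. u \<notin> elts z" x x x x] definable_basic) auto
    then obtain z where "z \<in> X" "\<forall>u\<in>Hset \<theta>. u \<notin> elts z" by blast
    moreover then have "elts z = {}" using trans[OF XN] by blast
    ultimately have "?z \<in> X" using mkset_elts[of z] by simp
    then show ?case using z\<kappa> \<delta>(2) by auto
  next
    case (Suc n)
    define \<beta> :: 'a where "\<beta> = numeral_set n"
    define s where "s = mkset (insert \<beta> (elts \<beta>))"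
    have s: "elts s = insert \<beta> (elts \<beta>)" by (simp add: s_def small_insert)
    have \<beta>: "\<beta> \<in> elts \<delta>" "\<beta> \<in> X" "\<beta> \<in> elts \<kappa>" using Suc \<delta>(2) by (auto simp: \<beta>_def)
    then have \<beta>O: "Ord \<beta>" using Ord_elt \<delta>O by blast
    have "Ord s"
    proof (rule OrdI)
      show "Transset s" unfolding Transset_def s using Ord_subset[OF \<beta>O] by blast
      show "Ord \<gamma>" if "\<gamma> \<in> elts s" for \<gamma> using that \<beta>O Ord_elt[OF \<beta>O] by (auto simp: s)
    qed
    moreover have "\<delta> \<notin> elts s" using \<beta>(1) mem_not_sym by (auto simp: s)
    ultimately have s\<kappa>: "s \<in> elts \<kappa>" using Ord_not_mem_iff[of s \<kappa>] \<kappa>(2) \<delta>(1) by blast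
    have "\<exists>t\<in>Hset \<theta>. \<forall>u\<in>Hset \<theta>. u \<in> elts t \<longleftrightarrow> u = \<beta> \<or> u \<in> elts \<beta>"
      by (rule bexI[OF _ \<kappa>N[OF s\<kappa>]]) (simp add: s)
    then have "\<exists>t\<in>X. \<forall>u\<in>Hset \<theta>. u \<in> elts t \<longleftrightarrow> u = \<beta> \<or> u \<in> elts \<beta>"
      using \<beta>
      by (intro elem_substruct_bex[OF X, of "\<lambda>t \<beta> _ _ _. \<forall>u\<in>Hset \<theta>. u \<in> elts t \<longleftrightarrow> u = \<beta> \<or> u \<in> elts \<beta>" \<beta> \<beta> \<beta> \<beta>] definable_basic) auto
    then obtain t where t: "t \<in> X" "\<forall>u\<in>Hset \<theta>. u \<in> elts t \<longleftrightarrow> u = \<beta> \<or> u \<in> elts \<beta>" by blast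
    have "elts t \<subseteq> Hset \<theta>" using trans[OF XN[OF t(1)]] by blast
    moreover have "insert \<beta> (elts \<beta>) \<subseteq> Hset \<theta>" using XN[OF \<beta>(2)] trans[OF XN[OF \<beta>(2)]] by blast
    ultimately have "elts t = elts s" using t(2) unfolding s by auto
    then have "s \<in> X" using t(1) extensionality by metis
    then show ?case using s\<kappa> \<delta>(2) by (auto simp: s_def \<beta>_def)
  qed
  \<comment> \<open>Now \<delta> < \<kappa> contains all numerals, so a countable \<kappa> would
    inject into a smaller ordinal.\<close>
  then have "infinite (elts \<delta>)"
    using inj_numeral_set by (meson image_subsetI infinite_iff_countable_subset)
  then have "(UNIV :: nat set) \<lesssim> elts \<delta>" by (simp add: infinite_le_lepoll)
  moreover have "elts \<kappa> \<lesssim> (UNIV :: nat set)"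
    using count by (auto simp: countable_def lepoll_def)
  ultimately show False using Card_not_lepoll_elt[OF \<kappa>(1) \<delta>(1)] lepoll_trans by blast
qed

text \<open>The set \<open>y\<close> of \<open>nm_code_of_list\<close> is j(p) for the list preimage
  \<open>p\<close>: as \<open>p\<close> belongs to \<open>M\<close>, its image belongs to the range
  and agrees there with the list value.\<close>

lemma small_embedding_nm_code:
  assumes E: "small_embedding \<kappa> \<theta> M j" and M: "elts M \<prec> elts \<kappa>" and N: "pow_class (Hset \<theta>)"
    and sub: "elts \<kappa> \<subseteq> elts A" "elts A \<subseteq> elts lam"
    and inX: "lam \<in> emb_range M j" "A \<in> emb_range M j" "d \<in> emb_range M j"
    and L: "is_list (Pkappa \<kappa> lam) d" and codes: "codes_all (Hset \<theta>) \<kappa> lam A d"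
    and pre: "list_preimage M j lam d \<in> elts M"
  shows "\<exists>U\<in>Hset \<theta>. nm_code (Hset \<theta>) \<kappa> A U"
proof -
  interpret pow_class "Hset \<theta>" by (rule N)
  define b where "b = app d (mkset (emb_range M j \<inter> elts lam))"
  have ee: "elementary_embedding (elts M) (Hset \<theta>) j" and \<kappa>: "Card \<kappa>"
    using E by (auto simp: small_embedding_def)
  define p where "p = list_preimage M j lam d"
  have p: "elts p = {x \<in> elts M. j x \<in> elts b}"
    unfolding p_def list_preimage_def b_def by (rule elts_mkset, rule small_subset[OF small_elts]) auto
  have pM: "p \<in> elts M" using pre by (simp add: p_def)
  have "j x \<in> elts (j p) \<longleftrightarrow> j x \<in> elts b" if "x \<in> elts M" for x
    using elementary_embedding_mem[OF ee that pM] that by (simp add: p)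
  then have y: "elts (j p) \<inter> emb_range M j = elts b \<inter> emb_range M j"
    by (auto simp: emb_range_def)
  obtain \<delta> where \<delta>: "\<delta> \<in> elts \<kappa>" "emb_range M j \<inter> elts \<kappa> = elts \<delta>"
    using small_embedding_range(3)[OF E] by blast
  have "Ord \<delta>" using Ord_elt Card_Ord \<kappa> \<delta> by blast
  then have "elts \<beta> \<subseteq> emb_range M j" if "\<beta> \<in> emb_range M j" "\<beta> \<in> elts \<kappa>" for \<beta>
    using that \<delta> Ord_subset[of \<delta> \<beta>] by blast
  moreover have "emb_range M j \<prec> elts \<kappa>"
    unfolding emb_range_def using M image_lepoll lesspoll_trans1 by blast
  moreover have "j p \<in> emb_range M j" using pM by (simp add: emb_range_def)
  ultimately show ?thesis
    using nm_code_of_list[OF small_embedding_range(1)[OF E] _ _ \<kappa> sub small_embedding_range(2)[OF E]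
        inX _ L codes y[unfolded b_def]] by blast
qed

subsection \<open>Transfer of normal measures along bijections\<close>

lemma normal_measureD:
  assumes "normal_measure \<kappa> A U"
  shows "U \<subseteq> Pow (Pkappa \<kappa> A)" "Pkappa \<kappa> A \<in> U" "{} \<notin> U"
    and "\<lbrakk>X \<in> U; X \<subseteq> Y; Y \<subseteq> Pkappa \<kappa> A\<rbrakk> \<Longrightarrow> Y \<in> U"
    and "X \<subseteq> Pkappa \<kappa> A \<Longrightarrow> X \<in> U \<or> Pkappa \<kappa> A - X \<in> U"
    and "\<lbrakk>F \<subseteq> U; F \<noteq> {}; F \<prec> elts \<kappa>\<rbrakk> \<Longrightarrow> \<Inter>F \<in> U"
    and "a \<in> elts A \<Longrightarrow> {x \<in> Pkappa \<kappa> A. a \<in> elts x} \<in> U"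
    and "{x \<in> Pkappa \<kappa> A. f x \<in> elts x} \<in> U \<Longrightarrow> \<exists>a\<in>elts A. {x \<in> Pkappa \<kappa> A. f x = a} \<in> U"
proof -
  note c = assms[unfolded normal_measure_def]
  show "U \<subseteq> Pow (Pkappa \<kappa> A)" by (rule c[THEN conjunct1])
  show "Pkappa \<kappa> A \<in> U" by (rule c[THEN conjunct2, THEN conjunct1])
  show "{} \<notin> U" by (rule c[THEN conjunct2, THEN conjunct2, THEN conjunct1])
  show "\<lbrakk>X \<in> U; X \<subseteq> Y; Y \<subseteq> Pkappa \<kappa> A\<rbrakk> \<Longrightarrow> Y \<in> U"
    using c[THEN conjunct2, THEN conjunct2, THEN conjunct2, THEN conjunct1] by blast
  show "X \<subseteq> Pkappa \<kappa> A \<Longrightarrow> X \<in> U \<or> Pkappa \<kappa> A - X \<in> U"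
    using c[THEN conjunct2, THEN conjunct2, THEN conjunct2, THEN conjunct2, THEN conjunct1] by blast
  show "\<lbrakk>F \<subseteq> U; F \<noteq> {}; F \<prec> elts \<kappa>\<rbrakk> \<Longrightarrow> \<Inter>F \<in> U"
    using c[THEN conjunct2, THEN conjunct2, THEN conjunct2, THEN conjunct2, THEN conjunct2,
        THEN conjunct1] by blast
  show "a \<in> elts A \<Longrightarrow> {x \<in> Pkappa \<kappa> A. a \<in> elts x} \<in> U"
    using c[THEN conjunct2, THEN conjunct2, THEN conjunct2, THEN conjunct2, THEN conjunct2,
        THEN conjunct2, THEN conjunct1] by blast
  show "{x \<in> Pkappa \<kappa> A. f x \<in> elts x} \<in> U \<Longrightarrow> \<exists>a\<in>elts A. {x \<in> Pkappa \<kappa> A. f x = a} \<in> U"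
    using c[THEN conjunct2, THEN conjunct2, THEN conjunct2, THEN conjunct2, THEN conjunct2,
        THEN conjunct2, THEN conjunct2] by blast
qed

text \<open>Supercompactness asks for measures over arbitrary sets, whereas the embedding conditions
  speak of cardinals. A bijection of the underlying sets induces a bijection \<open>T\<close> of
  their P_kappa, along which the measure is pulled back.\<close>

lemma normal_measure_transfer:
  fixes \<kappa> A B :: "'v::zfc_universe"
  assumes U: "normal_measure \<kappa> B U" and AB: "elts A \<approx> elts B"
  shows "\<exists>V. normal_measure \<kappa> A V"
proof -
  obtain h where h: "bij_betw h (elts A) (elts B)" using AB by (auto simp: eqpoll_def)
  \<comment> \<open>A function tested for normality may take values outside \<open>A\<close>.
    Sending these to \<open>B\<close>, which is not an element of itself, keeps them outside every
    \<open>T x\<close>.\<close>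
  define g where "g u = (if u \<in> elts A then h u else B)" for u
  have g_bij: "bij_betw g (elts A) (elts B)"
    using h by (rule bij_betw_cong[THEN iffD1, rotated]) (simp add: g_def)
  have g_out: "g u = B" if "u \<notin> elts A" for u using that by (simp add: g_def)
  have inj: "inj_on g (elts A)" and img: "g ` elts A = elts B" using g_bij by (auto simp: bij_betw_def)
  define P where "P = Pkappa \<kappa> A"
  define Q where "Q = Pkappa \<kappa> B"
  define T where "T x = mkset (g ` elts x)" for x
  have T: "elts (T x) = g ` elts x" for x by (simp add: T_def small_image)
  have PA: "elts x \<subseteq> elts A" if "x \<in> P" for x using that by (simp add: P_def Pkappa_def)
  have T_mem: "g u \<in> elts (T x) \<longleftrightarrow> u \<in> elts x" if "x \<in> P" for u x
  proof (cases "u \<in> elts A")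
    case True
    then show ?thesis using inj_on_image_mem_iff[OF inj True PA[OF that]] by (simp add: T)
  next
    case False
    moreover have "B \<notin> elts (T x)"
    proof
      assume "B \<in> elts (T x)"
      then have "B \<in> g ` elts A" unfolding T using PA[OF that] by blast
      then show False by (simp only: img mem_not_refl)
    qed
    ultimately show ?thesis using PA[OF that] g_out by auto
  qed
  have T_inj: "inj_on T P"
  proof (rule inj_onI)
    fix x y assume xy: "x \<in> P" "y \<in> P" "T x = T y"
    then have "elts x = elts y" using T_mem by (metis subset_antisym subsetI)
    then show "x = y" by (rule extensionality)
  qed
  have T_img: "T ` P = Q"
  proof (intro equalityI subsetI)
    fix y assume "y \<in> T ` P"
    then obtain x where x: "x \<in> P" "y = T x" by blast
    then have "g ` elts x \<subseteq> elts B" using PA img by blast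
    moreover have "g ` elts x \<prec> elts \<kappa>"
      using x lesspoll_trans1[OF image_lepoll[of g "elts x"]] by (auto simp: P_def Pkappa_def)
    ultimately show "y \<in> Q" using x by (simp add: Q_def Pkappa_def T)
  next
    fix y assume y: "y \<in> Q"
    define S where "S = {u \<in> elts A. g u \<in> elts y}"
    have S: "small S" unfolding S_def by (rule small_subset[OF small_elts]) auto
    have gS: "g ` S = elts y" using y img by (auto simp: S_def Q_def Pkappa_def)
    have "inj_on g S" using inj by (rule inj_on_subset) (auto simp: S_def)
    then have "S \<approx> elts y" using gS inj_on_image_eqpoll_self eqpoll_sym by metis
    then have "S \<prec> elts \<kappa>" using y eq_lesspoll_trans[of S "elts y"] by (auto simp: Q_def Pkappa_def)
    then have "mkset S \<in> P" using S by (auto simp: P_def Pkappa_def S_def)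
    moreover have "T (mkset S) = y" by (rule extensionality) (simp add: T S gS)
    ultimately show "y \<in> T ` P" by blast
  qed
  note u = normal_measureD[OF U, folded Q_def]
  define V where "V = {S. S \<subseteq> P \<and> T ` S \<in> U}"
  have T_Collect: "T ` {x \<in> P. R (T x)} = {y \<in> Q. R y}" for R using T_img by auto
  have "normal_measure \<kappa> A V"
    unfolding normal_measure_def P_def[symmetric]
  proof (intro conjI allI impI ballI)
    show "V \<subseteq> Pow P" "P \<in> V" "{} \<notin> V" using u(2,3) T_img by (auto simp: V_def)
  next
    fix X Y assume XY: "X \<in> V \<and> X \<subseteq> Y \<and> Y \<subseteq> P"
    then have "T ` X \<in> U" by (simp add: V_def)
    moreover have "T ` X \<subseteq> T ` Y" using XY by blast
    moreover have "T ` Y \<subseteq> Q" using XY T_img by blast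
    ultimately have "T ` Y \<in> U" by (rule u(4))
    then show "Y \<in> V" using XY by (simp add: V_def)
  next
    fix X assume "X \<subseteq> P"
    moreover from this have "T ` (P - X) = Q - T ` X"
      using inj_on_image_set_diff[OF T_inj, of P X] T_img by auto
    moreover have "T ` X \<subseteq> Q" using calculation(1) T_img by blast
    ultimately show "X \<in> V \<or> P - X \<in> V" using u(5)[of "T ` X"] by (auto simp: V_def)
  next
    fix F assume F: "F \<subseteq> V \<and> F \<noteq> {} \<and> F \<prec> elts \<kappa>"
    have "(`) T ` F \<subseteq> U" "(`) T ` F \<noteq> {}" "(`) T ` F \<prec> elts \<kappa>"
      using F lesspoll_trans1[OF image_lepoll[of "(`) T" F]] by (auto simp: V_def)
    then have "\<Inter>((`) T ` F) \<in> U" by (rule u(6))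
    moreover have "T ` \<Inter>F = \<Inter>((`) T ` F)"
    proof -
      obtain X where "X \<in> F" using F by blast
      then show ?thesis
        using image_INT[OF T_inj, of F "\<lambda>X. X" X] F by (auto simp: V_def)
    qed
    moreover have "\<Inter>F \<subseteq> P" using F by (auto simp: V_def)
    ultimately show "\<Inter>F \<in> V" by (simp add: V_def)
  next
    fix a assume a: "a \<in> elts A"
    have "{x \<in> P. a \<in> elts x} = {x \<in> P. g a \<in> elts (T x)}" using T_mem by blast
    then have "T ` {x \<in> P. a \<in> elts x} = {y \<in> Q. g a \<in> elts y}" using T_Collect by simp
    moreover have "\<dots> \<in> U" by (rule u(7)) (use a img in blast)
    ultimately show "{x \<in> P. a \<in> elts x} \<in> V" by (simp add: V_def)
  next
    fix f assume f: "{x \<in> P. f x \<in> elts x} \<in> V"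
    define f' where "f' y = g (f (inv_into P T y))" for y
    have f': "f' (T x) = g (f x)" if "x \<in> P" for x
      using that T_inj by (simp add: f'_def inv_into_f_f)
    have "{x \<in> P. f x \<in> elts x} = {x \<in> P. f' (T x) \<in> elts (T x)}" using T_mem f' by auto
    then have "{y \<in> Q. f' y \<in> elts y} \<in> U" using f T_Collect[of "\<lambda>y. f' y \<in> elts y"] by (simp add: V_def)
    then obtain b where b: "b \<in> elts B" "{y \<in> Q. f' y = b} \<in> U" using u(8) by blast
    obtain a where a: "a \<in> elts A" "b = g a" using b img by blast
    have ga: "g v = g a \<longleftrightarrow> v = a" for v
    proof (cases "v \<in> elts A")
      case True
      then show ?thesis using inj a by (auto simp: inj_on_def)
    next
      case False
      then show ?thesis using g_out[of v] a b mem_not_refl[of B] by auto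
    qed
    have "{x \<in> P. f x = a} = {x \<in> P. f' (T x) = b}" using f' ga a by auto
    then have "T ` {x \<in> P. f x = a} \<in> U" using b(2) T_Collect[of "\<lambda>y. f' y = b"] by simp
    then show "\<exists>a\<in>elts A. {x \<in> P. f x = a} \<in> V" using a by (auto simp: V_def)
  qed
  then show ?thesis by blast
qed

lemma supercompactI:
  fixes \<kappa> :: "'v::zfc_universe"
  assumes \<kappa>: "Card \<kappa>" "uncountable (elts \<kappa>)"
    and nm: "\<And>lam. \<lbrakk>Card lam; elts \<kappa> \<subseteq> elts lam\<rbrakk> \<Longrightarrow> \<exists>U. normal_measure \<kappa> lam U"
  shows "supercompact \<kappa>"
  unfolding supercompact_def
proof (intro conjI \<kappa> allI impI)
  fix A :: 'v assume "elts \<kappa> \<lesssim> elts A"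
  then have "elts \<kappa> \<lesssim> elts (cardof A)" using cardof(2)[of A] eqpoll_sym lepoll_trans2 by blast
  then have "elts \<kappa> \<subseteq> elts (cardof A)"
    using lepoll_Card_subset \<kappa>(1) cardof(1)[of A] Card_Ord by blast
  then obtain U where "normal_measure \<kappa> (cardof A) U" using nm cardof(1) by blast
  then show "\<exists>U. normal_measure \<kappa> A U"
    using normal_measure_transfer cardof(2)[of A] eqpoll_sym by blast
qed

subsection \<open>Collapsing elementary substructures\<close>

text \<open>Transitivity of \<open>X \<inter> \<kappa>\<close> makes the collapse the identity below
  \<kappa>, so \<kappa> collapses to \<delta> = \<open>X \<inter> \<kappa>\<close>, the critical
  point. An element \<open>y\<close> of \<open>X\<close> with the trace of the list value collapses
  to exactly the list preimage.\<close>

lemma small_embedding_of_elem: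
  fixes \<kappa> \<theta> :: "'v::zfc_universe"
  assumes \<kappa>: "Card \<kappa>" and \<theta>: "Card \<theta>" "\<kappa> \<in> elts \<theta>" and X: "elem_substruct X (Hset \<theta>)" and \<kappa>X: "\<kappa> \<in> X"
    and X\<kappa>: "X \<prec> elts \<kappa>" and tr: "\<And>\<beta>. \<lbrakk>\<beta> \<in> X; \<beta> \<in> elts \<kappa>\<rbrakk> \<Longrightarrow> elts \<beta> \<subseteq> X"
  obtains M j where "small_embedding \<kappa> \<theta> M j" "elts M \<prec> elts \<kappa>" "emb_range M j = X"
    "\<And>lam d y. \<lbrakk>y \<in> X; elts y \<inter> X = elts (app d (mkset (X \<inter> elts lam))) \<inter> X\<rbrakk> \<Longrightarrow>
      list_preimage M j lam d \<in> elts M"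
proof -
  interpret trans_class "Hset \<theta>" by unfold_locales (rule Hset_trans)
  have O\<kappa>: "Ord \<kappa>" using \<kappa> by (rule Card_Ord)
  have smX: "small X" using small_lepoll[OF lesspoll_imp_lepoll[OF X\<kappa>] small_elts] .
  define R where "R = {(v, u). v \<in> elts u \<and> v \<in> X \<and> u \<in> X}"
  define \<pi> where "\<pi> = collapse R"
  have wf: "wf R" by (rule wf_subset[OF foundation]) (auto simp: R_def)
  have sm: "small {v. (v, u) \<in> R}" for u
    by (rule small_subset[OF small_elts[of u]]) (auto simp: R_def)
  have \<pi>: "elts (\<pi> u) = \<pi> ` (elts u \<inter> X)" if "u \<in> X" for u
  proof -
    have "{v. (v, u) \<in> R} = elts u \<inter> X" using that by (auto simp: R_def)
    then show ?thesis using elts_collapse[OF wf sm, of u] by (simp add: \<pi>_def)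
  qed
  have "u = v" if "u \<in> X" "v \<in> X" "\<pi> u = \<pi> v" for u v
    using that
  proof (induction u arbitrary: v rule: elts_induct)
    case (step u)
    have eq: "\<pi> ` (elts u \<inter> X) = \<pi> ` (elts v \<inter> X)"
      using \<pi>[OF step.prems(1)] \<pi>[OF step.prems(2)] step.prems(3) by simp
    have "elts u \<inter> X = elts v \<inter> X"
    proof (intro equalityI subsetI)
      fix w assume w: "w \<in> elts u \<inter> X"
      then obtain w' where "w' \<in> elts v \<inter> X" "\<pi> w = \<pi> w'" using eq by (metis imageE imageI)
      then show "w \<in> elts v \<inter> X" using step.IH[of w w'] w by auto
    next
      fix w' assume w': "w' \<in> elts v \<inter> X"
      then obtain w where "w \<in> elts u \<inter> X" "\<pi> w' = \<pi> w" using eq by (metis imageE imageI)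
      then show "w' \<in> elts u \<inter> X" using step.IH[of w w'] w' by auto
    qed
    then show ?case by (rule elem_substruct_extensional[OF X step.prems(1,2)])
  qed
  then have inj: "inj_on \<pi> X" by (auto intro: inj_onI)
  define M where "M = mkset (\<pi> ` X)"
  define j where "j = inv_into X \<pi>"
  have M: "elts M = \<pi> ` X" by (simp add: M_def smX small_image)
  have j\<pi>: "j (\<pi> u) = u" if "u \<in> X" for u using that inj by (simp add: j_def)
  have \<pi>_mem: "\<pi> u \<in> elts (\<pi> v) \<longleftrightarrow> u \<in> elts v" if "u \<in> X" "v \<in> X" for u v
    using inj_on_image_mem_iff[OF inj, of u "elts v \<inter> X"] \<pi>[of v] that by auto
  have j_img: "j ` elts M = X" using j\<pi> by (force simp: M image_image)
  have jX: "j m \<in> X" "\<pi> (j m) = m" if "m \<in> elts M" for m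
    using that j\<pi> by (auto simp: M)
  have TM: "Transset M" using \<pi> by (auto simp: Transset_def M)
  have sat_iso: "sat (elts M) p e \<longleftrightarrow> sat X p (j \<circ> e)" if "range e \<subseteq> elts M" for p e
    using that
  proof (induction p arbitrary: e)
    case (Mem m n)
    then have "e m \<in> elts M" "e n \<in> elts M" by auto
    then show ?case using \<pi>_mem[of "j (e m)" "j (e n)"] jX by simp
  next
    case (Equal m n)
    then have "e m \<in> elts M" "e n \<in> elts M" by auto
    then show ?case using jX(2) by (metis comp_apply sat.simps(2))
  next
    case (Forall n p)
    have "sat (elts M) p (e(n := m)) \<longleftrightarrow> sat X p ((j \<circ> e)(n := j m))" if "m \<in> elts M" for m
    proof -
      have "sat (elts M) p (e(n := m)) \<longleftrightarrow> sat X p (j \<circ> e(n := m))"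
        by (rule Forall.IH) (use Forall.prems that in auto)
      then show ?thesis by (simp only: fun_upd_comp)
    qed
    then have "(\<forall>m\<in>elts M. sat (elts M) p (e(n := m))) \<longleftrightarrow>
        (\<forall>m\<in>elts M. sat X p ((j \<circ> e)(n := j m)))" by simp
    also have "\<dots> \<longleftrightarrow> (\<forall>x\<in>j ` elts M. sat X p ((j \<circ> e)(n := x)))" by simp
    finally show ?case by (simp only: sat.simps j_img)
  qed auto
  have ee: "elementary_embedding (elts M) (Hset \<theta>) j"
    unfolding elementary_embedding_def
  proof (intro conjI allI impI)
    show "j ` elts M \<subseteq> Hset \<theta>" using X j_img by (simp add: elem_substruct_def)
    fix p and e :: "nat \<Rightarrow> 'v" assume e: "range e \<subseteq> elts M"
    then have "range (j \<circ> e) \<subseteq> X" using jX by auto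
    then show "sat (elts M) p e \<longleftrightarrow> sat (Hset \<theta>) p (j \<circ> e)"
      using sat_iso[OF e] elem_substruct_sat[OF X] by simp
  qed
  have M\<kappa>: "elts M \<prec> elts \<kappa>" unfolding M using X\<kappa> image_lepoll lesspoll_trans1 by blast
  have "elts \<kappa> \<prec> elts \<theta>" using Card_elt_lesspoll \<theta> by blast
  then have MH: "M \<in> Hset \<theta>" using Hset_Transset[OF TM] M\<kappa> lesspoll_trans by blast
  have \<pi>_fix: "\<pi> \<beta> = \<beta>" if "\<beta> \<in> X" "\<beta> \<in> elts \<kappa>" for \<beta>
    using that
  proof (induction \<beta> rule: elts_induct)
    case (step \<beta>)
    have sub: "elts \<beta> \<subseteq> X" "elts \<beta> \<subseteq> elts \<kappa>" using tr step.prems Ord_subset[OF O\<kappa>] by blast+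
    then have "elts (\<pi> \<beta>) = \<pi> ` elts \<beta>" using \<pi>[OF step.prems(1)] by (simp add: inf_absorb1)
    also have "\<dots> = id ` elts \<beta>" by (rule image_cong) (use step.IH sub in auto)
    finally show ?case by (intro extensionality) simp
  qed
  define \<delta> where "\<delta> = \<pi> \<kappa>"
  have "elts \<delta> = \<pi> ` (elts \<kappa> \<inter> X)" unfolding \<delta>_def by (rule \<pi>[OF \<kappa>X])
  also have "\<dots> = id ` (elts \<kappa> \<inter> X)" by (rule image_cong) (use \<pi>_fix in auto)
  finally have \<delta>: "elts \<delta> = elts \<kappa> \<inter> X" by simp
  have "Transset \<delta>" unfolding Transset_def \<delta> using tr Ord_subset[OF O\<kappa>] by blast
  moreover have "\<delta> \<noteq> \<kappa>"
  proof
    assume "\<delta> = \<kappa>"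
    then have "elts \<kappa> \<subseteq> X" using \<delta> by blast
    then show False using X\<kappa> subset_imp_lepoll lesspoll_trans1 lesspoll_not_refl by blast
  qed
  ultimately have \<delta>\<kappa>: "\<delta> \<in> elts \<kappa>" using Transset_subset_Ord[OF O\<kappa>] \<delta> by blast
  have O\<delta>: "Ord \<delta>" using Ord_elt[OF O\<kappa> \<delta>\<kappa>] .
  have \<delta>_moved: "moved (elts M) j \<delta>"
    unfolding moved_def using O\<delta> \<delta>\<kappa> \<kappa>X j\<pi> by (auto simp: M \<delta>_def)
  then have nt: "nontrivial (elts M) j" by (auto simp: nontrivial_def)
  have "elts \<delta> \<subseteq> elts \<beta>" if "moved (elts M) j \<beta>" for \<beta>
  proof (rule ccontr)
    assume "\<not> elts \<delta> \<subseteq> elts \<beta>"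
    then have "\<beta> \<in> elts \<delta>" using that O\<delta> Ord_not_mem_iff by (auto simp: moved_def)
    then have "\<beta> \<in> X" "\<pi> \<beta> = \<beta>" using \<delta> \<pi>_fix by auto
    then have "j \<beta> = \<beta>" using j\<pi> by metis
    then show False using that by (simp add: moved_def)
  qed
  then have "elts (crit (elts M) j) = elts \<delta>"
    using crit_moved[OF nt] \<delta>_moved by blast
  then have "crit (elts M) j = \<delta>" by (rule extensionality)
  then have "j (crit (elts M) j) = \<kappa>" using j\<pi>[OF \<kappa>X] by (simp add: \<delta>_def)
  then have E: "small_embedding \<kappa> \<theta> M j"
    unfolding small_embedding_def using \<kappa> \<theta> MH TM ee nt by blast
  have range: "emb_range M j = X" by (simp add: emb_range_def j_img)
  have "list_preimage M j lam d \<in> elts M"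
    if y: "y \<in> X" "elts y \<inter> X = elts (app d (mkset (X \<inter> elts lam))) \<inter> X" for lam d y
  proof -
    have "{x \<in> elts M. j x \<in> elts (app d (mkset (X \<inter> elts lam)))} = \<pi> ` (elts y \<inter> X)"
      unfolding y(2) using j\<pi> by (auto simp: M)
    then have "list_preimage M j lam d = \<pi> y"
      unfolding list_preimage_def range by (simp add: \<pi>[OF y(1), symmetric])
    then show ?thesis using y(1) by (simp add: M)
  qed
  then show thesis using that E M\<kappa> range by blast
qed

subsection \<open>Normal measures concentrate on elementary substructures\<close>

text \<open>Countably many formulas are fewer than \<kappa>, so \<kappa>-completeness can treat all
  of them at once.\<close>

instance fm :: countable
  by countable_datatype

locale nmeasure =
  fixes \<kappa> A :: "'v::zfc_universe" and U :: "'v set set"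
  assumes Card_\<kappa>: "Card \<kappa>" and uncountable_\<kappa>: "uncountable (elts \<kappa>)"
    and normal_measure: "normal_measure \<kappa> A U"
begin

text \<open>Reading the measure as a quantifier turns completeness into \<open>ae_ball_less\<close>
  and normality into \<open>ae_ball\<close>.\<close>

definition ae :: "('v \<Rightarrow> bool) \<Rightarrow> bool" where
  "ae Q \<longleftrightarrow> {x \<in> Pkappa \<kappa> A. Q x} \<in> U"

lemma ae_mono: "\<lbrakk>ae Q; \<And>x. x \<in> Pkappa \<kappa> A \<Longrightarrow> Q x \<Longrightarrow> Q' x\<rbrakk> \<Longrightarrow> ae Q'"
proof -
  assume Q: "ae Q" and imp: "\<And>x. x \<in> Pkappa \<kappa> A \<Longrightarrow> Q x \<Longrightarrow> Q' x"
  have "{x \<in> Pkappa \<kappa> A. Q x} \<subseteq> {x \<in> Pkappa \<kappa> A. Q' x}" using imp by blast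
  then show "ae Q'"
    using Q normal_measureD(4)[OF normal_measure] unfolding ae_def by blast
qed

lemma ae_all: "(\<And>x. x \<in> Pkappa \<kappa> A \<Longrightarrow> Q x) \<Longrightarrow> ae Q"
proof -
  assume "\<And>x. x \<in> Pkappa \<kappa> A \<Longrightarrow> Q x"
  then have "{x \<in> Pkappa \<kappa> A. Q x} = Pkappa \<kappa> A" by blast
  then show "ae Q" using normal_measureD(2)[OF normal_measure] unfolding ae_def by simp
qed

lemma ae_ex: "ae Q \<Longrightarrow> \<exists>x\<in>Pkappa \<kappa> A. Q x"
proof (rule ccontr)
  assume "ae Q" "\<not> (\<exists>x\<in>Pkappa \<kappa> A. Q x)"
  moreover from this have "{x \<in> Pkappa \<kappa> A. Q x} = {}" by blast
  ultimately show False using normal_measureD(3)[OF normal_measure] unfolding ae_def by simp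
qed

lemma ae_not: "\<not> ae Q \<Longrightarrow> ae (\<lambda>x. \<not> Q x)"
proof -
  assume nQ: "\<not> ae Q"
  have "Pkappa \<kappa> A - {x \<in> Pkappa \<kappa> A. Q x} = {x \<in> Pkappa \<kappa> A. \<not> Q x}" by blast
  moreover have "{x \<in> Pkappa \<kappa> A. Q x} \<subseteq> Pkappa \<kappa> A" by blast
  ultimately show ?thesis
    using nQ normal_measureD(5)[OF normal_measure, of "{x \<in> Pkappa \<kappa> A. Q x}"] unfolding ae_def by simp
qed

lemma ae_mem: "a \<in> elts A \<Longrightarrow> ae (\<lambda>x. a \<in> elts x)"
  unfolding ae_def by (rule normal_measureD(7)[OF normal_measure])

lemma ae_ball_less:
  assumes I: "I \<prec> elts \<kappa>" and Q: "\<And>i. i \<in> I \<Longrightarrow> ae (Q i)"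
  shows "ae (\<lambda>x. \<forall>i\<in>I. Q i x)"
proof (cases "I = {}")
  case True
  then show ?thesis by (intro ae_all) simp
next
  case False
  let ?F = "(\<lambda>i. {x \<in> Pkappa \<kappa> A. Q i x}) ` I"
  have "?F \<prec> elts \<kappa>" using I image_lepoll lesspoll_trans1 by blast
  moreover have "?F \<subseteq> U" using Q by (auto simp: ae_def)
  moreover have "?F \<noteq> {}" using False by simp
  ultimately have "\<Inter>?F \<in> U" by (intro normal_measureD(6)[OF normal_measure])
  moreover have "\<Inter>?F = {x \<in> Pkappa \<kappa> A. \<forall>i\<in>I. Q i x}" using False by blast
  ultimately show ?thesis by (simp add: ae_def)
qed

lemma countable_less_\<kappa>: "countable I \<Longrightarrow> I \<prec> elts \<kappa>"
  using uncountable_\<kappa> countable_lepoll not_lepoll_iff_lesspoll by blast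

lemma ae_conj: "\<lbrakk>ae Q; ae Q'\<rbrakk> \<Longrightarrow> ae (\<lambda>x. Q x \<and> Q' x)"
proof -
  assume "ae Q" "ae Q'"
  then have "ae (\<lambda>x. \<forall>b\<in>UNIV. (if b then Q else Q') x)"
    by (intro ae_ball_less countable_less_\<kappa>) auto
  then show ?thesis
  proof (rule ae_mono)
    fix x assume "\<forall>b\<in>UNIV. (if b then Q else Q') x"
    from this[rule_format, of True] this[rule_format, of False] show "Q x \<and> Q' x" by simp
  qed
qed

text \<open>Closure under diagonal intersections. Otherwise almost every \<open>x\<close> contains
  an index at which the property fails at \<open>x\<close>; by normality one index \<open>a\<close>
  is chosen almost everywhere, against the assumption for \<open>a\<close>.\<close>

lemma ae_ball:
  assumes "\<And>a. a \<in> elts A \<Longrightarrow> ae (Q a)"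
  shows "ae (\<lambda>x. \<forall>a\<in>elts x. Q a x)"
proof (rule ccontr)
  assume "\<not> ?thesis"
  then have neg: "ae (\<lambda>x. \<exists>a\<in>elts x. \<not> Q a x)" by (rule ae_mono[OF ae_not]) blast
  define f where "f x = (SOME a. a \<in> elts x \<and> \<not> Q a x)" for x
  have f: "f x \<in> elts x \<and> \<not> Q (f x) x" if "\<exists>a\<in>elts x. \<not> Q a x" for x
    unfolding f_def by (rule someI_ex) (use that in blast)
  have "ae (\<lambda>x. f x \<in> elts x)" using neg by (rule ae_mono) (use f in blast)
  then obtain a where a: "a \<in> elts A" "ae (\<lambda>x. f x = a)"
    using normal_measureD(8)[OF normal_measure, of f] unfolding ae_def by blast
  have "ae (\<lambda>x. (\<exists>a\<in>elts x. \<not> Q a x) \<and> f x = a \<and> Q a x)"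
    by (intro ae_conj neg a(2) assms a(1))
  then show False using ae_ex f by blast
qed

text \<open>Diagonal intersection handles one element at a time, so the infinite environment is
  treated through the \<open>K\<close> entries on which \<open>R\<close> depends, by induction on
  \<open>K\<close>.\<close>

lemma ae_env:
  assumes "elts A \<noteq> {}"
    and "\<And>e. range e \<subseteq> elts A \<Longrightarrow> ae (R e)"
    and "\<And>e e' x. (\<And>i. i < K \<Longrightarrow> e i = e' i) \<Longrightarrow> R e x \<longleftrightarrow> R e' x"
  shows "ae (\<lambda>x. \<forall>e::nat \<Rightarrow> 'v. range e \<subseteq> elts x \<longrightarrow> R e x)"
  using assms(2,3)
proof (induction K arbitrary: R)
  case 0
  obtain a where "a \<in> elts A" using assms(1) by blast
  then have "ae (R (\<lambda>_. a))" by (intro 0) auto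
  then show ?case by (rule ae_mono) (use 0(2) in blast)
next
  case (Suc K)
  have "ae (\<lambda>x. \<forall>e. range e \<subseteq> elts x \<longrightarrow> (\<forall>a\<in>elts x. R (e(K := a)) x))"
  proof (rule Suc.IH)
    fix e :: "nat \<Rightarrow> 'v" assume "range e \<subseteq> elts A"
    then show "ae (\<lambda>x. \<forall>a\<in>elts x. R (e(K := a)) x)"
      by (intro ae_ball Suc.prems(1)) auto
  next
    fix e e' :: "nat \<Rightarrow> 'v" and x assume "\<And>i. i < K \<Longrightarrow> e i = e' i"
    then have "R (e(K := a)) x \<longleftrightarrow> R (e'(K := a)) x" for a
      by (intro Suc.prems(2)) (auto simp: less_Suc_eq)
    then show "(\<forall>a\<in>elts x. R (e(K := a)) x) \<longleftrightarrow> (\<forall>a\<in>elts x. R (e'(K := a)) x)" by simp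
  qed
  \<comment> \<open>An environment is recovered as its own update at \<open>K\<close>, with the
    value \<open>e K\<close> in \<open>x\<close>.\<close>
  then show ?case
    by (rule ae_mono) (metis fun_upd_triv range_subsetD)
qed

lemma ae_elem:
  assumes ne: "elts A \<noteq> {}"
  shows "ae (\<lambda>x. elem_substruct (elts x) (elts A))"
proof -
  define R where "R n p e x \<longleftrightarrow> (\<exists>w\<in>elts A. sat (elts A) p (e(n := w))) \<longrightarrow>
    (\<exists>w\<in>elts x. sat (elts A) p (e(n := w)))" for n p e and x :: 'v
  have "ae (\<lambda>x. \<forall>e. range e \<subseteq> elts x \<longrightarrow> R n p e x)" for n p
  proof (rule ae_env[OF ne, of _ "var_bound p"])
    fix e
    show "ae (R n p e)"
    proof (cases "\<exists>w\<in>elts A. sat (elts A) p (e(n := w))")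
      case True
      then obtain w where "w \<in> elts A" "sat (elts A) p (e(n := w))" by blast
      \<comment> \<open>For a fixed environment one witness \<open>w\<close> works for all
        \<open>x\<close>, and \<open>w\<close> is in almost every \<open>x\<close> by
        fineness.\<close>
      then show ?thesis by (intro ae_mono[OF ae_mem]) (auto simp: R_def)
    qed (auto intro: ae_all simp: R_def)
  next
    fix e e' :: "nat \<Rightarrow> 'v" and x assume "\<And>i. i < var_bound p \<Longrightarrow> e i = e' i"
    then have "sat (elts A) p (e(n := w)) \<longleftrightarrow> sat (elts A) p (e'(n := w))" for w
      by (intro sat_cong) auto
    then show "R n p e x \<longleftrightarrow> R n p e' x" by (simp add: R_def)
  qed
  then have "ae (\<lambda>x. \<forall>i\<in>(UNIV :: (nat \<times> fm) set). \<forall>e. range e \<subseteq> elts x \<longrightarrow> R (fst i) (snd i) e x)"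
    by (intro ae_ball_less countable_less_\<kappa>) auto
  then show ?thesis
  proof (rule ae_mono)
    fix x assume x: "x \<in> Pkappa \<kappa> A"
      "\<forall>i\<in>(UNIV :: (nat \<times> fm) set). \<forall>e. range e \<subseteq> elts x \<longrightarrow> R (fst i) (snd i) e x"
    have "R n p e x" if "range e \<subseteq> elts x" for n p e
      using x(2)[rule_format, of "(n, p)"] that by simp
    then show "elem_substruct (elts x) (elts A)"
      unfolding elem_substruct_def R_def using x(1) by (auto simp: Pkappa_def)
  qed
qed

text \<open>Completeness and fineness put all of \<beta> into almost every \<open>x\<close> when
  \<beta> < \<kappa>; diagonal intersection then treats all \<beta> in \<open>x\<close>
  together.\<close>

lemma ae_transitive: "ae (\<lambda>x. \<forall>\<beta>\<in>elts x. \<beta> \<in> elts \<kappa> \<longrightarrow> elts \<beta> \<subseteq> elts x)"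
  if "elts \<kappa> \<subseteq> elts A"
proof (rule ae_ball)
  fix \<beta> assume "\<beta> \<in> elts A"
  show "ae (\<lambda>x. \<beta> \<in> elts \<kappa> \<longrightarrow> elts \<beta> \<subseteq> elts x)"
  proof (cases "\<beta> \<in> elts \<kappa>")
    case True
    then have "elts \<beta> \<subseteq> elts A" using Ord_subset Card_Ord Card_\<kappa> that by blast
    then have "ae (\<lambda>x. \<forall>\<gamma>\<in>elts \<beta>. \<gamma> \<in> elts x)"
      using Card_elt_lesspoll[OF Card_\<kappa> True] by (intro ae_ball_less ae_mem) auto
    then show ?thesis by (rule ae_mono) blast
  qed (simp add: ae_all)
qed

text \<open>The set \<open>y\<close> of all \<open>a\<close> that belong to \<open>d\<^bsub>x \<inter> lam\<^esub>\<close> for almost all \<open>x\<close> satisfies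
  \<open>y \<inter> x = d\<^bsub>x \<inter> lam\<^esub>\<close> for almost all \<open>x\<close>.\<close>

lemma ae_list:
  assumes sub: "\<And>lam y. \<lbrakk>lam \<in> elts A; elts y \<subseteq> elts lam\<rbrakk> \<Longrightarrow> y \<in> elts A"
  shows "ae (\<lambda>x. \<forall>lam\<in>elts x. \<forall>d\<in>elts x. is_list (Pkappa \<kappa> lam) d \<longrightarrow>
    (\<exists>y\<in>elts x. elts y \<inter> elts x = elts (app d (mkset (elts x \<inter> elts lam))) \<inter> elts x))"
proof (intro ae_ball)
  fix lam d assume lam: "lam \<in> elts A" and d: "d \<in> elts A"
  show "ae (\<lambda>x. is_list (Pkappa \<kappa> lam) d \<longrightarrow>
    (\<exists>y\<in>elts x. elts y \<inter> elts x = elts (app d (mkset (elts x \<inter> elts lam))) \<inter> elts x))"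
  proof (cases "is_list (Pkappa \<kappa> lam) d")
    case True
    define D where "D x = app d (mkset (elts x \<inter> elts lam))" for x
    have D: "elts (D x) \<subseteq> elts lam" if "x \<in> Pkappa \<kappa> A" for x
    proof -
      have sm: "small (elts x \<inter> elts lam)" by (rule small_subset[OF small_elts[of x]]) auto
      have "elts x \<inter> elts lam \<prec> elts \<kappa>"
        using that lesspoll_trans1[OF subset_imp_lepoll[of "elts x \<inter> elts lam" "elts x"]]
        by (auto simp: Pkappa_def)
      then have "mkset (elts x \<inter> elts lam) \<in> Pkappa \<kappa> lam" using sm by (simp add: Pkappa_def)
      then show ?thesis using is_list_app_subset[OF True] sm by (fastforce simp: D_def)
    qed
    define y where "y = mkset {a \<in> elts lam. ae (\<lambda>x. a \<in> elts (D x))}"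
    have y: "elts y = {a \<in> elts lam. ae (\<lambda>x. a \<in> elts (D x))}"
      unfolding y_def by (rule elts_mkset, rule small_subset[OF small_elts[of lam]]) auto
    \<comment> \<open>The closure assumption on \<open>A\<close> is used here: \<open>y\<close> must
      be an element of \<open>A\<close> for fineness to place it in almost every
      \<open>x\<close>.\<close>
    have yA: "y \<in> elts A" by (rule sub[OF lam]) (auto simp: y)
    have "ae (\<lambda>x. \<forall>a\<in>elts x. a \<in> elts y \<longleftrightarrow> a \<in> elts (D x))"
    proof (rule ae_ball)
      fix a
      show "ae (\<lambda>x. a \<in> elts y \<longleftrightarrow> a \<in> elts (D x))"
      proof (cases "a \<in> elts y")
        case True
        then have "ae (\<lambda>x. a \<in> elts (D x))" by (simp add: y)
        then show ?thesis by (rule ae_mono) (use True in simp)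
      next
        case False
        then consider "a \<notin> elts lam" | "ae (\<lambda>x. a \<notin> elts (D x))" using ae_not by (auto simp: y)
        then show ?thesis
        proof cases
          case 1
          then show ?thesis using D False by (intro ae_all) blast
        next
          case 2
          then show ?thesis by (rule ae_mono) (use False in simp)
        qed
      qed
    qed
    then have "ae (\<lambda>x. y \<in> elts x \<and> (\<forall>a\<in>elts x. a \<in> elts y \<longleftrightarrow> a \<in> elts (D x)))"
      by (intro ae_conj ae_mem yA)
    then show ?thesis
    proof (rule ae_mono)
      fix x assume "y \<in> elts x \<and> (\<forall>a\<in>elts x. a \<in> elts y \<longleftrightarrow> a \<in> elts (D x))"
      then have "y \<in> elts x" "elts y \<inter> elts x = elts (D x) \<inter> elts x" by blast+
      then show "is_list (Pkappa \<kappa> lam) d \<longrightarrow>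
          (\<exists>y\<in>elts x. elts y \<inter> elts x = elts (app d (mkset (elts x \<inter> elts lam))) \<inter> elts x)"
        unfolding D_def by blast
    qed
  qed (simp add: ae_all)
qed

end

text \<open>The elements \<open>a\<close> and \<open>b\<close> enter the range by fineness. For (ii)
  they are the prescribed \<open>lam\<close> and \<open>d\<close>; for (iii) both are
  \<kappa>.\<close>

lemma supercompact_small_embedding:
  fixes \<kappa> \<theta> :: "'v::zfc_universe"
  assumes "supercompact \<kappa>" and \<theta>: "Card \<theta>" "\<kappa> \<in> elts \<theta>" and ab: "a \<in> Hset \<theta>" "b \<in> Hset \<theta>"
  shows "\<exists>M j. small_embedding \<kappa> \<theta> M j \<and> elts M \<prec> elts \<kappa> \<and>
    a \<in> emb_range M j \<and> b \<in> emb_range M j \<and>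
    (\<forall>lam d. is_list (Pkappa \<kappa> lam) d \<and> lam \<in> emb_range M j \<and> d \<in> emb_range M j \<longrightarrow>
      list_preimage M j lam d \<in> elts M)"
proof -
  define A where "A = mkset (Hset \<theta>)"
  have A: "elts A = Hset \<theta>" by (simp add: A_def small_Hset)
  have \<kappa>A: "\<kappa> \<in> elts A" using Hset_Card_elt[OF \<theta>] by (simp add: A)
  then have sub: "elts \<kappa> \<subseteq> elts A" using Hset_trans by (auto simp: A)
  have \<kappa>: "Card \<kappa>" "uncountable (elts \<kappa>)" using assms(1) by (auto simp: supercompact_def)
  obtain U where "normal_measure \<kappa> A U"
    using assms(1) sub subset_imp_lepoll unfolding supercompact_def by blast
  then interpret nmeasure \<kappa> A U using \<kappa> by unfold_locales
  have "ae (\<lambda>x. elem_substruct (elts x) (elts A) \<and> (\<forall>\<beta>\<in>elts x. \<beta> \<in> elts \<kappa> \<longrightarrow> elts \<beta> \<subseteq> elts x) \<and>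
      \<kappa> \<in> elts x \<and> a \<in> elts x \<and> b \<in> elts x \<and>
      (\<forall>lam\<in>elts x. \<forall>d\<in>elts x. is_list (Pkappa \<kappa> lam) d \<longrightarrow>
        (\<exists>y\<in>elts x. elts y \<inter> elts x = elts (app d (mkset (elts x \<inter> elts lam))) \<inter> elts x)))"
  proof (intro ae_conj ae_elem ae_transitive ae_mem ae_list)
    fix lam y assume "lam \<in> elts A" "elts y \<subseteq> elts lam"
    then show "y \<in> elts A" using Hset_subset by (simp add: A)
  qed (use \<kappa>A sub ab A in auto)
  then obtain x where x: "x \<in> Pkappa \<kappa> A" "elem_substruct (elts x) (Hset \<theta>)"
      "\<forall>\<beta>\<in>elts x. \<beta> \<in> elts \<kappa> \<longrightarrow> elts \<beta> \<subseteq> elts x" "\<kappa> \<in> elts x" "a \<in> elts x" "b \<in> elts x"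
    and L: "\<forall>lam\<in>elts x. \<forall>d\<in>elts x. is_list (Pkappa \<kappa> lam) d \<longrightarrow>
        (\<exists>y\<in>elts x. elts y \<inter> elts x = elts (app d (mkset (elts x \<inter> elts lam))) \<inter> elts x)"
    using ae_ex unfolding A by blast
  have "elts x \<prec> elts \<kappa>" using x(1) by (simp add: Pkappa_def)
  then obtain M j where "small_embedding \<kappa> \<theta> M j" "elts M \<prec> elts \<kappa>" "emb_range M j = elts x"
    and "\<And>lam d y. \<lbrakk>y \<in> elts x; elts y \<inter> elts x = elts (app d (mkset (elts x \<inter> elts lam))) \<inter> elts x\<rbrakk> \<Longrightarrow>
      list_preimage M j lam d \<in> elts M"
    using small_embedding_of_elem[OF \<kappa>(1) \<theta> x(2,4)] x(3) by metis
  then show ?thesis using x(5,6) L by metis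
qed

subsection \<open>Cardinals without a normal measure\<close>

text \<open>A failure of supercompactness as seen by \<open>N\<close>, built from notions definable
  over \<open>N\<close> so that elementarity can move it. The conditions on \<open>lam\<close> and
  \<open>d\<close> make (iii) applicable to a counterexample found in the range.\<close>

definition unmeasured_list :: "'v set \<Rightarrow> 'v \<Rightarrow> 'v \<Rightarrow> 'v \<Rightarrow> 'v::zfc_universe \<Rightarrow> bool" where
  "unmeasured_list N A d lam \<kappa> \<longleftrightarrow> Card lam \<and> is_list (Pkappa \<kappa> lam) d \<and> elts \<kappa> \<subseteq> elts A \<and>
    elts A \<subseteq> elts lam \<and> codes_all N \<kappa> lam A d \<and> (\<forall>U\<in>N. \<not> nm_code N \<kappa> A U)"

lemma (in pow_class) definable_unmeasured_list: "definable N (\<lambda>e. unmeasured_list N (e i) (e j) (e k) (e l))"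
  unfolding unmeasured_list_def
  by (intro definable_basic definable_Card definable_is_list definable_subset definable_codes_all definable_nm_code)

text \<open>Only \<open>lam\<close> and \<open>d\<close> are known to lie in the range. Elementarity
  replaces \<open>A\<close> by some \<open>A'\<close> there, and the measure coded from the list
  contradicts the choice of \<open>A'\<close>.\<close>

lemma not_unmeasured_list_in_range:
  assumes E: "small_embedding \<kappa> \<theta> M j" "elts M \<prec> elts \<kappa>" and N: "pow_class (Hset \<theta>)"
    and lam: "lam \<in> emb_range M j" and d: "d \<in> emb_range M j"
    and pre: "list_preimage M j lam d \<in> elts M"
    and A: "A \<in> Hset \<theta>" "unmeasured_list (Hset \<theta>) A d lam \<kappa>"
  shows False
proof -
  interpret pow_class "Hset \<theta>" by (rule N)
  note X = small_embedding_range(1)[OF E(1)]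
  have "\<exists>A\<in>emb_range M j. unmeasured_list (Hset \<theta>) A d lam \<kappa>"
  proof (rule elem_substruct_bex[OF X, of "\<lambda>A d lam \<kappa> _. unmeasured_list (Hset \<theta>) A d lam \<kappa>" d lam \<kappa> \<kappa>])
    show "definable (Hset \<theta>) (\<lambda>e. unmeasured_list (Hset \<theta>) (e 0) (e 1) (e 2) (e 3))" by (rule definable_unmeasured_list)
  qed (use A lam d small_embedding_range(2)[OF E(1)] in auto)
  then obtain A' where A': "A' \<in> emb_range M j" "unmeasured_list (Hset \<theta>) A' d lam \<kappa>" by blast
  have "\<exists>U\<in>Hset \<theta>. nm_code (Hset \<theta>) \<kappa> A' U"
    using A'(2) unfolding unmeasured_list_def
    by (intro small_embedding_nm_code[OF E N _ _ lam A'(1) d _ _ pre]) auto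
  then show False using A'(2) by (simp add: unmeasured_list_def)
qed

text \<open>Under (iii) the embedding is given without regard to a particular list. Since \<kappa>
  is in the range, elementarity yields first a suitable \<open>lam\<close> and then a suitable
  \<open>d\<close> in the range.\<close>

lemma unmeasured_list_in_range:
  assumes E: "small_embedding \<kappa> \<theta> M j" and N: "pow_class (Hset \<theta>)"
    and bad: "unmeasured_list (Hset \<theta>) A d lam \<kappa>" and inN: "A \<in> Hset \<theta>" "d \<in> Hset \<theta>" "lam \<in> Hset \<theta>"
  shows "\<exists>lam\<in>emb_range M j. \<exists>d\<in>emb_range M j. \<exists>A\<in>Hset \<theta>. unmeasured_list (Hset \<theta>) A d lam \<kappa>"
proof -
  interpret pow_class "Hset \<theta>" by (rule N)
  note X = small_embedding_range(1)[OF E] and \<kappa>X = small_embedding_range(2)[OF E]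
  have "\<exists>lam\<in>emb_range M j. \<exists>d\<in>Hset \<theta>. \<exists>A\<in>Hset \<theta>. unmeasured_list (Hset \<theta>) A d lam \<kappa>"
  proof (rule elem_substruct_bex[OF X, of "\<lambda>lam \<kappa> _ _ _. \<exists>d\<in>Hset \<theta>. \<exists>A\<in>Hset \<theta>. unmeasured_list (Hset \<theta>) A d lam \<kappa>" \<kappa> \<kappa> \<kappa> \<kappa>])
    show "definable (Hset \<theta>) (\<lambda>e. \<exists>d\<in>Hset \<theta>. \<exists>A\<in>Hset \<theta>. unmeasured_list (Hset \<theta>) A d (e 0) (e 1))"
      by (intro definable_basic definable_unmeasured_list)
  qed (use bad inN \<kappa>X in auto)
  then obtain lam where lam: "lam \<in> emb_range M j"
      "\<exists>d\<in>Hset \<theta>. \<exists>A\<in>Hset \<theta>. unmeasured_list (Hset \<theta>) A d lam \<kappa>" by blast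
  have "\<exists>d\<in>emb_range M j. \<exists>A\<in>Hset \<theta>. unmeasured_list (Hset \<theta>) A d lam \<kappa>"
  proof (rule elem_substruct_bex[OF X, of "\<lambda>d lam \<kappa> _ _. \<exists>A\<in>Hset \<theta>. unmeasured_list (Hset \<theta>) A d lam \<kappa>" lam \<kappa> \<kappa> \<kappa>])
    show "definable (Hset \<theta>) (\<lambda>e. \<exists>A\<in>Hset \<theta>. unmeasured_list (Hset \<theta>) A (e 0) (e 1) (e 2))"
      by (intro definable_basic definable_unmeasured_list)
  qed (use lam \<kappa>X in auto)
  then show ?thesis using lam(1) by blast
qed

text \<open>A measure code in H(\<theta>) would give a true normal measure. The bound \<alpha> is
  quantified after \<open>lam\<close> and \<open>d\<close>, matching the dependence of the bound on
  \<open>lam\<close> in (ii).\<close>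

lemma ex_unmeasured_list:
  assumes \<kappa>: "Card \<kappa>" and A: "Card A" "elts \<kappa> \<subseteq> elts A" "\<nexists>U. normal_measure \<kappa> A U"
  obtains lam d where "Card lam" "elts \<kappa> \<subseteq> elts lam" "is_list (Pkappa \<kappa> lam) d"
    "\<And>\<alpha>. Ord \<alpha> \<Longrightarrow> \<exists>\<theta>. Card \<theta> \<and> \<alpha> \<in> elts \<theta> \<and> pow_class (Hset \<theta>) \<and>
      A \<in> Hset \<theta> \<and> d \<in> Hset \<theta> \<and> lam \<in> Hset \<theta> \<and> unmeasured_list (Hset \<theta>) A d lam \<kappa>"
proof -
  obtain lam d where lam: "Card lam" "elts A \<subseteq> elts lam" "is_list (Pkappa \<kappa> lam) d"
    and codes: "\<And>N. \<lbrakk>trans_class N; A \<in> N\<rbrakk> \<Longrightarrow> codes_all N \<kappa> lam A d"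
    using ex_coding_list[OF A(1), of \<kappa>] by blast
  have "\<exists>\<theta>. Card \<theta> \<and> \<alpha> \<in> elts \<theta> \<and> pow_class (Hset \<theta>) \<and>
      A \<in> Hset \<theta> \<and> d \<in> Hset \<theta> \<and> lam \<in> Hset \<theta> \<and> unmeasured_list (Hset \<theta>) A d lam \<kappa>" if \<alpha>: "Ord \<alpha>" for \<alpha>
  proof -
    let ?z = "mkset (insert A {d, lam})"
    obtain \<theta> where \<theta>: "Card \<theta>" "\<alpha> \<in> elts \<theta>" "?z \<in> Hset \<theta>" "pow_class (Hset \<theta>)"
      using ex_strong_limit_Hset[OF \<alpha>] by blast
    interpret pow_class "Hset \<theta>" by (rule \<theta>(4))
    have inN: "A \<in> Hset \<theta>" "d \<in> Hset \<theta>" "lam \<in> Hset \<theta>"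
      using Hset_trans[OF \<theta>(3)] by (simp_all add: small_insert)
    have "\<not> nm_code (Hset \<theta>) \<kappa> A U" if "U \<in> Hset \<theta>" for U
      using normal_measure_nm_code[OF \<kappa> A(2) inN(1) that] A(3) by blast
    then have "unmeasured_list (Hset \<theta>) A d lam \<kappa>"
      unfolding unmeasured_list_def using lam A codes[OF trans_class_axioms inN(1)] by blast
    then show ?thesis using \<theta> inN by blast
  qed
  then show thesis using that[of lam d] lam A(2) by blast
qed

theorem corollary5p14:
  fixes \<kappa> :: "'v::zfc_universe"
  assumes "Card \<kappa>"
  shows
    "(supercompact \<kappa> \<longleftrightarrow>
        (\<forall>lam. Card lam \<and> elts \<kappa> \<subseteq> elts lam \<longrightarrow>
          sufficiently_large_cardinals \<kappa> (\<lambda>\<theta>.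
            \<forall>d. is_list (Pkappa \<kappa> lam) d \<longrightarrow>
              (\<exists>M j. small_embedding \<kappa> \<theta> M j \<and> elts M \<prec> elts \<kappa> \<and>
                     lam \<in> emb_range M j \<and> d \<in> emb_range M j \<and>
                     list_preimage M j lam d \<in> elts M))))
     \<and>
     (supercompact \<kappa> \<longleftrightarrow>
        sufficiently_large_cardinals \<kappa> (\<lambda>\<theta>.
          \<exists>M j. small_embedding \<kappa> \<theta> M j \<and> elts M \<prec> elts \<kappa> \<and>
            (\<forall>lam d. Card lam \<and> elts \<kappa> \<subseteq> elts lam \<and> is_list (Pkappa \<kappa> lam) d \<and>
                     lam \<in> emb_range M j \<and> d \<in> emb_range M j \<longrightarrow>
                     list_preimage M j lam d \<in> elts M)))"
    (is "(_ \<longleftrightarrow> ?ii) \<and> (_ \<longleftrightarrow> ?iii)")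
proof -
  have O\<kappa>: "Ord \<kappa>" using assms by (rule Card_Ord)
  have i_ii: ?ii if sc: "supercompact \<kappa>"
  proof (intro allI impI)
    fix lam assume lam: "Card lam \<and> elts \<kappa> \<subseteq> elts lam"
    \<comment> \<open>Every list on P_kappa(lam) is a subset of \<open>?T\<close>, so one bound on
      \<theta> serves all of them.\<close>
    let ?T = "mkset {kpair a b |a b. a \<in> elts (pow lam) \<and> b \<in> elts (pow lam)}"
    have T: "elts ?T = {kpair a b |a b. a \<in> elts (pow lam) \<and> b \<in> elts (pow lam)}"
      by (intro elts_mkset small_times small_elts)
    have dT: "d \<in> elts (pow ?T)" if "is_list (Pkappa \<kappa> lam) d" for d
    proof -
      have "z \<in> elts ?T" if z: "z \<in> elts d" for z
      proof -
        obtain a b where "z = kpair a b" "a \<in> Pkappa \<kappa> lam" "elts b \<subseteq> elts a"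
          using \<open>is_list (Pkappa \<kappa> lam) d\<close> z unfolding is_list_iff by blast
        then show ?thesis unfolding T by (auto simp: Pkappa_def)
      qed
      then show ?thesis by (simp add: subset_iff)
    qed
    let ?z = "mkset {pow ?T, lam}"
    have e: "elts (mkset (TC ?z \<union> elts \<kappa>)) = TC ?z \<union> elts \<kappa>"
      by (intro elts_mkset small_Un small_TC small_elts)
    obtain \<alpha> :: 'v where \<alpha>: "Ord \<alpha>" "elts \<alpha> \<approx> TC ?z \<union> elts \<kappa>"
      using ex_Ord_eqpoll[of "mkset (TC ?z \<union> elts \<kappa>)"] unfolding e by blast
    have \<alpha>': "TC ?z \<union> elts \<kappa> \<lesssim> elts \<alpha>"
      using eqpoll_imp_lepoll[OF eqpoll_sym[OF \<alpha>(2)]] .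
    have "elts \<kappa> \<lesssim> elts \<alpha>"
      using lepoll_trans[OF subset_imp_lepoll \<alpha>'] by blast
    then have \<kappa>\<alpha>: "elts \<kappa> \<subseteq> elts \<alpha>" using lepoll_Card_subset assms \<alpha>(1) by blast
    show "sufficiently_large_cardinals \<kappa> (\<lambda>\<theta>. \<forall>d. is_list (Pkappa \<kappa> lam) d \<longrightarrow>
        (\<exists>M j. small_embedding \<kappa> \<theta> M j \<and> elts M \<prec> elts \<kappa> \<and>
          lam \<in> emb_range M j \<and> d \<in> emb_range M j \<and> list_preimage M j lam d \<in> elts M))"
      unfolding sufficiently_large_cardinals_def
    proof (rule exI[of _ \<alpha>], intro conjI \<alpha>(1) \<kappa>\<alpha> allI impI)
      fix \<theta> d assume \<theta>: "Card \<theta> \<and> \<alpha> \<in> elts \<theta>" and d: "is_list (Pkappa \<kappa> lam) d"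
      have "TC ?z \<lesssim> elts \<alpha>" using lepoll_trans[OF subset_imp_lepoll \<alpha>'] by blast
      then have "TC ?z \<prec> elts \<theta>" using \<theta> Card_elt_lesspoll[of \<theta> \<alpha>] lesspoll_trans1 by blast
      then have z: "?z \<in> Hset \<theta>" unfolding Hset_def by (rule CollectI)
      have "lam \<in> Hset \<theta>" "pow ?T \<in> Hset \<theta>" by (rule Hset_trans[OF z]; simp)+
      moreover have "d \<in> Hset \<theta>" using Hset_trans[OF \<open>pow ?T \<in> Hset \<theta>\<close> dT[OF d]] .
      moreover have "\<kappa> \<in> elts \<theta>"
        using \<theta> \<kappa>\<alpha> Ord_not_mem_iff[OF O\<kappa> Card_Ord] mem_not_refl[of \<alpha>] by blast
      ultimately show "\<exists>M j. small_embedding \<kappa> \<theta> M j \<and> elts M \<prec> elts \<kappa> \<and>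
          lam \<in> emb_range M j \<and> d \<in> emb_range M j \<and> list_preimage M j lam d \<in> elts M"
        using supercompact_small_embedding[OF sc, of \<theta> lam d] \<theta> d by blast
    qed
  qed
  have i_iii: ?iii if sc: "supercompact \<kappa>"
    unfolding sufficiently_large_cardinals_def
  \<comment> \<open>No list is prescribed in (iii), so \<kappa> itself is a sufficient
    bound.\<close>
  proof (rule exI[of _ \<kappa>], intro conjI O\<kappa> order_refl allI impI)
    fix \<theta> assume \<theta>: "Card \<theta> \<and> \<kappa> \<in> elts \<theta>"
    then have "\<kappa> \<in> Hset \<theta>" using Hset_Card_elt by blast
    then show "\<exists>M j. small_embedding \<kappa> \<theta> M j \<and> elts M \<prec> elts \<kappa> \<and>
        (\<forall>lam d. Card lam \<and> elts \<kappa> \<subseteq> elts lam \<and> is_list (Pkappa \<kappa> lam) d \<and>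
          lam \<in> emb_range M j \<and> d \<in> emb_range M j \<longrightarrow> list_preimage M j lam d \<in> elts M)"
      using supercompact_small_embedding[OF sc, of \<theta> \<kappa> \<kappa>] \<theta> by blast
  qed
  have ii_i: "supercompact \<kappa>" if ii: ?ii
  proof (rule supercompactI[OF assms])
    have ii': "\<exists>\<alpha>. Ord \<alpha> \<and> (\<forall>\<theta> d. Card \<theta> \<and> \<alpha> \<in> elts \<theta> \<and> is_list (Pkappa \<kappa> lam) d \<longrightarrow>
        (\<exists>M j. small_embedding \<kappa> \<theta> M j \<and> elts M \<prec> elts \<kappa> \<and>
          lam \<in> emb_range M j \<and> d \<in> emb_range M j \<and> list_preimage M j lam d \<in> elts M))"
      if "Card lam" "elts \<kappa> \<subseteq> elts lam" for lam
      using ii that unfolding sufficiently_large_cardinals_def by blast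
    show "uncountable (elts \<kappa>)"
    proof -
      \<comment> \<open>Condition (ii) produces an embedding only for a given list; the coding list
        for \<kappa> serves as an example.\<close>
      obtain lam d where lam: "Card lam" "elts \<kappa> \<subseteq> elts lam" "is_list (Pkappa \<kappa> lam) d"
        using ex_coding_list[OF assms, of \<kappa>] by blast
      obtain \<alpha> where \<alpha>: "Ord \<alpha>"
        "\<And>\<theta> d. \<lbrakk>Card \<theta>; \<alpha> \<in> elts \<theta>; is_list (Pkappa \<kappa> lam) d\<rbrakk> \<Longrightarrow> \<exists>M j. small_embedding \<kappa> \<theta> M j"
        using ii'[OF lam(1,2)] by blast
      obtain \<theta> where "Card \<theta>" "\<alpha> \<in> elts \<theta>" using ex_strong_limit_Hset[OF \<alpha>(1)] by blast
      then show ?thesis using \<alpha>(2) lam(3) small_embedding_uncountable by blast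
    qed
    fix A assume A: "Card A" "elts \<kappa> \<subseteq> elts A"
    show "\<exists>U. normal_measure \<kappa> A U"
    proof (rule ccontr)
      assume "\<nexists>U. normal_measure \<kappa> A U"
      then obtain lam d where lam: "Card lam" "elts \<kappa> \<subseteq> elts lam" "is_list (Pkappa \<kappa> lam) d"
        and bad: "\<And>\<alpha>. Ord \<alpha> \<Longrightarrow> \<exists>\<theta>. Card \<theta> \<and> \<alpha> \<in> elts \<theta> \<and> pow_class (Hset \<theta>) \<and>
          A \<in> Hset \<theta> \<and> d \<in> Hset \<theta> \<and> lam \<in> Hset \<theta> \<and> unmeasured_list (Hset \<theta>) A d lam \<kappa>"
        using ex_unmeasured_list[OF assms A] by metis
      obtain \<alpha> where \<alpha>: "Ord \<alpha>" and emb: "\<forall>\<theta> d. Card \<theta> \<and> \<alpha> \<in> elts \<theta> \<and> is_list (Pkappa \<kappa> lam) d \<longrightarrow>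
        (\<exists>M j. small_embedding \<kappa> \<theta> M j \<and> elts M \<prec> elts \<kappa> \<and>
          lam \<in> emb_range M j \<and> d \<in> emb_range M j \<and> list_preimage M j lam d \<in> elts M)"
        using ii'[OF lam(1,2)] by blast
      obtain \<theta> where \<theta>: "Card \<theta>" "\<alpha> \<in> elts \<theta>" "pow_class (Hset \<theta>)" "A \<in> Hset \<theta>"
        "unmeasured_list (Hset \<theta>) A d lam \<kappa>" using bad[OF \<alpha>] by blast
      obtain M j where "small_embedding \<kappa> \<theta> M j" "elts M \<prec> elts \<kappa>" "lam \<in> emb_range M j"
        "d \<in> emb_range M j" "list_preimage M j lam d \<in> elts M"
        using emb \<theta>(1,2) lam(3) by blast
      then show False using not_unmeasured_list_in_range \<theta>(3-5) by blast
    qed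
  qed
  have iii_i: "supercompact \<kappa>" if iii: ?iii
  proof (rule supercompactI[OF assms])
    obtain \<alpha> where \<alpha>: "Ord \<alpha>" and emb: "\<forall>\<theta>. Card \<theta> \<and> \<alpha> \<in> elts \<theta> \<longrightarrow>
        (\<exists>M j. small_embedding \<kappa> \<theta> M j \<and> elts M \<prec> elts \<kappa> \<and>
          (\<forall>lam d. Card lam \<and> elts \<kappa> \<subseteq> elts lam \<and> is_list (Pkappa \<kappa> lam) d \<and>
            lam \<in> emb_range M j \<and> d \<in> emb_range M j \<longrightarrow> list_preimage M j lam d \<in> elts M))"
      using iii unfolding sufficiently_large_cardinals_def by blast
    obtain \<theta> where "Card \<theta>" "\<alpha> \<in> elts \<theta>" using ex_strong_limit_Hset[OF \<alpha>] by blast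
    then show "uncountable (elts \<kappa>)" using emb small_embedding_uncountable by blast
    fix A assume A: "Card A" "elts \<kappa> \<subseteq> elts A"
    show "\<exists>U. normal_measure \<kappa> A U"
    proof (rule ccontr)
      assume "\<nexists>U. normal_measure \<kappa> A U"
      then obtain lam d where
        bad: "\<And>\<alpha>. Ord \<alpha> \<Longrightarrow> \<exists>\<theta>. Card \<theta> \<and> \<alpha> \<in> elts \<theta> \<and> pow_class (Hset \<theta>) \<and>
          A \<in> Hset \<theta> \<and> d \<in> Hset \<theta> \<and> lam \<in> Hset \<theta> \<and> unmeasured_list (Hset \<theta>) A d lam \<kappa>"
        using ex_unmeasured_list[OF assms A] by metis
      obtain \<theta> where \<theta>: "Card \<theta>" "\<alpha> \<in> elts \<theta>" "pow_class (Hset \<theta>)" "A \<in> Hset \<theta>" "d \<in> Hset \<theta>"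
        "lam \<in> Hset \<theta>" "unmeasured_list (Hset \<theta>) A d lam \<kappa>" using bad[OF \<alpha>] by blast
      obtain M j where E: "small_embedding \<kappa> \<theta> M j" "elts M \<prec> elts \<kappa>"
        and pre: "\<And>lam d. \<lbrakk>Card lam; elts \<kappa> \<subseteq> elts lam; is_list (Pkappa \<kappa> lam) d;
            lam \<in> emb_range M j; d \<in> emb_range M j\<rbrakk> \<Longrightarrow> list_preimage M j lam d \<in> elts M"
        using emb \<theta>(1,2) by blast
      obtain lam' d' A' where *: "lam' \<in> emb_range M j" "d' \<in> emb_range M j" "A' \<in> Hset \<theta>"
        "unmeasured_list (Hset \<theta>) A' d' lam' \<kappa>"
        using unmeasured_list_in_range[OF E(1) \<theta>(3,7,4-6)] by blast
      have "list_preimage M j lam' d' \<in> elts M"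
        by (rule pre[OF _ _ _ *(1,2)]) (use *(4) in \<open>auto simp: unmeasured_list_def\<close>)
      then show False using not_unmeasured_list_in_range[OF E \<theta>(3)] * by blast
    qed
  qed
  show ?thesis using i_ii i_iii ii_i iii_i by blast
qed

end
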